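(* Let $m$ and $n$ be non-negative integers. Then, as polynomials in the variables $t=(t_1,t_2,t_3,\ldots)$, $$\sum_{\mu \in I_1^n(c_m)}\delta(\mu)\, Q_{\mu[0]}(t)\, S_{\mu[1]}(t^{(2)}) = S_{\square(2m-n,\,n)}(t),$$ $$\sum_{\mu \in I_0^n(c_{-m})}\delta(\mu)\, Q_{\mu[0]}(t)\, S_{\mu[1]}(t^{(2)}) = S_{\square(n,\,2m+1-n)}(t).$$ Here, whenever the index set $I_1^n(c_m)$ (respectively $I_0^n(c_{-m})$) is empty, both sides of the corresponding identity are understood to be $0$.
   Context: Partitions. A partition is a non-increasing sequence of non-negative integers with finitely many non-zero terms; sequences differing only by trailing zeros are identified; $\ell(\lambda)$ is the number of non-zero parts. A partition is strict if its non-zero parts are distinct; $\mathcal{SP}$ is the set of strict partitions. Young diagrams are the ordinary (unshifted) ones. $\square(a,b)$ denotes the rectangular partition $(b^a)$ ($a$ rows of length $b$; it is $\emptyset$ if $a=0$ or $b=0$). Colors. A node in the $j$-th column has color $0$ if $j\equiv 0,1 \pmod 4$ and color $1$ if $j\equiv 2,3\pmod 4$. For $\lambda\in\mathcal{SP}$, $i\in\{0,1\}$, $\ell\ge 0$, $$I_i^\ell(\lambda)=\{\mu\in\mathcal{SP} : \mu\supset\lambda,\ |\mu|=|\lambda|+\ell,\ \text{every node of }\mu-\lambda\text{ has color } i\}.$$ Cores. For $k\in\mathbb{Z}$: $c_k=(4k-3,\ldots,5,1)$ if $k>0$, $c_0=\emptyset$, $c_k=(-4k-1,\ldots,7,3)$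 if $k<0$. (One has $I_1^\ell(c_m)=\emptyset$ for $m>0,\ \ell>2m$, and $I_0^\ell(c_{-m})=\emptyset$ for $m>0,\ \ell>2m+1$.) 4-bar quotient. For $\lambda\in\mathcal{SP}$, $\lambda[0]$ is the strict partition whose parts are the halves of the non-zero even parts of $\lambda$. Let $$\mathcal{M}(\lambda)=\{k\ge 0 : 4k+1 \text{ is a part of }\lambda\}\cup\bigl(\mathbb{Z}_{<0}\setminus\{-k-1 : k\ge0,\ 4k+3\text{ is a part of }\lambda\}\bigr),$$ write its elements in decreasing order $i_1>i_2>\cdots$, and let $r=\#\{\text{parts}\equiv 1 \bmod 4\}-\#\{\text{parts}\equiv 3\bmod 4\}$ (so $i_k=-k+r$ for $k$ large). Then $\lambda[1]=(i_1+1-r,\,i_2+2-r,\,i_3+3-r,\ldots)$, a partition. Sign. For $\lambda\in I_i^\ell(c_k)$ ($k\in\mathbb{Z}$, $i\in\{0,1\}$), place beads at the positions given by the non-zero parts of $\lambda$, and in addition place a bead at position $0$ if and only if $k<0$ and $\lambda_{-k+1}=0$. Let $g(\lambda)$ be the number of pairs (bead at an even position $p$, bead at a position $q\equiv 1\bmod 4$) with $q>p$. Then $\delta(\lambda)=(-1)^{g(\lambda)}$. In the first sum $\delta$ is computed with $k=m$, in the second with $k=-m$. Schur functions. $h_n(t)$ is defined by $\exp(\sum_{n\ge1}t_nz^n)=\sum_{n\ge 0}h_n(t)z^n$ (with $h_n=0$ for $n<0$), and $S_\lambda(t)=\det(h_{\lambda_i+j-i}(t))$. Set $S_\nu(t^{(2)})=S_\nu(t_2,t_4,t_6,\ldots)$,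 i.e. $S_\nu(u)$ with $u_j$ replaced by $t_{2j}$. $Q$-functions. $q_n(t)$ is defined by $\exp(\sum_{n\ge1}t_{2n-1}z^{2n-1})=\sum_{n\ge0}q_n(t)z^n$. For $a>b\ge 0$, $Q_{a,b}=q_aq_b+2\sum_{i=1}^{b}(-1)^iq_{a+i}q_{b-i}$; for $a\le b$, $Q_{a,b}=-Q_{b,a}$ (so $Q_{a,a}=0$). For a strict partition written as $\lambda=(\lambda_1>\cdots>\lambda_{2k}\ge 0)$ (adding one zero if $\ell(\lambda)$ is odd), $Q_\lambda(t)=\mathrm{Pf}(Q_{\lambda_i,\lambda_j})_{1\le i,j\le 2k}$, with $Q_\emptyset=1$. *)

theory Defs
  imports
    "HOL-Library.Poly_Mapping"
    "HOL-Combinatorics.Permutations"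
    "HOL-Computational_Algebra.Formal_Power_Series"
    "Jordan_Normal_Form.Determinant"
begin

text \<open>
  A partition is an infinite sequence indexed from 0, so the part written
  \<open>\<lambda>\<^sub>i\<close> with \<open>i \<ge> 1\<close> is \<open>lam (i - 1)\<close>.  Sequences differing only by
  trailing zeros are then literally equal.
\<close>

definition is_partition :: "(nat \<Rightarrow> nat) \<Rightarrow> bool" where
  "is_partition lam \<longleftrightarrow> antimono lam \<and> finite {i. lam i \<noteq> 0}"

definition strict_partitions :: "(nat \<Rightarrow> nat) set" where
  "strict_partitions = {lam. is_partition lam \<and> inj_on lam {i. lam i \<noteq> 0}}"

definition part_length :: "(nat \<Rightarrow> nat) \<Rightarrow> nat" where
  "part_length lam = card {i. lam i \<noteq> 0}"

definition part_size :: "(nat \<Rightarrow> nat) \<Rightarrow> nat" where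
  "part_size lam = (\<Sum>i | lam i \<noteq> 0. lam i)"

text \<open>A set loses multiplicities, so this is only meant for strict partitions.\<close>

definition nonzero_parts :: "(nat \<Rightarrow> nat) \<Rightarrow> nat set" where
  "nonzero_parts lam = range lam - {0}"

text \<open>The node \<open>(i, j)\<close> is in row \<open>i \<ge> 0\<close> (numbered like the parts) and column \<open>j \<ge> 1\<close>.\<close>

definition young_diagram :: "(nat \<Rightarrow> nat) \<Rightarrow> (nat \<times> nat) set" where
  "young_diagram lam = {(i, j). 1 \<le> j \<and> j \<le> lam i}"

definition rect_partition :: "nat \<Rightarrow> nat \<Rightarrow> nat \<Rightarrow> nat" where
  "rect_partition a b = (\<lambda>i. if i < a then b else 0)"

definition strict_partition_of :: "nat set \<Rightarrow> nat \<Rightarrow> nat" where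
  "strict_partition_of A =
     (\<lambda>i. if i < card A then rev (sorted_list_of_set A) ! i else 0)"

definition node_color :: "nat \<times> nat \<Rightarrow> nat" where
  "node_color = (\<lambda>(i, j). if j mod 4 \<in> {0, 1} then 0 else 1)"

definition I_set :: "nat \<Rightarrow> nat \<Rightarrow> (nat \<Rightarrow> nat) \<Rightarrow> (nat \<Rightarrow> nat) set" where
  "I_set c l lam =
     {mu \<in> strict_partitions.
        young_diagram lam \<subseteq> young_diagram mu \<and>
        part_size mu = part_size lam + l \<and>
        (\<forall>x \<in> young_diagram mu - young_diagram lam. node_color x = c)}"

definition core :: "int \<Rightarrow> nat \<Rightarrow> nat" where
  "core k = (\<lambda>i.
     if int i < k then nat (4 * (k - int i) - 3)
     else if int i < - k then nat (4 * (- k - int i) - 1)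
     else 0)"

definition quotient0 :: "(nat \<Rightarrow> nat) \<Rightarrow> nat \<Rightarrow> nat" where
  "quotient0 lam = strict_partition_of {p div 2 | p. p \<in> nonzero_parts lam \<and> even p}"

definition maya :: "(nat \<Rightarrow> nat) \<Rightarrow> int set" where
  "maya lam =
     {int k | k. 4 * k + 1 \<in> nonzero_parts lam} \<union>
     ({x. x < 0} - {- int k - 1 | k. 4 * k + 3 \<in> nonzero_parts lam})"

definition charge :: "(nat \<Rightarrow> nat) \<Rightarrow> int" where
  "charge lam =
     int (card {p \<in> nonzero_parts lam. p mod 4 = 1}) -
     int (card {p \<in> nonzero_parts lam. p mod 4 = 3})"

text \<open>\<open>dec_enum M k\<close> is the \<open>(k+1)\<close>-st largest element of \<open>M\<close>.\<close>

primrec dec_enum :: "int set \<Rightarrow> nat \<Rightarrow> int" where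
  "dec_enum M 0 = (GREATEST x. x \<in> M)"
| "dec_enum M (Suc k) = (GREATEST x. x \<in> M \<and> x < dec_enum M k)"

text \<open>
  For strict \<open>lam\<close> the integer below is non-negative (it decreases weakly in \<open>k\<close> and
  vanishes for large \<open>k\<close>), so \<open>nat\<close> does not truncate.
\<close>

definition quotient1 :: "(nat \<Rightarrow> nat) \<Rightarrow> nat \<Rightarrow> nat" where
  "quotient1 lam = (\<lambda>k. nat (dec_enum (maya lam) k + int (k + 1) - charge lam))"

text \<open>With indexing from 0, \<open>lam (nat (- k))\<close> is the part \<open>\<lambda>\<^sub>i\<close> with \<open>i = -k+1\<close>.\<close>

definition beads :: "int \<Rightarrow> (nat \<Rightarrow> nat) \<Rightarrow> nat set" where
  "beads k lam =
     nonzero_parts lam \<union> (if k < 0 \<and> lam (nat (- k)) = 0 then {0} else {})"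

definition sign_exponent :: "int \<Rightarrow> (nat \<Rightarrow> nat) \<Rightarrow> nat" where
  "sign_exponent k lam =
     card {(p, q). p \<in> beads k lam \<and> q \<in> beads k lam \<and> even p \<and> q mod 4 = 1 \<and> p < q}"

definition delta :: "int \<Rightarrow> (nat \<Rightarrow> nat) \<Rightarrow> 'a::comm_ring_1" where
  "delta k lam = (- 1) ^ sign_exponent k lam"

text \<open>
  Polynomials in countably many variables over a field of characteristic 0.  Below, a family
  \<open>u\<close> of polynomials is substituted for the variables: \<open>u j\<close> takes the place of \<open>t\<^sub>j\<close> for
  \<open>j \<ge> 1\<close>, and \<open>u 0\<close> is never used.
\<close>

type_synonym 'k polys = "(nat \<Rightarrow>\<^sub>0 nat) \<Rightarrow>\<^sub>0 'k"

definition var :: "nat \<Rightarrow> 'k::field_char_0 polys" where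
  "var j = Poly_Mapping.single (Poly_Mapping.single j 1) 1"

definition const :: "'k::field_char_0 \<Rightarrow> 'k polys" where
  "const c = Poly_Mapping.single 0 c"

text \<open>
  \<open>exp (f(z))\<close> for \<open>f\<close> without constant term; the library's \<open>fps_exp\<close> needs a
  coefficient field.
\<close>

definition exp_series :: "'k::field_char_0 polys fps \<Rightarrow> 'k polys fps" where
  "exp_series f = fps_compose (Abs_fps (\<lambda>n. const (1 / fact n))) f"

definition h_poly :: "(nat \<Rightarrow> 'k::field_char_0 polys) \<Rightarrow> int \<Rightarrow> 'k polys" where
  "h_poly u n =
     (if n < 0 then 0
      else fps_nth (exp_series (Abs_fps (\<lambda>j. if j = 0 then 0 else u j))) (nat n))"

definition schur :: "(nat \<Rightarrow> nat) \<Rightarrow> (nat \<Rightarrow> 'k::field_char_0 polys) \<Rightarrow> 'k polys" where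
  "schur lam u =
     det (mat (part_length lam) (part_length lam)
            (\<lambda>(i, j). h_poly u (int (lam i) + int j - int i)))"

definition q_poly :: "(nat \<Rightarrow> 'k::field_char_0 polys) \<Rightarrow> nat \<Rightarrow> 'k polys" where
  "q_poly u n = fps_nth (exp_series (Abs_fps (\<lambda>j. if odd j then u j else 0))) n"

definition Q_pair_gt :: "(nat \<Rightarrow> 'k::field_char_0 polys) \<Rightarrow> nat \<Rightarrow> nat \<Rightarrow> 'k polys" where
  "Q_pair_gt u a b =
     q_poly u a * q_poly u b +
     2 * (\<Sum>i = 1..b. (- 1) ^ i * q_poly u (a + i) * q_poly u (b - i))"

definition Q_pair :: "(nat \<Rightarrow> 'k::field_char_0 polys) \<Rightarrow> nat \<Rightarrow> nat \<Rightarrow> 'k polys" where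
  "Q_pair u a b =
     (if a > b then Q_pair_gt u a b else if a < b then - Q_pair_gt u b a else 0)"

text \<open>
  The Pfaffian of a skew-symmetric \<open>2k \<times> 2k\<close> matrix with rows and columns indexed by
  \<open>0, \<dots>, 2k-1\<close>; each perfect matching is represented by the unique permutation that lists
  its pairs increasingly by their smaller elements.
\<close>

definition pfaffian :: "nat \<Rightarrow> (nat \<Rightarrow> nat \<Rightarrow> 'a::comm_ring_1) \<Rightarrow> 'a" where
  "pfaffian k A =
     (\<Sum>\<sigma> | \<sigma> permutes {..<2 * k} \<and>
            (\<forall>i<k. \<sigma> (2 * i) < \<sigma> (2 * i + 1)) \<and>
            (\<forall>i j. i < j \<and> j < k \<longrightarrow> \<sigma> (2 * i) < \<sigma> (2 * j)).
        of_int (sign \<sigma>) * (\<Prod>i<k. A (\<sigma> (2 * i)) (\<sigma> (2 * i + 1))))"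

text \<open>
  The matrix has size \<open>2 * ((part_length lam + 1) div 2)\<close>, the least even number that is at
  least the length; for odd length its last index belongs to the part \<open>0\<close>.
\<close>

definition Q_fun :: "(nat \<Rightarrow> nat) \<Rightarrow> (nat \<Rightarrow> 'k::field_char_0 polys) \<Rightarrow> 'k polys" where
  "Q_fun lam u = pfaffian ((part_length lam + 1) div 2) (\<lambda>i j. Q_pair u (lam i) (lam j))"

end

theory Submission
  imports Defs
begin

text \<open>
  Choose points \<open>x\<^sub>p\<close> and weights \<open>c\<^sub>p\<close> with \<open>q\<^sub>k = (\<Sum>p. c\<^sub>p * x\<^sub>p ^ k)\<close> for all \<open>k\<close> in a long
  interval around 0.  The generating series satisfy \<open>h(z) = q(z) * e(z\<^sup>2)\<close>, where \<open>e\<close> is \<open>h\<close> in the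
  variables \<open>t\<^sub>2, t\<^sub>4, \<dots>\<close>, so the Schur function of a rectangle is a Hankel determinant that becomes a
  sum over tuples of points involving the squared Vandermonde product
  \<open>V(x)\<^sup>2 = V(x\<^sup>2) * R(x)\<close>, where \<open>R(x)\<close> is the product of all \<open>(x\<^sub>j - x\<^sub>i) / (x\<^sub>j + x\<^sub>i)\<close> with \<open>i < j\<close>.
  Expanding \<open>V(x\<^sup>2)\<close> against \<open>e\<close> by Cauchy-Binet yields a sum over sets \<open>Y\<close> of exponents: a minor of
  the \<open>e\<^sub>k\<close>, which is the Schur function of \<open>mu[1]\<close>, times the correlation obtained by integrating
  \<open>x\<^sup>Y * R(x)\<close> against the point masses.  By partial fractions (Schur's Pfaffian) this correlation is a
  Pfaffian in the \<open>Q\<^sub>a\<^sub>,\<^sub>b\<close>, extended to negative indices.  There a negative exponent pairs with its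
  opposite only; removing such pairs produces the sign \<open>delta\<close> and leaves the Q-function of \<open>mu[0]\<close>.
\<close>

section \<open>Sums over tuples and antisymmetric functions\<close>

text \<open>Point masses replace a formal expansion: the factors (x_j - x_i)/(x_j + x_i) have no
  preferred power series, but at finitely many points with non-zero sums every step is a finite
  identity. The price is that the masses reproduce q_k only for |k| \<le> b, where b is chosen after
  the size of the determinant. Factors e(x^(-2)) push exponents below 0, so the masses must also
  encode q_0 = 1 and q_k = 0 for k < 0. Two-point correlations obey a recurrence in the direction
  (1, -1), started on the diagonal where they vanish. It reaches only pairs of equal parity, which
  suffices because all exponents have the parity of one number M. With M = 2m - 1 and k = 2m - n,
  respectively M = 2m and k = n, both identities become one statement about the rectangle with k
  rows of length M + 1 - k. The index sets agree for a simple reason: a core row labelled a > 0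
  admits the parts 2a - 1, 2a and 2a + 1, and a set of exponents without unmatched negatives has
  three states at a > 0 as well: neither of a and -a, only a, or both.\<close>

definition tuples :: "nat \<Rightarrow> 'a set \<Rightarrow> 'a list set" where
  "tuples n S = {ps. set ps \<subseteq> S \<and> length ps = n}"

definition remove_nth :: "nat \<Rightarrow> 'a list \<Rightarrow> 'a list" where
  "remove_nth j xs = take j xs @ drop (Suc j) xs"

lemma tuples_0 [simp]: "tuples 0 S = {[]}"
  by (auto simp: tuples_def)

lemma sum_tuples_Suc:
  "(\<Sum>ps\<in>tuples (Suc n) S. F ps) = (\<Sum>a\<in>S. \<Sum>ps\<in>tuples n S. F (a # ps))"
proof -
  have "tuples (Suc n) S = (\<lambda>(a, ps). a # ps) ` (S \<times> tuples n S)"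
    by (auto simp: tuples_def length_Suc_conv image_iff)
  moreover have "inj_on (\<lambda>(a, ps). a # ps) (S \<times> tuples n S)"
    by (auto simp: inj_on_def)
  ultimately show ?thesis
    by (simp add: sum.reindex sum.cartesian_product case_prod_unfold)
qed

lemma sum_tuples_insert:
  "j \<le> n \<Longrightarrow> (\<Sum>ps\<in>tuples (Suc n) S. F ps) =
    (\<Sum>a\<in>S. \<Sum>ps\<in>tuples n S. F (take j ps @ a # drop j ps))"
proof (induction j arbitrary: n F)
  case 0
  then show ?case by (simp add: sum_tuples_Suc)
next
  case (Suc j)
  then obtain k where n: "n = Suc k" and jk: "j \<le> k" by (cases n) auto
  have "(\<Sum>ps\<in>tuples (Suc n) S. F ps) = (\<Sum>a\<in>S. \<Sum>ps\<in>tuples (Suc k) S. F (a # ps))"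
    by (simp only: sum_tuples_Suc n)
  also have "\<dots> = (\<Sum>a\<in>S. \<Sum>b\<in>S. \<Sum>ps\<in>tuples k S. F (a # take j ps @ b # drop j ps))"
    by (simp only: Suc.IH[OF jk])
  also have "\<dots> = (\<Sum>b\<in>S. \<Sum>a\<in>S. \<Sum>ps\<in>tuples k S. F (a # take j ps @ b # drop j ps))"
    by (rule sum.swap)
  finally show ?case by (simp add: n sum_tuples_Suc[of _ k])
qed

lemma sum_tuples_snoc:
  "(\<Sum>ps\<in>tuples (Suc n) S. F ps) = (\<Sum>a\<in>S. \<Sum>ps\<in>tuples n S. F (ps @ [a]))"
  by (subst sum_tuples_insert[OF order_refl]) (auto simp: tuples_def intro!: sum.cong)

lemma prod_sum_tuples:
  fixes f :: "nat \<Rightarrow> 'b \<Rightarrow> 'a::comm_semiring_1"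
  shows "(\<Prod>i<n. \<Sum>p\<in>S. f i p) = (\<Sum>ps\<in>tuples n S. \<Prod>i<n. f i (ps ! i))"
proof (induction n arbitrary: f)
  case (Suc n)
  have "(\<Prod>i<Suc n. \<Sum>p\<in>S. f i p) = (\<Sum>p\<in>S. f 0 p) * (\<Prod>i<n. \<Sum>p\<in>S. f (Suc i) p)"
    by (simp only: prod.lessThan_Suc_shift)
  then show ?case
    by (simp only: Suc.IH sum_tuples_Suc prod.lessThan_Suc_shift nth_Cons_0 nth_Cons_Suc
        sum_distrib_left sum_distrib_right) (rule sum.swap)
qed simp

text \<open>Decreasing order is that of the parts of a partition, so that a correlation over
  \<open>desc_list I\<close> can be compared with a Q-function entry by entry.\<close>

definition desc_list :: "'b::linorder set \<Rightarrow> 'b list" where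
  "desc_list I = rev (sorted_list_of_set I)"

lemma desc_list_props [simp]:
  "distinct (desc_list I)" "finite I \<Longrightarrow> set (desc_list I) = I"
  "length (desc_list I) = card I"
  by (auto simp: desc_list_def)

text \<open>Tuples with a repetition drop out, and every other tuple is a unique rearrangement of
  the decreasing list of an \<open>n\<close>-subset. For a fixed subset, the signs from
  \<open>anti\<close> turn the products of the \<open>a i\<close> into a Leibniz sum. This serves
  both Cauchy-Binet and the passage from point sets to \<open>corr\<close>.\<close>

lemma sum_tuples_antisym:
  fixes a :: "nat \<Rightarrow> 'b::linorder \<Rightarrow> 'a::comm_ring_1" and G :: "'b list \<Rightarrow> 'a"
  assumes S: "finite S"
    and anti: "\<And>\<sigma> ps. length ps = n \<Longrightarrow> \<sigma> permutes {..<n} \<Longrightarrow>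
      G (permute_list \<sigma> ps) = of_int (sign \<sigma>) * G ps"
    and nd: "\<And>ps. length ps = n \<Longrightarrow> \<not> distinct ps \<Longrightarrow> G ps = 0"
  shows "(\<Sum>ps\<in>tuples n S. (\<Prod>i<n. a i (ps ! i)) * G ps) =
    (\<Sum>I | I \<subseteq> S \<and> card I = n. det (mat n n (\<lambda>(i, j). a i (desc_list I ! j))) * G (desc_list I))"
proof -
  let ?P = "{\<sigma>. \<sigma> permutes {..<n}}"
  let ?I = "{I. I \<subseteq> S \<and> card I = n}"
  let ?e = "\<lambda>(I, \<sigma>). permute_list \<sigma> (desc_list I)"
  have fin: "finite I" if "I \<in> ?I" for I using that S by (auto intro: finite_subset)
  have "(\<Sum>ps\<in>tuples n S. (\<Prod>i<n. a i (ps ! i)) * G ps) =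
      (\<Sum>ps\<in>{ps\<in>tuples n S. distinct ps}. (\<Prod>i<n. a i (ps ! i)) * G ps)"
    by (rule sum.mono_neutral_right) (use S nd in \<open>auto simp: tuples_def finite_lists_length_eq\<close>)
  also have "{ps\<in>tuples n S. distinct ps} = ?e ` (?I \<times> ?P)"
  proof (intro equalityI subsetI)
    fix ps assume "ps \<in> {ps\<in>tuples n S. distinct ps}"
    then have ps: "ps \<in> tuples n S" "distinct ps" by auto
    have I: "set ps \<in> ?I" using ps by (auto simp: tuples_def distinct_card)
    then have "mset ps = mset (desc_list (set ps))"
      using ps by (simp add: set_eq_iff_mset_eq_distinct[symmetric])
    then obtain \<sigma> where "\<sigma> permutes {..<length (desc_list (set ps))}"
        "permute_list \<sigma> (desc_list (set ps)) = ps"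
      by (rule mset_eq_permutation)
    then show "ps \<in> ?e ` (?I \<times> ?P)" using I by (intro image_eqI[of _ _ "(set ps, \<sigma>)"]) auto
  next
    fix ps assume "ps \<in> ?e ` (?I \<times> ?P)"
    then obtain I \<sigma> where I: "I \<subseteq> S" "n = card I" and s: "\<sigma> permutes {..<card I}"
      and ps: "ps = permute_list \<sigma> (desc_list I)" by auto
    have f: "finite I" using I S by (auto intro: finite_subset)
    show "ps \<in> {ps\<in>tuples n S. distinct ps}"
      using I s f by (auto simp: tuples_def ps)
  qed
  also have "(\<Sum>ps\<in>?e ` (?I \<times> ?P). (\<Prod>i<n. a i (ps ! i)) * G ps) =
      (\<Sum>(I, \<sigma>)\<in>?I \<times> ?P. (\<Prod>i<n. a i (desc_list I ! \<sigma> i)) * (of_int (sign \<sigma>) * G (desc_list I)))"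
  proof (subst sum.reindex)
    show "inj_on ?e (?I \<times> ?P)"
    proof (rule inj_onI, clarsimp)
    fix I J \<sigma> \<tau> assume IJ: "I \<subseteq> S" "J \<subseteq> S" "n = card I" "card J = card I"
      and p: "\<sigma> permutes {..<card I}" "\<tau> permutes {..<card I}"
      and eq: "permute_list \<sigma> (desc_list I) = permute_list \<tau> (desc_list J)"
    have f: "finite I" "finite J" using IJ S by (auto intro: finite_subset)
    have "set (permute_list \<sigma> (desc_list I)) = I" "set (permute_list \<tau> (desc_list J)) = J"
      using p f IJ by auto
    then have "I = J" using eq by simp
    moreover have "\<sigma> i = \<tau> i" for i
    proof (cases "i < card I")
      case True
      have "desc_list I ! \<sigma> i = desc_list I ! \<tau> i"
        using arg_cong[OF eq, of "\<lambda>l. l ! i"] True p \<open>I = J\<close> by (simp add: permute_list_nth)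
      moreover have "\<sigma> i < card I" "\<tau> i < card I"
        using True p permutes_in_image[of _ "{..<card I}" i] by auto
      ultimately show ?thesis by (simp add: nth_eq_iff_index_eq)
    next
      case False
      then show ?thesis using p by (simp add: permutes_not_in)
    qed
    ultimately show "I = J \<and> \<sigma> = \<tau>" by auto
    qed
  qed (auto simp: anti permute_list_nth intro!: sum.cong prod.cong arg_cong2[of _ _ _ _ "(*)"])
  also have "\<dots> = (\<Sum>I\<in>?I. det (mat n n (\<lambda>(i, j). a i (desc_list I ! j))) * G (desc_list I))"
    unfolding sum.cartesian_product[symmetric]
  proof (rule sum.cong[OF refl])
    fix I assume "I \<in> ?I"
    have "det (mat n n (\<lambda>(i, j). a i (desc_list I ! j))) =
        (\<Sum>\<sigma>\<in>?P. of_int (sign \<sigma>) * (\<Prod>i<n. a i (desc_list I ! \<sigma> i)))"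
      unfolding det_def by (auto simp: atLeast0LessThan intro!: sum.cong prod.cong)
    then show "(\<Sum>\<sigma>\<in>?P. (\<Prod>i<n. a i (desc_list I ! \<sigma> i)) * (of_int (sign \<sigma>) * G (desc_list I))) =
        det (mat n n (\<lambda>(i, j). a i (desc_list I ! j))) * G (desc_list I)"
      by (simp add: sum_distrib_left sum_distrib_right mult_ac)
  qed
  finally show ?thesis .
qed

text \<open>With \<open>r x y = y - x\<close> this is the Vandermonde product, with
  \<open>ratio\<close> it is R(x). It is defined on lists because the order of the entries fixes the
  sign.\<close>

fun pair_prod :: "('b \<Rightarrow> 'b \<Rightarrow> 'a::comm_monoid_mult) \<Rightarrow> 'b list \<Rightarrow> 'a" where
  "pair_prod r [] = 1"
| "pair_prod r (x # xs) = prod_list (map (r x) xs) * pair_prod r xs"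

lemma pair_prod_append:
  "pair_prod r (xs @ ys) =
    pair_prod r xs * pair_prod r ys * prod_list (map (\<lambda>x. prod_list (map (r x) ys)) xs)"
  by (induction xs) (simp_all add: ac_simps)

lemma prod_list_map_mult:
  "prod_list (map (\<lambda>x. f x * g x) xs) = prod_list (map f xs) * (prod_list (map g xs) :: 'a::comm_monoid_mult)"
  by (induction xs) (simp_all add: ac_simps)

lemma pair_prod_mult:
  "pair_prod (\<lambda>x y. f x y * g x y) xs = pair_prod f xs * (pair_prod g xs :: 'a::comm_monoid_mult)"
  by (induction xs) (simp_all add: ac_simps prod_list_map_mult)

lemma prod_list_map_uminus:
  "prod_list (map (\<lambda>x. - f x) xs) = (-1) ^ length xs * (prod_list (map f xs) :: 'a::comm_ring_1)"
  by (induction xs) simp_all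

context
  fixes r :: "'b \<Rightarrow> 'b \<Rightarrow> 'a::comm_ring_1"
  assumes anti: "\<And>x y. r y x = - r x y"
begin

text \<open>Exchanging \<open>x\<close> and \<open>y\<close> also reverses the factors of each of
  them with the entries of \<open>ys\<close>. These two signs \<open>(-1) ^ length ys\<close>
  cancel, and the factor of \<open>x\<close> with \<open>y\<close> gives the minus.\<close>

lemma pair_prod_swap:
  "pair_prod r (xs @ y # ys @ x # zs) = - pair_prod r (xs @ x # ys @ y # zs)"
proof -
  have 1: "prod_list (map (\<lambda>z. r z x) ys) = (-1) ^ length ys * prod_list (map (r x) ys)" for x ys
    using prod_list_map_uminus[of "r x" ys] by (simp add: anti[of x])
  have e: "(-1) ^ k * ((-1) ^ k * u) = (u::'a)" for k u
    by (simp add: mult.assoc[symmetric] power_mult_distrib[symmetric])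
  show ?thesis
    by (simp add: pair_prod_append prod_list_map_mult 1 anti[of x y] mult_ac e)
qed

lemma pair_prod_transpose:
  assumes "a < length xs" "b < length xs" "a \<noteq> b"
  shows "pair_prod r (permute_list (transpose a b) xs) = - pair_prod r xs"
proof -
  have main: "pair_prod r (permute_list (transpose a b) xs) = - pair_prod r xs"
    if "a < b" "b < length xs" for a b
  proof -
    define A where "A = take a xs"
    define B where "B = take (b - Suc a) (drop (Suc a) xs)"
    define C where "C = drop (Suc b) xs"
    have xs: "xs = A @ xs ! a # B @ xs ! b # C"
    proof -
      have "xs = A @ xs ! a # drop (Suc a) xs"
        using that by (simp add: A_def id_take_nth_drop)
      moreover have "drop (Suc a) xs = B @ xs ! b # C"
        using that id_take_nth_drop[of "b - Suc a" "drop (Suc a) xs"]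
        by (simp add: B_def C_def)
      ultimately show ?thesis by simp
    qed
    have len: "length A = a" "length B = b - Suc a" using that by (auto simp: A_def B_def)
    have "permute_list (transpose a b) xs = A @ xs ! b # B @ xs ! a # C"
    proof (rule nth_equalityI)
      show "length (permute_list (transpose a b) xs) = length (A @ xs ! b # B @ xs ! a # C)"
        using arg_cong[OF xs, of length] by simp
      fix i assume i: "i < length (permute_list (transpose a b) xs)"
      have p: "transpose a b permutes {..<length xs}"
        using that by (intro permutes_swap_id) auto
      have "xs ! i = (A @ xs ! a # B @ xs ! b # C) ! i" using xs by simp
      then show "permute_list (transpose a b) xs ! i = (A @ xs ! b # B @ xs ! a # C) ! i"
        using i that len
        by (auto simp: permute_list_nth[OF p] nth_append nth_Cons transpose_def split: nat.splits)
    qed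
    then show ?thesis using pair_prod_swap xs by metis
  qed
  show ?thesis using assms main[of a b] main[of b a]
    by (cases "a < b") (auto simp: transpose_commute)
qed

lemma pair_prod_permute_list:
  assumes "\<sigma> permutes {..<length xs}"
  shows "pair_prod r (permute_list \<sigma> xs) = of_int (sign \<sigma>) * pair_prod r xs"
proof -
  have "\<forall>xs. length xs = n \<longrightarrow> pair_prod r (permute_list \<sigma> xs) = of_int (sign \<sigma>) * pair_prod r xs"
    if "\<sigma> permutes {..<n}" for n
    using that finite_lessThan
  proof (induction rule: permutes_induct)
    case id
    then show ?case by simp
  next
    case (swap a b p)
    show ?case
    proof (intro allI impI)
      fix xs :: "'b list" assume len: "length xs = n"
      have p: "p permutes {..<length xs}" using swap len by simp
      have "permute_list (transpose a b \<circ> p) xs = permute_list p (permute_list (transpose a b) xs)"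
        using p by (rule permute_list_compose)
      moreover have "sign (transpose a b \<circ> p) = - sign p"
        using swap
        by (simp add: sign_compose permutation_swap_id permutation_permutes[of p] sign_swap_id
            exI[of _ "{..<n}"])
      ultimately show "pair_prod r (permute_list (transpose a b \<circ> p) xs) =
          of_int (sign (transpose a b \<circ> p)) * pair_prod r xs"
        using swap len pair_prod_transpose[of a xs b] by simp
    qed
  qed
  then show ?thesis using assms by blast
qed

text \<open>Only the factors of \<open>x\<close> with the entries of \<open>ys\<close> are
  reversed.\<close>

lemma pair_prod_move:
  "pair_prod r (xs @ x # ys @ zs) = (-1) ^ length ys * pair_prod r (xs @ ys @ x # zs)"
proof -
  have 1: "prod_list (map (\<lambda>z. r z x) ys) = (-1) ^ length ys * prod_list (map (r x) ys)" for x ys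
    using prod_list_map_uminus[of "r x" ys] by (simp add: anti[of x])
  have e: "(-1) ^ k * ((-1) ^ k * u) = (u::'a)" for k u
    by (simp add: mult.assoc[symmetric] power_mult_distrib[symmetric])
  show ?thesis
    by (simp add: pair_prod_append prod_list_map_mult 1 mult_ac e)
qed

end

lemma pair_prod_not_distinct:
  assumes "\<And>x. r x x = (0::'a::comm_ring_1)" "\<not> distinct xs"
  shows "pair_prod r xs = 0"
  using assms(2)
proof (induction xs)
  case (Cons x xs)
  then show ?case
    by (cases "x \<in> set xs") (auto simp: prod_list_zero_iff assms image_iff dest!: split_list)
qed simp

text \<open>Multiplying from the left by the unitriangular matrix of coefficients of the Newton
  polynomials \<open>p i\<close> turns row \<open>i\<close> into the values of \<open>p i\<close>.
  These vanish at the earlier nodes, so the product is triangular and its diagonal carries the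
  Vandermonde factors.\<close>

lemma det_vandermonde:
  fixes xs :: "'a::idom list"
  assumes n: "length xs = n"
  shows "det (mat n n (\<lambda>(i, j). (xs ! j) ^ i)) = pair_prod (\<lambda>x y. y - x) xs"
proof -
  define p where "p i = (\<Prod>k<i. [:- (xs ! k), 1:])" for i
  have deg: "degree (p i) = i" and lc: "coeff (p i) i = 1" for i
  proof -
    show d: "degree (p i) = i"
      unfolding p_def by (subst degree_prod_eq_sum_degree) auto
    have "lead_coeff (p i) = 1" unfolding p_def by (simp add: lead_coeff_prod)
    then show "coeff (p i) i = 1" using d by simp
  qed
  define C where "C = mat n n (\<lambda>(i, k). coeff (p i) k)"
  define V where "V = mat n n (\<lambda>(i, j). (xs ! j) ^ i)"
  have CV: "C * V = mat n n (\<lambda>(i, j). poly (p i) (xs ! j))"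
  proof (rule eq_matI)
    fix i j assume ij: "i < dim_row (mat n n (\<lambda>(i, j). poly (p i) (xs ! j)))"
      "j < dim_col (mat n n (\<lambda>(i, j). poly (p i) (xs ! j)))"
    then have "(C * V) $$ (i, j) = (\<Sum>k<n. coeff (p i) k * xs ! j ^ k)"
      by (simp add: C_def V_def scalar_prod_def atLeast0LessThan)
    also have "\<dots> = (\<Sum>k\<le>degree (p i). coeff (p i) k * xs ! j ^ k)"
      using ij by (intro sum.mono_neutral_right) (auto simp: deg coeff_eq_0)
    finally show "(C * V) $$ (i, j) = mat n n (\<lambda>(i, j). poly (p i) (xs ! j)) $$ (i, j)"
      using ij by (simp add: poly_altdef)
  qed (auto simp: C_def V_def)
  have "det C = prod_list (diag_mat C)"
    by (rule det_lower_triangular[of n]) (auto simp: C_def deg coeff_eq_0)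
  also have "\<dots> = 1" by (simp add: diag_mat_def C_def lc prod.list_conv_set_nth)
  finally have "det V = det (C * V)"
    by (subst det_mult[of _ n]) (auto simp: C_def V_def)
  also have "\<dots> = prod_list (diag_mat (mat n n (\<lambda>(i, j). poly (p i) (xs ! j))))"
    unfolding CV
    by (rule det_upper_triangular) (auto simp: upper_triangular_def p_def poly_prod)
  also have "\<dots> = (\<Prod>j<n. \<Prod>k<j. xs ! j - xs ! k)"
    by (simp add: diag_mat_def p_def poly_prod interv_sum_list_conv_sum_set_nat
        prod.distinct_set_conv_list[symmetric] atLeast0LessThan)
  also have "\<dots> = pair_prod (\<lambda>x y. y - x) xs"
    using n
  proof (induction xs arbitrary: n)
    case (Cons x xs)
    then show ?case
      by (auto simp: prod.lessThan_Suc_shift prod.distrib 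
          prod.list_conv_set_nth atLeast0LessThan simp del: prod.lessThan_Suc)
  qed simp
  finally show ?thesis by (simp add: V_def)
qed

section \<open>Partial fractions and correlations of point masses\<close>

lemma length_remove_nth [simp]: "j < length xs \<Longrightarrow> length (remove_nth j xs) = length xs - 1"
  by (auto simp: remove_nth_def)

lemma nth_remove_nth:
  "j < length xs \<Longrightarrow> i < length xs - 1 \<Longrightarrow>
    remove_nth j xs ! i = xs ! (if i < j then i else Suc i)"
  by (auto simp: remove_nth_def nth_append)

lemma map_remove_nth: "map f (remove_nth j xs) = remove_nth j (map f xs)"
  by (simp add: remove_nth_def take_map drop_map)

lemma remove_nth_append_Cons: "remove_nth (length xs) (xs @ x # ys) = xs @ ys"
  by (simp add: remove_nth_def)

text \<open>Partial fractions in \<open>z\<close>, with poles at the points \<open>- x\<close>. The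
  basic fractions (z - x)/(z + x) tend to 1 at infinity, so the constant term is 1 minus the sum of
  the coefficients, which depends only on parity. The induction generalizes \<open>z\<close> because
  its step needs the hypothesis at three arguments: \<open>z\<close>, 0 and
  \<open>- u\<close>.\<close>

lemma partial_fraction_product:
  fixes X :: "'k::field set"
  assumes "finite X" "\<And>x. x \<in> X \<Longrightarrow> x \<noteq> 0"
    "\<And>x y. x \<in> X \<Longrightarrow> y \<in> X \<Longrightarrow> x + y \<noteq> 0" "\<And>x. x \<in> X \<Longrightarrow> z + x \<noteq> 0"
  shows "(\<Prod>x\<in>X. (z - x) / (z + x)) = (if even (card X) then 1 else 0) +
    (\<Sum>x\<in>X. (\<Prod>y\<in>X - {x}. (x + y) / (x - y)) * ((z - x) / (z + x)))"
  using assms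
proof (induction X arbitrary: z rule: finite_induct)
  case empty
  then show ?case by simp
next
  case (insert u X)
  define B where "B x = (\<Prod>y\<in>X - {x}. (x + y) / (x - y))" for x
  define e :: 'k where "e = (if even (card X) then 1 else 0)"
  have IH: "(\<Prod>x\<in>X. (z - x) / (z + x)) = e + (\<Sum>x\<in>X. B x * ((z - x) / (z + x)))"
    if "\<And>x. x \<in> X \<Longrightarrow> z + x \<noteq> 0" for z
    using insert.IH[of z] insert.prems that unfolding B_def e_def by auto
  have nz: "x \<noteq> u" "x - u \<noteq> 0" "u - x \<noteq> 0" "x + u \<noteq> 0" "z + x \<noteq> 0" "x \<noteq> 0" if "x \<in> X" for x
    using insert.hyps insert.prems that by auto
  have zu: "z + u \<noteq> 0" using insert.prems by auto
  \<comment> \<open>At \<open>z = 0\<close> each factor is -1, which determines the sum of the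
    coefficients.\<close>
  have B0: "(\<Sum>x\<in>X. B x) = 1 - e"
  proof -
    have "(\<Prod>x\<in>X. (0 - x) / (0 + x)) = e + (\<Sum>x\<in>X. B x * ((0 - x) / (0 + x)))"
      by (rule IH) (use nz in auto)
    also have "(\<Prod>x\<in>X. (0 - x) / (0 + x)) = (\<Prod>x\<in>X. -1)"
      by (rule prod.cong) (use nz in \<open>auto simp: field_simps\<close>)
    also have "(\<Sum>x\<in>X. B x * ((0 - x) / (0 + x))) = - (\<Sum>x\<in>X. B x)"
      unfolding sum_negf[symmetric] by (rule sum.cong) (use nz in \<open>auto simp: field_simps\<close>)
    finally show ?thesis by (simp add: e_def field_simps split: if_splits)
  qed
  \<comment> \<open>At \<open>z = - u\<close> the product becomes the coefficient belonging to the
    new point \<open>u\<close>.\<close>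
  have Bu: "(\<Prod>y\<in>X. (u + y) / (u - y)) = e - (\<Sum>x\<in>X. B x * ((x + u) / (x - u)))"
  proof -
    have "(\<Prod>x\<in>X. (- u - x) / (- u + x)) = e + (\<Sum>x\<in>X. B x * ((- u - x) / (- u + x)))"
      by (rule IH) (use nz in \<open>auto simp: add_eq_0_iff\<close>)
    also have "(\<Prod>x\<in>X. (- u - x) / (- u + x)) = (\<Prod>y\<in>X. (u + y) / (u - y))"
      by (rule prod.cong) (use nz in \<open>auto simp: divide_simps algebra_simps\<close>)
    also have "(\<Sum>x\<in>X. B x * ((- u - x) / (- u + x))) = - (\<Sum>x\<in>X. B x * ((x + u) / (x - u)))"
      unfolding sum_negf[symmetric]
      by (rule sum.cong) (use nz in \<open>auto simp: divide_simps algebra_simps\<close>)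
    finally show ?thesis by simp
  qed
  have B': "(\<Prod>y\<in>insert u X - {x}. (x + y) / (x - y)) = B x * ((x + u) / (x - u))" if "x \<in> X" for x
  proof -
    have "insert u X - {x} = insert u (X - {x})" using nz(1)[OF that] by auto
    then show ?thesis using insert.hyps by (simp add: B_def)
  qed
  have step: "(z - x) / (z + x) * ((z - u) / (z + u)) =
      1 + (x + u) / (x - u) * ((z - x) / (z + x)) - (x + u) / (x - u) * ((z - u) / (z + u))"
    if "x \<in> X" for x
  proof -
    have "(z - x) * (z - u) * (x - u) = (z + x) * (z + u) * (x - u) + (x + u) * (z - x) * (z + u) - (x + u) * (z - u) * (z + x)"
      by (simp add: algebra_simps)
    moreover have "a / p * (b / q) = 1 + c / d * (a / p) - c / d * (b / q)"
      if "a * b * d = p * q * d + c * a * q - c * b * p" "p \<noteq> 0" "q \<noteq> 0" "d \<noteq> 0" for a b c d p q :: 'k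
      using arg_cong[OF that(1), of "\<lambda>t. t * d"] that(2-) by (simp add: field_simps)
    ultimately show ?thesis using nz[OF that] zu by blast
  qed
  have "(\<Prod>x\<in>insert u X. (z - x) / (z + x)) =
      (e + (\<Sum>x\<in>X. B x * ((z - x) / (z + x)))) * ((z - u) / (z + u))"
    using insert.hyps IH[of z] nz by simp
  also have "\<dots> = e * ((z - u) / (z + u)) + (\<Sum>x\<in>X. B x * ((z - x) / (z + x) * ((z - u) / (z + u))))"
    by (simp only: distrib_right sum_distrib_right mult.assoc)
  also have "(\<Sum>x\<in>X. B x * ((z - x) / (z + x) * ((z - u) / (z + u)))) =
      (\<Sum>x\<in>X. B x + (B x * ((x + u) / (x - u))) * ((z - x) / (z + x))
         - (B x * ((x + u) / (x - u))) * ((z - u) / (z + u)))"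
  proof (rule sum.cong[OF refl])
    have "b * (1 + p * q - p * r) = b + b * p * q - b * p * r" for b p q r :: 'k
      by (simp add: algebra_simps)
    then show "B x * ((z - x) / (z + x) * ((z - u) / (z + u))) =
        B x + (B x * ((x + u) / (x - u))) * ((z - x) / (z + x))
         - (B x * ((x + u) / (x - u))) * ((z - u) / (z + u))" if "x \<in> X" for x
      by (simp only: step[OF that])
  qed
  also have "\<dots> = (\<Sum>x\<in>X. B x) + (\<Sum>x\<in>X. (B x * ((x + u) / (x - u))) * ((z - x) / (z + x)))
      - (\<Sum>x\<in>X. B x * ((x + u) / (x - u))) * ((z - u) / (z + u))"
    by (simp only: sum.distrib sum_subtractf sum_distrib_right)
  finally have main: "(\<Prod>x\<in>insert u X. (z - x) / (z + x)) = (1 - e) +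
      ((\<Prod>y\<in>X. (u + y) / (u - y)) * ((z - u) / (z + u)) +
      (\<Sum>x\<in>X. (B x * ((x + u) / (x - u))) * ((z - x) / (z + x))))"
    unfolding B0 Bu by (simp add: algebra_simps)
  have "insert u X - {u} = X" using insert.hyps by auto
  then have "(\<Sum>x\<in>insert u X. (\<Prod>y\<in>insert u X - {x}. (x + y) / (x - y)) * ((z - x) / (z + x))) =
      (\<Prod>y\<in>X. (u + y) / (u - y)) * ((z - u) / (z + u)) +
      (\<Sum>x\<in>X. (B x * ((x + u) / (x - u))) * ((z - x) / (z + x)))"
    using insert.hyps B' by simp
  then show ?case using main insert.hyps by (simp add: e_def)
qed

definition ratio :: "'k::field \<Rightarrow> 'k \<Rightarrow> 'k" where
  "ratio x y = (y - x) / (y + x)"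

lemma ratio_antisym: "ratio y x = - ratio x y"
  by (simp add: ratio_def add.commute minus_divide_left)

lemma ratio_self [simp]: "ratio x x = 0"
  by (simp add: ratio_def)

abbreviation ratio_prod :: "'k::field list \<Rightarrow> 'k" where
  "ratio_prod \<equiv> pair_prod ratio"

lemma not_distinct_remove_nth:
  assumes "a < b" "b < length xs" "xs ! a = xs ! b" "j < length xs" "j \<noteq> a" "j \<noteq> b"
  shows "\<not> distinct (remove_nth j xs)"
proof -
  let ?d = "\<lambda>i. if i < j then i else i - 1"
  have "remove_nth j xs ! ?d a = xs ! a" "remove_nth j xs ! ?d b = xs ! b"
    using assms by (auto simp: nth_remove_nth)
  moreover have "?d a \<noteq> ?d b" "?d a < length (remove_nth j xs)" "?d b < length (remove_nth j xs)"
    using assms by auto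
  ultimately show ?thesis
    using assms(3) nth_eq_iff_index_eq[of "remove_nth j xs" "?d a" "?d b"] by auto
qed

text \<open>Schur's Pfaffian identity, expanded along its last point:
  \<open>partial_fraction_product\<close> multiplied by \<open>ratio_prod xs\<close>. Lists with
  repetitions are covered because \<open>corr\<close> sums over all tuples.\<close>

lemma ratio_prod_snoc:
  fixes xs :: "'k::field list"
  assumes nz: "\<And>x. x \<in> set xs \<Longrightarrow> x \<noteq> 0"
    and sums: "\<And>x y. x \<in> set xs \<Longrightarrow> y \<in> set xs \<Longrightarrow> x + y \<noteq> 0" "\<And>x. x \<in> set xs \<Longrightarrow> z + x \<noteq> 0"
  shows "ratio_prod (xs @ [z]) = (if even (length xs) then ratio_prod xs else 0) +
    (\<Sum>j<length xs. (-1) ^ (length xs - 1 - j) * ratio (xs ! j) z * ratio_prod (remove_nth j xs))"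
proof (cases "distinct xs")
  case True
  define B where "B x = (\<Prod>y\<in>set xs - {x}. (x + y) / (x - y))" for x
  \<comment> \<open>Up to the sign of moving \<open>xs ! j\<close> to the end, its coefficient is
    inverse to the product of all its factors in \<open>ratio_prod xs\<close>; multiplication
    therefore deletes the point.\<close>
  have B: "B (xs ! j) * ratio_prod xs = (-1) ^ (length xs - 1 - j) * ratio_prod (remove_nth j xs)"
    if j: "j < length xs" for j
  proof -
    define x where "x = xs ! j"
    define A where "A = take j xs"
    define C where "C = drop (Suc j) xs"
    have xs: "xs = A @ x # C" using j by (simp add: x_def A_def C_def id_take_nth_drop)
    have C: "length C = length xs - 1 - j" using j by (simp add: C_def)
    have rem: "remove_nth j xs = A @ C" by (simp add: remove_nth_def A_def C_def)
    have "ratio_prod xs = (-1) ^ length C * ratio_prod ((A @ C) @ [x])"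
      using pair_prod_move[of ratio A x C "[]", OF ratio_antisym] xs by simp
    also have "\<dots> = (-1) ^ length C * (ratio_prod (A @ C) * (\<Prod>y\<leftarrow>A @ C. ratio y x))"
      by (subst pair_prod_append) simp
    also have "(\<Prod>y\<leftarrow>A @ C. ratio y x) = (\<Prod>y\<in>set xs - {x}. (x - y) / (x + y))"
    proof -
      have "set xs - {x} = set (A @ C)" "distinct (A @ C)" using True xs by auto
      then show ?thesis unfolding ratio_def by (simp only: prod.distinct_set_conv_list)
    qed
    finally have "B x * ratio_prod xs = (-1) ^ length C * ratio_prod (A @ C) *
        (B x * (\<Prod>y\<in>set xs - {x}. (x - y) / (x + y)))" by simp
    also have "B x * (\<Prod>y\<in>set xs - {x}. (x - y) / (x + y)) = 1"
      unfolding B_def prod.distrib[symmetric]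
    proof (rule prod.neutral, rule ballI)
      fix y assume "y \<in> set xs - {x}"
      then have "x + y \<noteq> 0" "x - y \<noteq> 0" using sums xs by auto
      then show "(x + y) / (x - y) * ((x - y) / (x + y)) = 1" by simp
    qed
    finally show ?thesis using rem C by (simp add: x_def)
  qed
  have "ratio_prod (xs @ [z]) = ratio_prod xs * (\<Prod>x\<leftarrow>xs. ratio x z)"
    by (simp add: pair_prod_append)
  also have "(\<Prod>x\<leftarrow>xs. ratio x z) = (\<Prod>x\<in>set xs. (z - x) / (z + x))"
    using True by (simp add: ratio_def prod.distinct_set_conv_list)
  also have "\<dots> = (if even (length xs) then 1 else 0) + (\<Sum>x\<in>set xs. B x * ratio x z)"
    using partial_fraction_product[of "set xs" z] assms True
    by (simp add: ratio_def distinct_card B_def)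
  also have "(\<Sum>x\<in>set xs. B x * ratio x z) = (\<Sum>j<length xs. B (xs ! j) * ratio (xs ! j) z)"
    using True by (intro sum.reindex_bij_betw[symmetric] bij_betw_nth) auto
  finally have "ratio_prod (xs @ [z]) = (if even (length xs) then ratio_prod xs else 0) +
      (\<Sum>j<length xs. ratio (xs ! j) z * (B (xs ! j) * ratio_prod xs))"
    by (simp add: distrib_left sum_distrib_left mult_ac)
  also have "(\<Sum>j<length xs. ratio (xs ! j) z * (B (xs ! j) * ratio_prod xs)) =
      (\<Sum>j<length xs. (-1) ^ (length xs - 1 - j) * ratio (xs ! j) z * ratio_prod (remove_nth j xs))"
    by (rule sum.cong[OF refl]) (simp add: B)
  finally show ?thesis .
next
  case False
  \<comment> \<open>The products over full lists vanish, and deleting a point can only remove the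
    repetition if it is one of the two copies of \<open>v\<close>. The two deletions cancel: the
    lists differ by moving \<open>v\<close> across \<open>D\<close>, while the exponents of the
    explicit signs differ by \<open>Suc (length D)\<close>.\<close>
  then obtain A v D C where xs: "xs = A @ [v] @ D @ [v] @ C"
    using not_distinct_decomp by blast
  define a where "a = length A"
  define b where "b = Suc (length A + length D)"
  have ab: "a < b" "b < length xs" "xs ! a = v" "xs ! b = v"
    by (auto simp: a_def b_def xs nth_append)
  let ?t = "\<lambda>j. (-1) ^ (length xs - 1 - j) * ratio (xs ! j) z * ratio_prod (remove_nth j xs)"
  note zero = pair_prod_not_distinct[of ratio, OF ratio_self]
  have "(\<Sum>j<length xs. ?t j) = (\<Sum>j\<in>{a, b}. ?t j)"
    by (rule sum.mono_neutral_right)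
      (use ab not_distinct_remove_nth[OF ab(1,2)] in \<open>auto intro!: zero\<close>)
  also have "\<dots> = ?t a + ?t b" using ab by simp
  also have "remove_nth a xs = A @ D @ v # C"
    by (simp add: xs a_def remove_nth_append_Cons)
  also have "remove_nth b xs = A @ v # D @ C"
    using remove_nth_append_Cons[of "A @ v # D" v C] by (simp add: xs b_def)
  also have "ratio_prod (A @ v # D @ C) = (-1) ^ length D * ratio_prod (A @ D @ v # C)"
    by (rule pair_prod_move[OF ratio_antisym])
  also have "length xs - 1 - a = (length xs - 1 - b) + Suc (length D)"
    by (simp add: xs a_def b_def)
  finally have "(\<Sum>j<length xs. ?t j) = 0"
    by (simp add: ab power_add)
  moreover have "\<not> distinct (xs @ [z])" "\<not> distinct xs" using False by auto
  ultimately show ?thesis by (simp add: zero)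
qed

lemma prod_lessThan_Suc_remove:
  fixes f :: "nat \<Rightarrow> 'a::comm_monoid_mult"
  assumes "j \<le> n"
  shows "(\<Prod>i<Suc n. f i) = f j * (\<Prod>i<n. f (if i < j then i else Suc i))"
  using assms
proof (induction n)
  case (Suc n)
  show ?case
  proof (cases "j = Suc n")
    case True
    then show ?thesis by (simp add: mult.commute)
  next
    case False
    then show ?thesis using Suc by (simp add: mult_ac)
  qed
qed simp

lemma sum_tuples_factor:
  fixes u :: "'y \<Rightarrow> 'b \<Rightarrow> 'a::comm_semiring_1"
  assumes "j < length ys"
  shows "(\<Sum>ps\<in>tuples (length ys) S. (\<Prod>i<length ys. u (ys ! i) (ps ! i)) * (f (ps ! j) * g (remove_nth j ps))) =
    (\<Sum>b\<in>S. u (ys ! j) b * f b) *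
    (\<Sum>qs\<in>tuples (length ys - 1) S. (\<Prod>i<length ys - 1. u (remove_nth j ys ! i) (qs ! i)) * g qs)"
proof -
  obtain n where n: "length ys = Suc n" using assms by (cases ys) auto
  have "(\<Prod>i<Suc n. u (ys ! i) ((take j qs @ b # drop j qs) ! i)) =
      u (ys ! j) b * (\<Prod>i<n. u (remove_nth j ys ! i) (qs ! i))" if "qs \<in> tuples n S" for b qs
  proof -
    have "length qs = n" using that by (simp add: tuples_def)
    then show ?thesis using assms n
      by (subst prod_lessThan_Suc_remove[of j])
        (auto simp: nth_append nth_remove_nth nth_Cons split: nat.splits
          intro!: arg_cong2[of _ _ _ _ "(*)"] prod.cong arg_cong2[of _ _ _ _ u] arg_cong[of _ _ "(!) qs"])
  qed
  moreover have "(take j qs @ b # drop j qs) ! j = b" "remove_nth j (take j qs @ b # drop j qs) = qs"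
    if "qs \<in> tuples n S" for b qs
    using that assms n by (auto simp: tuples_def nth_append remove_nth_def)
  ultimately show ?thesis
    using assms unfolding n
    by (subst sum_tuples_insert[of j])
      (auto simp: sum_product mult_ac intro!: sum.cong)
qed

lemma sum_swap3:
  "(\<Sum>a\<in>A. \<Sum>b\<in>B. \<Sum>c\<in>C. f a b c) = (\<Sum>c\<in>C. \<Sum>b\<in>B. \<Sum>a\<in>A. f a b c)"
proof -
  have "(\<Sum>a\<in>A. \<Sum>b\<in>B. \<Sum>c\<in>C. f a b c) = (\<Sum>b\<in>B. \<Sum>a\<in>A. \<Sum>c\<in>C. f a b c)"
    by (rule sum.swap)
  also have "\<dots> = (\<Sum>b\<in>B. \<Sum>c\<in>C. \<Sum>a\<in>A. f a b c)"
    by (rule sum.cong[OF refl]) (rule sum.swap)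
  also have "\<dots> = (\<Sum>c\<in>C. \<Sum>b\<in>B. \<Sum>a\<in>A. f a b c)"
    by (rule sum.swap)
  finally show ?thesis .
qed

text \<open>The points lie in a field, where the quotients in \<open>ratio\<close> exist, and the
  weights in a ring that receives these quotients through \<open>\<phi>\<close>. In the application
  \<open>u y p\<close> is \<open>c p * x p ^ y\<close>, so that summing over \<open>p\<close>
  integrates the monomial with exponent \<open>y\<close>.\<close>

locale point_masses = comm_ring_hom \<phi>
  for \<phi> :: "'k::field \<Rightarrow> 'a::comm_ring_1" +
  fixes S :: "'b set" and x :: "'b \<Rightarrow> 'k" and u :: "'y \<Rightarrow> 'b \<Rightarrow> 'a"
  assumes finite_S: "finite S"
    and x_nz: "\<And>p. p \<in> S \<Longrightarrow> x p \<noteq> 0"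
    and x_sum: "\<And>p q. p \<in> S \<Longrightarrow> q \<in> S \<Longrightarrow> x p + x q \<noteq> 0"
begin

text \<open>The integral of the product of the \<open>u y\<close> against R(x). Its cases of one and
  two entries are \<open>mass\<close> and \<open>pair_corr\<close>.\<close>

definition corr :: "'y list \<Rightarrow> 'a" where
  "corr ys = (\<Sum>ps\<in>tuples (length ys) S.
     (\<Prod>i<length ys. u (ys ! i) (ps ! i)) * \<phi> (ratio_prod (map x ps)))"

definition mass :: "'y \<Rightarrow> 'a" where
  "mass y = (\<Sum>p\<in>S. u y p)"

definition pair_corr :: "'y \<Rightarrow> 'y \<Rightarrow> 'a" where
  "pair_corr y z = (\<Sum>p\<in>S. \<Sum>q\<in>S. u y p * u z q * \<phi> (ratio (x p) (x q)))"

lemma corr_Nil [simp]: "corr [] = 1"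
  by (simp add: corr_def)

lemma pair_corr_antisym: "pair_corr z y = - pair_corr y z"
proof -
  have "pair_corr z y = (\<Sum>p\<in>S. \<Sum>q\<in>S. u z q * u y p * \<phi> (ratio (x q) (x p)))"
    unfolding pair_corr_def by (rule sum.swap)
  also have "\<dots> = (\<Sum>p\<in>S. \<Sum>q\<in>S. - (u y p * u z q * \<phi> (ratio (x p) (x q))))"
  proof (intro sum.cong refl)
    fix p q
    show "u z q * u y p * \<phi> (ratio (x q) (x p)) = - (u y p * u z q * \<phi> (ratio (x p) (x q)))"
      by (subst ratio_antisym) (simp add: hom_uminus mult_ac)
  qed
  finally show ?thesis by (simp add: pair_corr_def sum_negf)
qed

text \<open>This is \<open>ratio_prod_snoc\<close> under the sum: term \<open>j\<close> links point
  \<open>j\<close> with the new point and leaves R of the others, so it factors into a two-point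
  correlation and a shorter correlation. In a decreasing list the last entry is the smallest, which
  is the one to remove when it is negative.\<close>

lemma corr_snoc:
  "corr (ys @ [y]) = (if even (length ys) then mass y * corr ys else 0) +
    (\<Sum>j<length ys. (-1) ^ (length ys - 1 - j) * pair_corr (ys ! j) y * corr (remove_nth j ys))"
proof -
  let ?n = "length ys"
  let ?u = "\<lambda>ps. \<Prod>i<?n. u (ys ! i) (ps ! i)"
  have R: "ratio_prod (map x ps @ [x a]) = (if even ?n then ratio_prod (map x ps) else 0) +
    (\<Sum>j<?n. (-1) ^ (?n - 1 - j) * ratio (x (ps ! j)) (x a) * ratio_prod (map x (remove_nth j ps)))"
    if "ps \<in> tuples ?n S" "a \<in> S" for ps a
  proof -
    have ps: "length ps = ?n" "\<And>p. p \<in> set ps \<Longrightarrow> p \<in> S" using that by (auto simp: tuples_def)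
    have "ratio_prod (map x ps @ [x a]) = (if even (length (map x ps)) then ratio_prod (map x ps) else 0) +
        (\<Sum>j<length (map x ps). (-1) ^ (length (map x ps) - 1 - j) * ratio (map x ps ! j) (x a) *
          ratio_prod (remove_nth j (map x ps)))"
      by (rule ratio_prod_snoc) (use ps x_nz x_sum that in auto)
    then show ?thesis by (simp add: ps map_remove_nth)
  qed
  have "corr (ys @ [y]) = (\<Sum>a\<in>S. \<Sum>ps\<in>tuples ?n S. ?u ps * u y a * \<phi> (ratio_prod (map x ps @ [x a])))"
    unfolding corr_def length_append_singleton sum_tuples_snoc
    by (intro sum.cong refl) (auto simp: tuples_def nth_append)
  also have "\<dots> = (\<Sum>a\<in>S. \<Sum>ps\<in>tuples ?n S. ?u ps * u y a * (if even ?n then \<phi> (ratio_prod (map x ps)) else 0)) +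
     (\<Sum>a\<in>S. \<Sum>ps\<in>tuples ?n S. \<Sum>j<?n. ?u ps * u y a * ((-1) ^ (?n - 1 - j) *
        \<phi> (ratio (x (ps ! j)) (x a)) * \<phi> (ratio_prod (map x (remove_nth j ps)))))"
    by (auto simp: R hom_distribs distrib_left sum_distrib_left sum.distrib intro!: sum.cong)
  also have "(\<Sum>a\<in>S. \<Sum>ps\<in>tuples ?n S. ?u ps * u y a * (if even ?n then \<phi> (ratio_prod (map x ps)) else 0)) =
      (if even ?n then mass y * corr ys else 0)"
    by (simp add: mass_def corr_def sum_product mult_ac)
  also have "(\<Sum>a\<in>S. \<Sum>ps\<in>tuples ?n S. \<Sum>j<?n. ?u ps * u y a * ((-1) ^ (?n - 1 - j) *
        \<phi> (ratio (x (ps ! j)) (x a)) * \<phi> (ratio_prod (map x (remove_nth j ps))))) =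
      (\<Sum>j<?n. (-1) ^ (?n - 1 - j) * (\<Sum>ps\<in>tuples ?n S. ?u ps *
        ((\<Sum>a\<in>S. u y a * \<phi> (ratio (x (ps ! j)) (x a))) * \<phi> (ratio_prod (map x (remove_nth j ps))))))"
    by (subst sum_swap3) (simp add: sum_distrib_left sum_distrib_right mult_ac)
  also have "\<dots> = (\<Sum>j<?n. (-1) ^ (?n - 1 - j) * pair_corr (ys ! j) y * corr (remove_nth j ys))"
  proof (rule sum.cong[OF refl])
    fix j assume "j \<in> {..<?n}"
    then have j: "j < ?n" by simp
    show "(-1) ^ (?n - 1 - j) * (\<Sum>ps\<in>tuples ?n S. ?u ps *
        ((\<Sum>a\<in>S. u y a * \<phi> (ratio (x (ps ! j)) (x a))) * \<phi> (ratio_prod (map x (remove_nth j ps))))) =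
      (-1) ^ (?n - 1 - j) * pair_corr (ys ! j) y * corr (remove_nth j ys)"
      by (subst sum_tuples_factor[OF j, where f = "\<lambda>b. \<Sum>a\<in>S. u y a * \<phi> (ratio (x b) (x a))"
          and g = "\<lambda>qs. \<phi> (ratio_prod (map x qs))"])
        (simp add: pair_corr_def corr_def j sum_distrib_left mult_ac)
  qed
  finally show ?thesis .
qed

lemma corr_Cons_eq_snoc: "corr (y # ys) = (-1) ^ length ys * corr (ys @ [y])"
proof -
  have move: "\<phi> (ratio_prod (x a # map x ps)) = (-1) ^ length ps * \<phi> (ratio_prod (map x ps @ [x a]))" for a ps
    using pair_prod_move[of ratio "[]" "x a" "map x ps" "[]", OF ratio_antisym]
    by (simp add: hom_distribs del: pair_prod.simps)
  have "corr (y # ys) = (\<Sum>a\<in>S. \<Sum>ps\<in>tuples (length ys) S.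
      (\<Prod>i<length ys. u (ys ! i) (ps ! i)) * u y a * \<phi> (ratio_prod (x a # map x ps)))"
    unfolding corr_def length_Cons sum_tuples_Suc prod.lessThan_Suc_shift
    by (intro sum.cong refl) (auto simp: mult_ac simp del: pair_prod.simps)
  also have "\<dots> = (-1) ^ length ys * (\<Sum>a\<in>S. \<Sum>ps\<in>tuples (length ys) S.
      (\<Prod>i<length ys. u (ys ! i) (ps ! i)) * u y a * \<phi> (ratio_prod (map x ps @ [x a])))"
    unfolding sum_distrib_left by (intro sum.cong refl, subst move) (simp add: tuples_def mult_ac)
  also have "(\<Sum>a\<in>S. \<Sum>ps\<in>tuples (length ys) S.
      (\<Prod>i<length ys. u (ys ! i) (ps ! i)) * u y a * \<phi> (ratio_prod (map x ps @ [x a]))) = corr (ys @ [y])"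
    unfolding corr_def length_append_singleton sum_tuples_snoc
    by (intro sum.cong refl) (auto simp: tuples_def nth_append)
  finally show ?thesis .
qed

text \<open>Expansion along the largest entry of a decreasing list; it has the shape of
  \<open>pfaffian_Suc\<close>.\<close>

lemma corr_Cons:
  "corr (y # ys) = (if even (length ys) then mass y * corr ys else 0) +
    (\<Sum>j<length ys. (-1) ^ j * pair_corr y (ys ! j) * corr (remove_nth j ys))"
proof -
  have sgn: "(-1) ^ length ys * ((-1) ^ (length ys - 1 - j) * pair_corr (ys ! j) y * z) =
      (-1) ^ j * pair_corr y (ys ! j) * z" if "j < length ys" for j z
  proof -
    \<comment> \<open>One sign is left over, and the antisymmetry of \<open>pair_corr\<close>
      absorbs it.\<close>
    have "(-1) ^ length ys * (-1) ^ (length ys - 1 - j) = (- ((-1) ^ j) :: 'a)"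
      using that by (cases "even j"; cases "even (length ys)") (auto simp: minus_one_power_iff)
    then show ?thesis by (simp add: pair_corr_antisym[of y] flip: mult.assoc)
  qed
  have "corr (y # ys) = (if even (length ys) then mass y * corr ys else 0) +
    (\<Sum>j<length ys. (-1) ^ length ys * ((-1) ^ (length ys - 1 - j) * pair_corr (ys ! j) y * corr (remove_nth j ys)))"
    unfolding corr_Cons_eq_snoc corr_snoc distrib_left sum_distrib_left by simp
  also have "(\<Sum>j<length ys. (-1) ^ length ys * ((-1) ^ (length ys - 1 - j) * pair_corr (ys ! j) y * corr (remove_nth j ys))) =
      (\<Sum>j<length ys. (-1) ^ j * pair_corr y (ys ! j) * corr (remove_nth j ys))"
    by (rule sum.cong[OF refl], rule sgn) simp
  finally show ?thesis .
qed

end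

section \<open>Hankel determinants of point masses\<close>

text \<open>Solves the Vandermonde system one node at a time. With X the new node, the sequence
  \<open>s (j + 1) - X * s j\<close> needs only the old nodes; dividing its weights by
  \<open>x p - X\<close> undoes this difference operator. The defect \<open>v\<close> is annihilated
  by the operator, hence geometric with ratio X, and is the mass at the new node. The only divisions
  are by differences of nodes in the field.\<close>

lemma exists_point_masses:
  fixes x :: "nat \<Rightarrow> 'k::field" and \<phi> :: "'k \<Rightarrow> 'a::comm_ring_1" and s :: "nat \<Rightarrow> 'a"
  assumes hom: "comm_ring_hom \<phi>" and inj: "inj_on x {..d}"
  shows "\<exists>c. \<forall>j\<le>d. s j = (\<Sum>p\<le>d. c p * \<phi> (x p ^ j))"
  using inj
proof (induction d arbitrary: s)
  case 0
  interpret comm_ring_hom \<phi> by (rule hom)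
  show ?case by (intro exI[of _ s]) auto
next
  case (Suc d)
  interpret comm_ring_hom \<phi> by (rule hom)
  let ?X = "x (Suc d)"
  have "inj_on x {..d}" using Suc.prems by (rule inj_on_subset) auto
  then obtain c' where c': "\<And>j. j \<le> d \<Longrightarrow> s (Suc j) - \<phi> ?X * s j = (\<Sum>p\<le>d. c' p * \<phi> (x p ^ j))"
    using Suc.IH[of "\<lambda>j. s (Suc j) - \<phi> ?X * s j"] by auto
  define c where "c p = c' p * \<phi> (1 / (x p - ?X))" for p
  define v where "v j = s j - (\<Sum>p\<le>d. c p * \<phi> (x p ^ j))" for j
  have c: "c p * \<phi> (x p ^ Suc j) - \<phi> ?X * (c p * \<phi> (x p ^ j)) = c' p * \<phi> (x p ^ j)" if "p \<le> d" for p j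
  proof -
    have nz: "x p - ?X \<noteq> 0" using Suc.prems that inj_onD[OF Suc.prems, of p "Suc d"] by auto
    have "c p * \<phi> (x p ^ Suc j) - \<phi> ?X * (c p * \<phi> (x p ^ j)) = c' p * \<phi> (1 / (x p - ?X) * (x p - ?X) * x p ^ j)"
      by (simp only: c_def hom_mult hom_minus power_Suc mult.assoc right_diff_distrib left_diff_distrib
          mult.left_commute mult.commute)
    then show ?thesis using nz by simp
  qed
  have v: "v (Suc j) = \<phi> ?X * v j" if "j \<le> d" for j
  proof -
    have "v (Suc j) - \<phi> ?X * v j = (s (Suc j) - \<phi> ?X * s j) -
        (\<Sum>p\<le>d. c p * \<phi> (x p ^ Suc j) - \<phi> ?X * (c p * \<phi> (x p ^ j)))"
      by (simp add: v_def sum_subtractf sum_distrib_left algebra_simps)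
    also have "\<dots> = 0" using c'[OF that] c by simp
    finally show ?thesis by simp
  qed
  have v_geometric: "v j = v 0 * \<phi> (?X ^ j)" if "j \<le> Suc d" for j
    using that by (induction j) (auto simp: v hom_distribs mult_ac)
  have "s j = (\<Sum>p\<le>d. c p * \<phi> (x p ^ j)) + v 0 * \<phi> (?X ^ j)" if "j \<le> Suc d" for j
    unfolding v_geometric[OF that, symmetric] by (simp add: v_def)
  then have "s j = (\<Sum>p\<le>Suc d. (if p = Suc d then v 0 else c p) * \<phi> (x p ^ j))" if "j \<le> Suc d" for j
    using that by simp
  then show ?case by (intro exI allI impI)
qed

section \<open>Determinants as sums over permutations, and the Cauchy-Binet formula\<close>

lemma det_mat_leibniz:
  "det (mat n n (\<lambda>(i, j). A i j)) =
    (\<Sum>\<sigma> | \<sigma> permutes {..<n}. of_int (sign \<sigma>) * (\<Prod>i<n. A i (\<sigma> i) :: 'a::comm_ring_1))"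
  unfolding det_def by (auto simp: atLeast0LessThan intro!: sum.cong prod.cong)

lemma det_mat_transpose:
  "det (mat n n (\<lambda>(i, j). A j i)) = (det (mat n n (\<lambda>(i, j). A i j)) :: 'a::comm_ring_1)"
proof -
  have "mat n n (\<lambda>(i, j). A j i) = transpose_mat (mat n n (\<lambda>(i, j). A i j))" by (rule eq_matI) auto
  then show ?thesis by (simp add: det_transpose[of _ n])
qed

lemma det_mat_permute_rows:
  fixes A :: "nat \<Rightarrow> nat \<Rightarrow> 'a::comm_ring_1"
  assumes "\<sigma> permutes {..<n}"
  shows "det (mat n n (\<lambda>(i, j). A (\<sigma> i) j)) = of_int (sign \<sigma>) * det (mat n n (\<lambda>(i, j). A i j))"
proof -
  have "mat n n (\<lambda>(i, j). A (\<sigma> i) j) = mat n n (\<lambda>(i, j). mat n n (\<lambda>(i, j). A i j) $$ (\<sigma> i, j))"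
    using assms permutes_in_image[OF assms] by (intro eq_matI) auto
  then show ?thesis
    using det_permute_rows[of "mat n n (\<lambda>(i, j). A i j)" n \<sigma>] assms
    by (simp add: atLeast0LessThan)
qed

lemma det_mat_scale_columns:
  fixes A :: "nat \<Rightarrow> nat \<Rightarrow> 'a::comm_ring_1"
  shows "det (mat n n (\<lambda>(i, j). f j * A i j)) = (\<Prod>j<n. f j) * det (mat n n (\<lambda>(i, j). A i j))"
proof -
  have "(\<Prod>i<n. f (\<sigma> i)) = (\<Prod>j<n. f j)" if "\<sigma> permutes {..<n}" for \<sigma>
    using prod.permute[OF that, of f] by (simp add: o_def)
  then show ?thesis
    by (simp add: det_mat_leibniz prod.distrib sum_distrib_left mult_ac)
qed

lemma det_mat_eq_rows:
  fixes A :: "nat \<Rightarrow> nat \<Rightarrow> 'a::comm_ring_1"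
  assumes "a < n" "b < n" "a \<noteq> b" "\<And>j. j < n \<Longrightarrow> A a j = A b j"
  shows "det (mat n n (\<lambda>(i, j). A i j)) = 0"
  by (rule det_identical_rows[of _ n a b]) (use assms in \<open>auto intro!: eq_vecI\<close>)

text \<open>Expanding the sums into tuples leaves a determinant that is antisymmetric in the tuple,
  which \<open>sum_tuples_antisym\<close> collects by subsets.\<close>

lemma cauchy_binet:
  fixes a :: "nat \<Rightarrow> 'b::linorder \<Rightarrow> 'a::comm_ring_1"
  assumes "finite S"
  shows "det (mat n n (\<lambda>(i, j). \<Sum>p\<in>S. a i p * b p j)) =
    (\<Sum>I | I \<subseteq> S \<and> card I = n. det (mat n n (\<lambda>(i, j). a i (desc_list I ! j))) *
       det (mat n n (\<lambda>(i, j). b (desc_list I ! i) j)))"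
proof -
  have "det (mat n n (\<lambda>(i, j). \<Sum>p\<in>S. a i p * b p j)) =
      (\<Sum>\<sigma> | \<sigma> permutes {..<n}. \<Sum>ps\<in>tuples n S. of_int (sign \<sigma>) *
        ((\<Prod>i<n. a i (ps ! i)) * (\<Prod>i<n. b (ps ! i) (\<sigma> i))))"
    by (simp add: det_mat_leibniz prod_sum_tuples prod.distrib sum_distrib_left)
  also have "\<dots> = (\<Sum>ps\<in>tuples n S. (\<Prod>i<n. a i (ps ! i)) * det (mat n n (\<lambda>(i, j). b (ps ! i) j)))"
    by (subst sum.swap) (simp add: det_mat_leibniz sum_distrib_left mult_ac)
  also have "\<dots> = (\<Sum>I | I \<subseteq> S \<and> card I = n. det (mat n n (\<lambda>(i, j). a i (desc_list I ! j))) *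
       det (mat n n (\<lambda>(i, j). b (desc_list I ! i) j)))"
  proof (rule sum_tuples_antisym[OF assms])
    fix \<sigma> and ps :: "'b list" assume ps: "length ps = n" and s: "\<sigma> permutes {..<n}"
    have "mat n n (\<lambda>(i, j). b (permute_list \<sigma> ps ! i) j) = mat n n (\<lambda>(i, j). b (ps ! \<sigma> i) j)"
      using ps s by (intro eq_matI) (auto simp: permute_list_nth)
    then show "det (mat n n (\<lambda>(i, j). b (permute_list \<sigma> ps ! i) j)) =
        of_int (sign \<sigma>) * det (mat n n (\<lambda>(i, j). b (ps ! i) j))"
      using det_mat_permute_rows[OF s, of "\<lambda>i. b (ps ! i)"] by simp
  next
    fix ps :: "'b list" assume ps: "length ps = n" "\<not> distinct ps"
    then obtain i j where "i < n" "j < n" "i \<noteq> j" "ps ! i = ps ! j"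
      by (auto simp: distinct_conv_nth)
    then show "det (mat n n (\<lambda>(i, j). b (ps ! i) j)) = 0"
      by (intro det_mat_eq_rows[of i n j]) auto
  qed
  finally show ?thesis .
qed

lemma pair_prod_cong:
  "(\<And>a b. a \<in> set xs \<Longrightarrow> b \<in> set xs \<Longrightarrow> f a b = g a b) \<Longrightarrow> pair_prod f xs = pair_prod g xs"
  by (induction xs) (auto intro!: arg_cong2[of _ _ _ _ "(*)"] arg_cong[of _ _ prod_list])

lemma pair_prod_map: "pair_prod f (map g xs) = pair_prod (\<lambda>a b. f (g a) (g b)) xs"
  by (induction xs) (auto simp: o_def)

text \<open>Positive integers are distinct and have non-zero sums in characteristic 0, which is all
  that the partial fractions ask of the points.\<close>

definition pt :: "nat \<Rightarrow> 'k::field_char_0" where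
  "pt p = of_nat (Suc p)"

lemma pt_nonzero: "pt p \<noteq> 0"
  by (simp add: pt_def del: of_nat_Suc)

lemma pt_add_nonzero: "pt p + pt r \<noteq> 0"
  using of_nat_eq_0_iff[of "Suc p + Suc r", where 'a = 'a]
  by (simp add: pt_def of_nat_add[symmetric] del: of_nat_Suc)

text \<open>The number of nodes, \<open>2 * b + 1\<close>, is the number of exponents from
  \<open>- b\<close> to \<open>b\<close>.\<close>

locale mass_system = comm_ring_hom \<phi>
  for \<phi> :: "'k::field_char_0 \<Rightarrow> 'a::comm_ring_1" +
  fixes q :: "int \<Rightarrow> 'a" and c :: "nat \<Rightarrow> 'a" and b :: nat
  assumes masses: "\<And>k. \<bar>k\<bar> \<le> int b \<Longrightarrow> q k = (\<Sum>p\<le>2 * b. c p * \<phi> (pt p powi k))"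
begin

sublocale point_masses \<phi> "{..2 * b}" pt "\<lambda>y p. c p * \<phi> (pt p powi y)"
  by unfold_locales (simp_all add: pt_nonzero pt_add_nonzero)

lemma hom_det_mat: "det (mat n n (\<lambda>(i, j). \<phi> (A i j))) = \<phi> (det (mat n n (\<lambda>(i, j). A i j)))"
proof -
  have "mat n n (\<lambda>(i, j). \<phi> (A i j)) = map_mat \<phi> (mat n n (\<lambda>(i, j). A i j))"
    by (rule eq_matI) auto
  then show ?thesis by simp
qed

lemma mass_eq: "\<bar>k\<bar> \<le> int b \<Longrightarrow> mass k = q k"
  by (simp add: mass_def masses)

text \<open>\<open>Y\<close> collects the exponents \<open>s + 2 * i - 2 * \<beta>\<close> that
  occur when row \<open>i < n\<close> is expanded in the coefficients \<open>e \<beta>\<close> with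
  0 \<le> \<open>\<beta>\<close> \<le> \<open>B\<close>. The relation for \<open>h\<close> is asked
  exactly on the range of the Hankel indices, and \<open>bound\<close> keeps every exponent where
  the masses represent \<open>q\<close>.\<close>

theorem hankel_expansion:
  fixes e h :: "int \<Rightarrow> 'a" and s :: int and n B :: nat
  defines "Y \<equiv> (\<lambda>k. s + 2 * k) ` {- int B..<int n}"
  assumes e: "\<And>k. k < 0 \<or> k > int B \<Longrightarrow> e k = 0"
    and h: "\<And>k. s \<le> k \<Longrightarrow> k \<le> s + 2 * int n - 2 \<Longrightarrow> h k = (\<Sum>\<beta>\<in>{0..int B}. e \<beta> * q (k - 2 * \<beta>))"
    and bound: "\<bar>s\<bar> + 2 * int n + 2 * int B \<le> int b"
  shows "det (mat n n (\<lambda>(i, j). h (s + int i + int j))) =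
    (\<Sum>I | I \<subseteq> Y \<and> card I = n.
       det (mat n n (\<lambda>(i, j). e ((s + 2 * int i - desc_list I ! j) div 2))) * corr (desc_list I))"
proof -
  let ?x = "pt :: nat \<Rightarrow> 'k"
  let ?S = "{..2 * b}"
  let ?I = "{I. I \<subseteq> ?S \<and> card I = n}"
  let ?T = "\<lambda>i y. e ((s + 2 * int i - y) div 2)"
  \<comment> \<open>The weights that represent \<open>h\<close>: convolving with \<open>e\<close> in
    steps of two multiplies the mass at x by e(x^(-2)).\<close>
  define \<gamma> where "\<gamma> p = c p * (\<Sum>\<beta>\<in>{0..int B}. e \<beta> * \<phi> (?x p powi (- 2 * \<beta>)))" for p
  have finY: "finite Y" by (simp add: Y_def)
  note xnz = pt_nonzero[where 'a = 'k]
  have h_mass: "h (s + int i + int j) = (\<Sum>p\<in>?S. (\<gamma> p * \<phi> (?x p powi (s + int i))) * \<phi> (?x p ^ j))"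
    if "i < n" "j < n" for i j
  proof -
    have "h (s + int i + int j) = (\<Sum>\<beta>\<in>{0..int B}. e \<beta> * q (s + int i + int j - 2 * \<beta>))"
      by (rule h) (use that in auto)
    also have "\<dots> = (\<Sum>\<beta>\<in>{0..int B}. \<Sum>p\<in>?S. e \<beta> * (c p * \<phi> (?x p powi (s + int i + int j - 2 * \<beta>))))"
      unfolding sum_distrib_left[symmetric]
      by (intro sum.cong refl arg_cong2[of _ _ _ _ "(*)"] masses) (use that bound in auto)
    also have "\<dots> = (\<Sum>p\<in>?S. \<Sum>\<beta>\<in>{0..int B}. e \<beta> * (c p * \<phi> (?x p powi (s + int i + int j - 2 * \<beta>))))"
      by (rule sum.swap)
    also have "\<dots> = (\<Sum>p\<in>?S. (\<gamma> p * \<phi> (?x p powi (s + int i))) * \<phi> (?x p ^ j))"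
    proof (rule sum.cong[OF refl])
      fix p
      have "?x p powi (s + int i + int j - 2 * \<beta>) = ?x p powi (s + int i) * ?x p ^ j * ?x p powi (- 2 * \<beta>)" for \<beta>
      proof -
        have "?x p powi (s + int i + int j - 2 * \<beta>) = ?x p powi ((s + int i) + int j + (- 2 * \<beta>))" by simp
        also have "\<dots> = ?x p powi (s + int i) * ?x p powi int j * ?x p powi (- 2 * \<beta>)"
          by (simp only: power_int_add[OF disjI1[OF xnz]])
        finally show ?thesis by (simp only: power_int_of_nat)
      qed
      then show "(\<Sum>\<beta>\<in>{0..int B}. e \<beta> * (c p * \<phi> (?x p powi (s + int i + int j - 2 * \<beta>)))) =
          (\<gamma> p * \<phi> (?x p powi (s + int i))) * \<phi> (?x p ^ j)"
        by (simp only: \<gamma>_def hom_mult sum_distrib_left sum_distrib_right mult_ac)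
    qed
    finally show ?thesis .
  qed
  \<comment> \<open>The reverse move for rows with doubled index: e(x^(-2)) is expanded again, so
    the row becomes a combination of pure powers with exponents in \<open>Y\<close>.\<close>
  have T_mass: "\<gamma> p * \<phi> (?x p powi (s + 2 * int i)) = (\<Sum>y\<in>Y. ?T i y * (c p * \<phi> (?x p powi y)))"
    if "i < n" for i p
  proof -
    have "(\<Sum>y\<in>Y. ?T i y * (c p * \<phi> (?x p powi y))) =
        (\<Sum>k\<in>{- int B..<int n}. e (int i - k) * (c p * \<phi> (?x p powi (s + 2 * k))))"
      unfolding Y_def by (subst sum.reindex) (auto simp: inj_on_def
          intro!: sum.cong arg_cong2[of _ _ _ _ "(*)"] arg_cong[of _ _ e])
    also have "\<dots> = (\<Sum>k\<in>{int i - int B..int i}. e (int i - k) * (c p * \<phi> (?x p powi (s + 2 * k))))"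
      by (rule sum.mono_neutral_right) (use that in \<open>auto simp: e\<close>)
    also have "\<dots> = (\<Sum>\<beta>\<in>{0..int B}. e \<beta> * (c p * \<phi> (?x p powi (s + 2 * (int i - \<beta>)))))"
      by (rule sum.reindex_bij_witness[of _ "\<lambda>\<beta>. int i - \<beta>" "\<lambda>k. int i - k"]) auto
    also have "\<dots> = \<gamma> p * \<phi> (?x p powi (s + 2 * int i))"
    proof -
      have "?x p powi (s + 2 * (int i - \<beta>)) = ?x p powi (s + 2 * int i) * ?x p powi (- 2 * \<beta>)" for \<beta>
        by (simp only: power_int_add[OF disjI1[OF xnz], symmetric]) (simp add: algebra_simps)
      then show ?thesis
        by (simp only: \<gamma>_def hom_mult sum_distrib_left sum_distrib_right mult_ac)
    qed
    finally show ?thesis by simp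
  qed
  let ?\<Gamma> = "\<lambda>I. det (mat n n (\<lambda>(i, j). \<gamma> (desc_list I ! j) * \<phi> (?x (desc_list I ! j) powi (s + int i))))"
  let ?H = "\<lambda>I. det (mat n n (\<lambda>(i, j). \<phi> (?x (desc_list I ! i) ^ j)))"
  let ?K = "\<lambda>I. det (mat n n (\<lambda>(i, j). \<Sum>y\<in>Y. ?T i y * (c (desc_list I ! j) * \<phi> (?x (desc_list I ! j) powi y))))"
  let ?W = "\<lambda>I J. det (mat n n (\<lambda>(i, j). c (desc_list I ! j) * \<phi> (?x (desc_list I ! j) powi (desc_list J ! i))))"
  let ?E = "\<lambda>J. det (mat n n (\<lambda>(i, j). ?T i (desc_list J ! j)))"
  let ?R = "\<lambda>I. \<phi> (ratio_prod (map ?x (desc_list I)))"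
  have "det (mat n n (\<lambda>(i, j). h (s + int i + int j))) =
      det (mat n n (\<lambda>(i, j). \<Sum>p\<in>?S. (\<gamma> p * \<phi> (?x p powi (s + int i))) * \<phi> (?x p ^ j)))"
    by (intro arg_cong[of _ _ det] eq_matI) (simp_all add: h_mass)
  \<comment> \<open>First Cauchy-Binet, over sets of points. Both determinants are Vandermonde
    determinants, the first one up to scaling of its columns.\<close>
  also have "\<dots> = (\<Sum>I\<in>?I. ?\<Gamma> I *
      ?H I)"
    by (rule cauchy_binet) simp
  also have "\<dots> = (\<Sum>I\<in>?I. ?K I *
      ?R I)"
  proof (rule sum.cong[OF refl])
    fix I assume "I \<in> ?I"
    then have I: "I \<subseteq> ?S" "card I = n" by auto
    define xs where "xs = map ?x (desc_list I)"
    have xs: "length xs = n" using I by (simp add: xs_def)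
    have xs_nth: "?x (desc_list I ! i) = xs ! i" if "i < n" for i using that I by (simp add: xs_def)
    have xs_nz: "xs ! i \<noteq> 0" if "i < n" for i using xs_nth[OF that] xnz by metis
    have V1: "det (mat n n (\<lambda>(i, j). \<phi> (xs ! j ^ i))) = \<phi> (pair_prod (\<lambda>x y. y - x) xs)"
      unfolding det_vandermonde[OF xs, symmetric] by (rule hom_det_mat)
    have V2: "det (mat n n (\<lambda>(i, j). \<phi> (xs ! j ^ (2 * i)))) = \<phi> (pair_prod (\<lambda>x y. y ^ 2 - x ^ 2) xs)"
    proof -
      have "det (mat n n (\<lambda>(i, j). (map (\<lambda>t. t ^ 2) xs ! j) ^ i)) = pair_prod (\<lambda>x y. y - x) (map (\<lambda>t. t ^ 2) xs)"
        by (rule det_vandermonde) (simp add: xs)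
      also have "mat n n (\<lambda>(i, j). (map (\<lambda>t. t ^ 2) xs ! j) ^ i) = mat n n (\<lambda>(i, j). xs ! j ^ (2 * i))"
        by (rule eq_matI) (simp_all add: xs power_mult)
      finally show ?thesis
        by (simp only: pair_prod_map hom_det_mat flip: power2_eq_square)
    qed
    have sq: "pair_prod (\<lambda>x y. y - x) xs * pair_prod (\<lambda>x y. y - x) xs =
        pair_prod (\<lambda>x y. y ^ 2 - x ^ 2) xs * ratio_prod xs"
      unfolding pair_prod_mult[symmetric]
    proof (rule pair_prod_cong)
      fix a b assume "a \<in> set xs" "b \<in> set xs"
      then have "b + a \<noteq> 0" using x_sum I by (auto simp: xs_def finite_subset[OF I(1)])
      then show "(b - a) * (b - a) = (b ^ 2 - a ^ 2) * ratio a b"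
        by (simp add: ratio_def field_simps power2_eq_square)
    qed
    \<comment> \<open>The column factors shared by \<open>?\<Gamma>\<close> and \<open>?K\<close>;
      passing from one to the other only replaces the Vandermonde product in x by that in
      x^2.\<close>
    let ?f = "\<lambda>j. \<gamma> (desc_list I ! j) * \<phi> (xs ! j powi s)"
    have "mat n n (\<lambda>(i, j). \<gamma> (desc_list I ! j) * \<phi> (?x (desc_list I ! j) powi (s + int i))) =
        mat n n (\<lambda>(i, j). ?f j * \<phi> (xs ! j ^ i))"
      by (rule eq_matI) (simp_all add: xs_nth xs_nz power_int_add hom_mult mult_ac)
    then have 1: "?\<Gamma> I =
        (\<Prod>j<n. ?f j) * \<phi> (pair_prod (\<lambda>x y. y - x) xs)"
      by (simp only: det_mat_scale_columns V1)
    have "mat n n (\<lambda>(i, j). \<phi> (?x (desc_list I ! i) ^ j)) = mat n n (\<lambda>(i, j). \<phi> (xs ! i ^ j))"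
      by (rule eq_matI) (simp_all add: xs_nth)
    then have 2: "?H I = \<phi> (pair_prod (\<lambda>x y. y - x) xs)"
      using V1 det_mat_transpose[of n "\<lambda>i j. \<phi> (xs ! j ^ i)"] by simp
    have "mat n n (\<lambda>(i, j). \<Sum>y\<in>Y. ?T i y * (c (desc_list I ! j) * \<phi> (?x (desc_list I ! j) powi y))) =
        mat n n (\<lambda>(i, j). ?f j * \<phi> (xs ! j ^ (2 * i)))"
    proof (rule eq_matI, goal_cases)
      case (1 i j)
      then have "i < n" "j < n" by auto
      then have "(\<Sum>y\<in>Y. ?T i y * (c (desc_list I ! j) * \<phi> (?x (desc_list I ! j) powi y))) =
          \<gamma> (desc_list I ! j) * \<phi> (xs ! j powi (s + 2 * int i))"
        using T_mass[OF \<open>i < n\<close>, of "desc_list I ! j"] by (simp only: xs_nth[OF \<open>j < n\<close>])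
      also have "xs ! j powi (s + 2 * int i) = xs ! j powi s * xs ! j ^ (2 * i)"
        using xs_nz[OF \<open>j < n\<close>] power_int_of_nat[of "xs ! j" "2 * i"] by (simp add: power_int_add)
      finally show ?case using \<open>i < n\<close> \<open>j < n\<close> by (simp add: hom_mult mult_ac)
    qed auto
    then have 3: "?K I =
        (\<Prod>j<n. ?f j) * \<phi> (pair_prod (\<lambda>x y. y ^ 2 - x ^ 2) xs)"
      by (simp only: det_mat_scale_columns V2)
    show "?\<Gamma> I *
      ?H I =
      ?K I *
      ?R I"
      unfolding 1 2 3 xs_def[symmetric] using arg_cong[OF sq, of \<phi>]
      by (simp only: hom_mult mult.assoc)
  qed
  \<comment> \<open>Second Cauchy-Binet, now over sets of exponents.\<close>
  also have "\<dots> = (\<Sum>I\<in>?I. (\<Sum>J | J \<subseteq> Y \<and> card J = n. ?E J *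
       ?W I J) *
      ?R I)"
    by (subst cauchy_binet[OF finY]) simp
  also have "\<dots> = (\<Sum>J | J \<subseteq> Y \<and> card J = n. ?E J *
      (\<Sum>I\<in>?I. ?W I J *
        ?R I))"
    unfolding sum_distrib_left sum_distrib_right by (subst sum.swap) (simp only: mult.assoc)
  also have "\<dots> = (\<Sum>J | J \<subseteq> Y \<and> card J = n. ?E J * corr (desc_list J))"
  proof (rule sum.cong[OF refl])
    fix J assume "J \<in> {J. J \<subseteq> Y \<and> card J = n}"
    then have J: "card J = n" by auto
    \<comment> \<open>The sum over point sets is the sum over all tuples in \<open>corr\<close>,
      because R is antisymmetric and vanishes on repetitions.\<close>
    have "corr (desc_list J) = (\<Sum>I\<in>?I. ?W I J *
        ?R I)"
      unfolding corr_def desc_list_props J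
    proof (rule sum_tuples_antisym)
      fix \<sigma> and ps :: "nat list" assume "length ps = n" "\<sigma> permutes {..<n}"
      then show "\<phi> (ratio_prod (map ?x (permute_list \<sigma> ps))) = of_int (sign \<sigma>) * \<phi> (ratio_prod (map ?x ps))"
        by (simp add: permute_list_map[symmetric] pair_prod_permute_list[OF ratio_antisym] hom_mult hom_signof
           )
    next
      fix ps :: "nat list" assume "\<not> distinct ps"
      then have "ratio_prod (map ?x ps) = 0"
        by (intro pair_prod_not_distinct) (auto simp: distinct_map)
      then show "\<phi> (ratio_prod (map ?x ps)) = 0" by simp
    qed simp
    then show "?E J *
      (\<Sum>I\<in>?I. ?W I J *
        ?R I) = ?E J * corr (desc_list J)"
      by simp
  qed
  finally show ?thesis .
qed

end

section \<open>Pair correlations and matched exponents\<close>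

lemma sorted_wrt_desc_list: "sorted_wrt (>) (desc_list (I :: 'b::linorder set))"
  using strict_sorted_list_of_set[of I] by (simp add: desc_list_def sorted_wrt_rev)

lemma desc_list_set:
  assumes "sorted_wrt (>) (xs :: 'b::linorder list)"
  shows "desc_list (set xs) = xs"
proof -
  have "sorted_wrt (<) (rev xs)" using assms by (simp add: sorted_wrt_rev)
  then have "sorted (rev xs)" "distinct (rev xs)" by (auto simp: strict_sorted_iff)
  then have "sorted_list_of_set (set (rev xs)) = rev xs"
    by (rule sorted_list_of_set.idem_if_sorted_distinct)
  then show ?thesis by (simp add: desc_list_def)
qed

lemma sorted_wrt_remove_nth: "j < length xs \<Longrightarrow> sorted_wrt P xs \<Longrightarrow> sorted_wrt P (remove_nth j xs)"
  by (subst (asm) (2) id_take_nth_drop) (auto simp: remove_nth_def sorted_wrt_append)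

lemma set_remove_nth: "j < length xs \<Longrightarrow> distinct xs \<Longrightarrow> set (remove_nth j xs) = set xs - {xs ! j}"
  by (subst (asm) (2) id_take_nth_drop, assumption, subst (3) id_take_nth_drop, assumption)
    (auto simp: remove_nth_def)

lemma remove_nth_desc_list:
  assumes "finite I" "j < card I"
  shows "remove_nth j (desc_list I) = desc_list (I - {desc_list I ! j})"
proof -
  have "sorted_wrt (>) (remove_nth j (desc_list I))"
    using assms by (intro sorted_wrt_remove_nth sorted_wrt_desc_list) simp
  then have "desc_list (set (remove_nth j (desc_list I))) = remove_nth j (desc_list I)"
    by (rule desc_list_set)
  then show ?thesis using assms by (simp add: set_remove_nth)
qed

lemma desc_list_Min:
  assumes "finite I" "I \<noteq> {}"
  shows "desc_list I = desc_list (I - {Min I}) @ [Min I]"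
  using sorted_list_of_set_nonempty[OF assms] by (simp add: desc_list_def)

text \<open>Turns the position that governs the sign in \<open>corr_snoc\<close> into a count of
  smaller elements.\<close>

lemma card_below_desc_list:
  assumes "finite I" "j < card I"
  shows "card {y \<in> I. y < desc_list I ! j} = card I - 1 - j"
proof -
  let ?xs = "desc_list I"
  have l: "j < length ?xs" using assms by simp
  have xs: "?xs = take j ?xs @ ?xs ! j # drop (Suc j) ?xs" by (rule id_take_nth_drop[OF l])
  have s: "sorted_wrt (>) (take j ?xs @ ?xs ! j # drop (Suc j) ?xs)"
    using sorted_wrt_desc_list[of I] xs by simp
  have "{y \<in> I. y < ?xs ! j} = {y \<in> set ?xs. y < ?xs ! j}" using assms by simp
  also have "\<dots> = {y \<in> set (take j ?xs @ ?xs ! j # drop (Suc j) ?xs). y < ?xs ! j}"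
    using xs by simp
  also have "\<dots> = set (drop (Suc j) ?xs)" using s by (auto simp: sorted_wrt_append)
  finally show ?thesis using assms by (simp add: distinct_card)
qed

text \<open>The assumption \<open>q_rel\<close> is q(z) q(-z) = 1, coefficient by
  coefficient.\<close>

locale schur_q_system = mass_system \<phi> q c b
  for \<phi> :: "'k::field_char_0 \<Rightarrow> 'a::comm_ring_1" and q c b +
  assumes q_neg: "k < 0 \<Longrightarrow> q k = 0" and q_0: "q 0 = 1"
    and q_rel: "n > 0 \<Longrightarrow> (\<Sum>i\<le>n. (-1) ^ i * q (int i) * q (int (n - i))) = 0"
begin

text \<open>The formula of \<open>Q_pair_gt\<close>, read at integer indices in any order.\<close>

definition pair_q :: "int \<Rightarrow> int \<Rightarrow> 'a" where
  "pair_q y z = q y * q z + 2 * (\<Sum>i = 1..nat z. (-1) ^ i * q (y + int i) * q (z - int i))"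

lemma pair_q_0: "pair_q y 0 = q y"
  by (simp add: pair_q_def q_0)

text \<open>The relation \<open>q_rel\<close> of degree \<open>2 * a\<close> is symmetric about its
  middle term; folding it there gives \<open>pair_q y y\<close> up to sign. It settles the diagonal,
  where the recurrence for \<open>pair_corr\<close> starts.\<close>

lemma pair_q_diag:
  assumes "y > 0"
  shows "pair_q y y = 0"
proof -
  obtain a where a: "y = int a" "a > 0" using assms by (cases y) auto
  let ?f = "\<lambda>i. (-1) ^ i * q (int i) * q (int (2 * a - i))"
  have "0 = (\<Sum>i\<le>2 * a. ?f i)" using q_rel[of "2 * a"] a by simp
  also have "{..2 * a} = {..<a} \<union> {a} \<union> {a<..2 * a}" using a by auto
  also have "(\<Sum>i\<in>\<dots>. ?f i) = (\<Sum>i<a. ?f i) + ?f a + (\<Sum>i\<in>{a<..2 * a}. ?f i)"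
    by (subst sum.union_disjoint; (subst sum.union_disjoint)?) auto
  also have "(\<Sum>i<a. ?f i) = (\<Sum>i\<in>{1..a}. (-1) ^ (a + i) * q (int a + int i) * q (int a - int i))"
  proof (rule sum.reindex_bij_witness[of _ "\<lambda>i. a - i" "\<lambda>i. a - i"], goal_cases)
    case (5 i)
    then have "(-1) ^ (a + (a - i)) = ((-1) ^ i :: 'a)" "int (2 * a - i) = int a + int (a - i)"
      "int a - int (a - i) = int i" by (auto simp: minus_one_power_iff)
    then show ?case by (simp add: mult_ac)
  qed auto
  also have "(\<Sum>i\<in>{a<..2 * a}. ?f i) = (\<Sum>i\<in>{1..a}. (-1) ^ (a + i) * q (int a + int i) * q (int a - int i))"
    by (rule sum.reindex_bij_witness[of _ "\<lambda>i. i + a" "\<lambda>i. i - a"])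
      (auto simp: of_nat_diff add.commute intro!: arg_cong2[of _ _ _ _ "(*)"] arg_cong[of _ _ q])
  also have "(\<Sum>i\<in>{1..a}. (-1) ^ (a + i) * q (int a + int i) * q (int a - int i)) + ?f a +
      (\<Sum>i\<in>{1..a}. (-1) ^ (a + i) * q (int a + int i) * q (int a - int i)) = (-1) ^ a * pair_q y y"
    by (simp add: pair_q_def a power_add algebra_simps sum_distrib_left)
  finally have "(-1) ^ a * ((-1) ^ a * pair_q y y) = 0" by simp
  then show ?thesis by (simp add: mult.assoc[symmetric] power_mult_distrib[symmetric])
qed

text \<open>The terms of the alternating sum for \<open>(y, z)\<close> after the first are the
  negatives of those for \<open>(y + 1, z - 1)\<close>, so the doubled sums cancel except for one
  product.\<close>

lemma pair_q_shift:
  assumes "z > 0"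
  shows "pair_q (y + 1) (z - 1) + pair_q y z = q y * q z - q (y + 1) * q (z - 1)"
proof -
  obtain m where m: "z = int (Suc m)" using assms by (metis zero_less_imp_eq_int gr0_implies_Suc)
  have "(\<Sum>i = 1..Suc m. (-1) ^ i * q (y + int i) * q (z - int i)) =
      - (q (y + 1) * q (z - 1)) + (\<Sum>i = 1..m. (-1) ^ Suc i * q (y + int (Suc i)) * q (z - int (Suc i)))"
    by (subst sum.atLeast_Suc_atMost) (simp_all only: One_nat_def sum.shift_bounds_cl_Suc_ivl, simp)
  also have "(\<Sum>i = 1..m. (-1) ^ Suc i * q (y + int (Suc i)) * q (z - int (Suc i))) =
      - (\<Sum>i = 1..m. (-1) ^ i * q (y + 1 + int i) * q (z - 1 - int i))"
    by (simp add: sum_negf[symmetric] algebra_simps)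
  finally have T: "(\<Sum>i = 1..Suc m. (-1) ^ i * q (y + int i) * q (z - int i)) =
      - (q (y + 1) * q (z - 1)) + - (\<Sum>i = 1..m. (-1) ^ i * q (y + 1 + int i) * q (z - 1 - int i))" .
  have n: "nat z = Suc m" "nat (z - 1) = m" using m by auto
  have "(P' * Q' + 2 * S) + (P * Q + 2 * T) = P * Q - P' * Q'" if "T = - (P' * Q') + - S"
    for P Q P' Q' S T :: 'a
    unfolding that by (simp add: algebra_simps)
  from this[OF T] show ?thesis unfolding pair_q_def n .
qed

text \<open>For points X and Z, adding the two integrands produces the factor X + Z, which clears
  the denominator of \<open>ratio\<close>. The remaining integrand is a difference of products and
  splits into one-point sums, giving the recurrence of \<open>pair_q_shift\<close>.\<close>

lemma pair_corr_shift:
  assumes "\<bar>y\<bar> \<le> int b" "\<bar>y + 1\<bar> \<le> int b" "\<bar>z\<bar> \<le> int b" "\<bar>z - 1\<bar> \<le> int b"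
  shows "pair_corr (y + 1) (z - 1) + pair_corr y z = q y * q z - q (y + 1) * q (z - 1)"
proof -
  let ?x = "pt :: nat \<Rightarrow> 'k"
  note xnz = pt_nonzero[where 'a = 'k]
  have ratio_id: "?x p powi (y + 1) * ?x r powi (z - 1) * ratio (?x p) (?x r) +
      ?x p powi y * ?x r powi z * ratio (?x p) (?x r) =
      ?x p powi y * ?x r powi z - ?x p powi (y + 1) * ?x r powi (z - 1)" if "p \<le> 2 * b" "r \<le> 2 * b" for p r
  proof -
    have s: "?x r + ?x p \<noteq> 0" using x_sum[of r p] that by simp
    have 1: "?x p powi (y + 1) = ?x p powi y * ?x p" "?x r powi z = ?x r powi (z - 1) * ?x r"
      using xnz[of p] xnz[of r] power_int_add_1[of "?x p" y] power_int_add_1[of "?x r" "z - 1"] by auto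
    have "A * X * Y * ((Y' - X) / (Y' + X)) + A * (Y * Y') * ((Y' - X) / (Y' + X)) = A * (Y * Y') - A * X * Y"
      if "Y' + X \<noteq> 0" for A X Y Y' :: 'k
    proof -
      have "A * X * Y * t + A * (Y * Y') * t = A * Y * ((Y' + X) * t)" for t
        by (simp add: algebra_simps)
      from this[of "(Y' - X) / (Y' + X)"] have "A * X * Y * ((Y' - X) / (Y' + X)) + A * (Y * Y') * ((Y' - X) / (Y' + X)) =
        A * Y * ((Y' + X) * ((Y' - X) / (Y' + X)))" .
      also have "(Y' + X) * ((Y' - X) / (Y' + X)) = Y' - X" using that by simp
      also have "A * Y * (Y' - X) = A * (Y * Y') - A * X * Y" by (simp add: algebra_simps)
      finally show ?thesis .
    qed
    from this[OF s] show ?thesis unfolding ratio_def 1 .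
  qed
  have hom_ratio_id: "\<phi> (?x p powi (y + 1)) * \<phi> (?x r powi (z - 1)) * \<phi> (ratio (?x p) (?x r)) +
      \<phi> (?x p powi y) * \<phi> (?x r powi z) * \<phi> (ratio (?x p) (?x r)) =
      \<phi> (?x p powi y) * \<phi> (?x r powi z) - \<phi> (?x p powi (y + 1)) * \<phi> (?x r powi (z - 1))"
    if "p \<le> 2 * b" "r \<le> 2 * b" for p r
    using arg_cong[OF ratio_id[OF that], of \<phi>] by (simp only: hom_mult hom_add hom_minus)
  have "pair_corr (y + 1) (z - 1) + pair_corr y z = (\<Sum>p\<le>2 * b. \<Sum>r\<le>2 * b. c p * c r *
      (\<phi> (?x p powi (y + 1)) * \<phi> (?x r powi (z - 1)) * \<phi> (ratio (?x p) (?x r)) +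
      \<phi> (?x p powi y) * \<phi> (?x r powi z) * \<phi> (ratio (?x p) (?x r))))"
    unfolding pair_corr_def sum.distrib[symmetric] by (intro sum.cong refl) (simp only: distrib_left mult_ac)
  also have "\<dots> = (\<Sum>p\<le>2 * b. \<Sum>r\<le>2 * b. (c p * \<phi> (?x p powi y)) * (c r * \<phi> (?x r powi z)) -
      (c p * \<phi> (?x p powi (y + 1))) * (c r * \<phi> (?x r powi (z - 1))))"
    by (intro sum.cong refl, subst hom_ratio_id) (auto simp: right_diff_distrib mult_ac)
  also have "\<dots> = q y * q z - q (y + 1) * q (z - 1)"
    unfolding masses[OF assms(1)] masses[OF assms(2)] masses[OF assms(3)] masses[OF assms(4)]
    by (simp only: sum_subtractf sum_product)
  finally show ?thesis .
qed

lemma pair_corr_self: "pair_corr y y = 0"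
proof -
  \<comment> \<open>Antisymmetry only shows that twice the value is 0; the inverse of 2 comes from
    the field through \<open>\<phi>\<close>.\<close>
  have "\<phi> (1 / 2) * (pair_corr y y + pair_corr y y) = \<phi> (1 / 2 + 1 / 2) * pair_corr y y"
    by (simp only: hom_add distrib_left distrib_right)
  moreover have "pair_corr y y + pair_corr y y = 0" using pair_corr_antisym[of y y] by simp
  ultimately show ?thesis by simp
qed

text \<open>Runs \<open>d\<close> steps (1, -1) from the diagonal along constant
  \<open>y + z\<close>. While \<open>z\<close> stays non-negative, the recurrence is that of
  \<open>pair_q\<close>. In the step from \<open>z' = 0\<close> to -1, the product
  \<open>q y' * q 0\<close> cancels \<open>pair_q y' 0\<close> if \<open>y' > 0\<close>; if
  \<open>y' = 0\<close> it leaves the value 1. From then on all products of \<open>q\<close> vanish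
  and each step merely changes the sign, so a negative exponent pairs only with its
  opposite.\<close>

lemma pair_corr_eq:
  assumes "- int b \<le> z" "y \<le> int b" "y = z + 2 * int d"
  shows "pair_corr y z = (if 0 \<le> z \<and> 0 < y + z then pair_q y z
     else if y + z = 0 \<and> 0 < y then - ((-1) ^ nat y) else 0)"
  using assms
proof (induction d arbitrary: y z)
  case 0
  then show ?case by (simp add: pair_corr_self pair_q_diag)
next
  case (Suc d)
  obtain y' z' where y: "y = y' + 1" "z = z' - 1"
  proof
    show "y = (y - 1) + 1" "z = (z + 1) - 1" by auto
  qed
  have IH: "pair_corr y' z' = (if 0 \<le> z' \<and> 0 < y' + z' then pair_q y' z'
     else if y' + z' = 0 \<and> 0 < y' then - ((-1) ^ nat y') else 0)"
    by (rule Suc.IH) (use Suc.prems y in auto)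
  have "pair_corr y z + pair_corr y' z' = q y' * q z' - q (y' + 1) * q (z' - 1)"
    unfolding y by (rule pair_corr_shift) (use Suc.prems y in auto)
  then have step: "pair_corr y z = q y' * q z' - q (y' + 1) * q (z' - 1) - pair_corr y' z'"
    by (simp add: eq_diff_eq)
  have "z' \<le> y'" using Suc.prems y by auto
  consider "z' > 0" | "z' = 0" "y' > 0" | "z' = 0" "y' = 0" | "z' < 0" "y' + z' = 0" | "z' < 0" "y' + z' \<noteq> 0"
    using \<open>z' \<le> y'\<close> by linarith
  then show ?case
  proof cases
    case 1
    then have "pair_corr y' z' = pair_q y' z'" using IH \<open>z' \<le> y'\<close> by auto
    then have "pair_corr y z = pair_q y z"
      unfolding step pair_q_shift[OF 1, symmetric] by (simp add: y)
    then show ?thesis using 1 \<open>z' \<le> y'\<close> y by auto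
  next
    case 2
    then show ?thesis using step IH y by (simp add: pair_q_0 q_0 q_neg)
  next
    case 3
    then show ?thesis using step IH y by (simp add: q_0 q_neg)
  next
    case 4
    then have "nat y = Suc (nat y')" using y by auto
    then show ?thesis using 4 step IH y by (simp add: q_neg)
  next
    case 5
    then show ?thesis using step IH y by (auto simp: q_neg)
  qed
qed

text \<open>The bound keeps the exponents where the masses represent \<open>q\<close>; equal parity
  places every pair an even distance from the diagonal, as \<open>pair_corr_eq\<close>
  requires.\<close>

definition admissible :: "int set \<Rightarrow> bool" where
  "admissible Y \<longleftrightarrow> finite Y \<and> (\<forall>y\<in>Y. \<bar>y\<bar> \<le> int b) \<and> (\<forall>y\<in>Y. \<forall>z\<in>Y. even (y - z))"

lemma admissible_subset: "admissible Y \<Longrightarrow> Z \<subseteq> Y \<Longrightarrow> admissible Z"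
  by (auto simp: admissible_def intro: finite_subset)

lemma admissible_pair_corr:
  assumes "admissible Y" "y \<in> Y" "z \<in> Y" "z \<le> y"
  shows "pair_corr y z = (if 0 \<le> z \<and> 0 < y + z then pair_q y z
     else if y + z = 0 \<and> 0 < y then - ((-1) ^ nat y) else 0)"
proof -
  have "even (y - z)" "\<bar>y\<bar> \<le> int b" "\<bar>z\<bar> \<le> int b"
    using assms unfolding admissible_def by blast+
  from \<open>even (y - z)\<close> obtain k where "y - z = 2 * k" by (rule dvdE)
  then have "y = z + 2 * int (nat k)" using assms(4) by simp
  then show ?thesis using \<open>\<bar>y\<bar> \<le> int b\<close> \<open>\<bar>z\<bar> \<le> int b\<close> 
    by (intro pair_corr_eq[where d = "nat k"]) auto
qed

text \<open>The minimum is the last entry, so \<open>corr_snoc\<close> expands along it. Its mass is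
  \<open>q\<close> at a negative index, hence 0, and its pair correlations vanish except with its
  opposite. The sign counts the entries strictly between the two.\<close>

lemma corr_Min_neg:
  assumes Y: "admissible Y" "Y \<noteq> {}" and neg: "Min Y < 0"
  shows "corr (desc_list Y) = (if - Min Y \<in> Y
    then (-1) ^ card {y \<in> Y. Min Y < y \<and> y < - Min Y} * - ((-1) ^ nat (- Min Y)) *
      corr (desc_list (Y - {Min Y, - Min Y}))
    else 0)"
proof -
  define z where "z = Min Y"
  define Z where "Z = Y - {z}"
  have finY: "finite Y" using Y by (simp add: admissible_def)
  have zY: "z \<in> Y" using Y finY by (simp add: z_def)
  have z_le: "z \<le> y" if "y \<in> Y" for y using that finY by (simp add: z_def)
  have z0: "z < 0" using neg by (simp add: z_def)
  have zb: "\<bar>z\<bar> \<le> int b" using zY Y by (simp add: admissible_def)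
  have finZ: "finite Z" using finY by (simp add: Z_def)
  let ?ys = "desc_list Z"
  let ?t = "\<lambda>j. (-1) ^ (card Z - 1 - j) * - ((-1) ^ nat (- z)) * corr (remove_nth j ?ys)"
  have nth: "?ys ! j \<in> Z" if "j < card Z" for j using that finZ nth_mem[of j ?ys] by simp
  have pc: "pair_corr (?ys ! j) z = (if ?ys ! j = - z then - ((-1) ^ nat (- z)) else 0)" if "j < card Z" for j
    using admissible_pair_corr[OF Y(1) _ zY z_le, of "?ys ! j"] nth[OF that] z0 by (auto simp: Z_def)
  have "corr (desc_list Y) = corr (?ys @ [z])"
    using desc_list_Min[OF finY Y(2)] by (simp add: z_def Z_def)
  also have "\<dots> = (\<Sum>j<card Z. (-1) ^ (card Z - 1 - j) * pair_corr (?ys ! j) z * corr (remove_nth j ?ys))"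
    by (subst corr_snoc) (simp add: mass_eq[OF zb] q_neg z0)
  also have "\<dots> = (\<Sum>j<card Z. if ?ys ! j = - z then
      ?t j else 0)"
    by (rule sum.cong[OF refl]) (simp add: pc)
  also have "\<dots> = (if - z \<in> Y then (-1) ^ card {y \<in> Y. z < y \<and> y < - z} * - ((-1) ^ nat (- z)) *
      corr (desc_list (Y - {z, - z})) else 0)"
  proof (cases "- z \<in> Y")
    case False
    then have "?ys ! j \<noteq> - z" if "j < card Z" for j using nth[OF that] by (auto simp: Z_def)
    then show ?thesis using False by simp
  next
    case True
    then have "- z \<in> Z" using z0 by (auto simp: Z_def)
    then have "- z \<in> set ?ys" using finZ by simp
    then obtain j where j: "j < card Z" "?ys ! j = - z" by (auto simp: in_set_conv_nth)
    have uniq: "i = j" if "i < card Z" "?ys ! i = - z" for i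
      using that j nth_eq_iff_index_eq[of ?ys i j] by simp
    have "(\<Sum>i<card Z. if ?ys ! i = - z then
      ?t i else 0) =
      (\<Sum>i<card Z. if i = j then ?t j else 0)"
    proof (rule sum.cong[OF refl])
      fix i assume "i \<in> {..<card Z}"
      then have "?ys ! i = - z \<longleftrightarrow> i = j" using uniq[of i] j(2) by blast
      then show "(if ?ys ! i = - z then
        ?t i else 0) =
        (if i = j then ?t j else 0)"
        by simp
    qed
    also have "\<dots> = ?t j"
      by (subst sum.delta) (use j(1) in auto)
    also have "card Z - 1 - j = card {y \<in> Z. y < - z}"
      using card_below_desc_list[OF finZ j(1)] j by simp
    also have "{y \<in> Z. y < - z} = {y \<in> Y. z < y \<and> y < - z}" using z_le by (force simp: Z_def)
    also have "remove_nth j ?ys = desc_list (Y - {z, - z})"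
      using remove_nth_desc_list[OF finZ j(1)] j by (simp add: Z_def Diff_insert[symmetric] insert_commute)
    finally show ?thesis using True by simp
  qed
  finally show ?thesis by (simp add: z_def)
qed

text \<open>Stripping matched pairs from below with \<open>corr_Min_neg\<close> never removes
  \<open>z\<close>, so at some stage the minimum is unmatched.\<close>

lemma corr_unmatched_neg:
  assumes "admissible Y" "z \<in> Y" "z < 0" "- z \<notin> Y"
  shows "corr (desc_list Y) = 0"
  using assms
proof (induction "card Y" arbitrary: Y rule: less_induct)
  case less
  have fin: "finite Y" and ne: "Y \<noteq> {}" using less.prems by (auto simp: admissible_def)
  have "Min Y \<le> z" using less.prems fin by simp
  then have M: "Min Y < 0" using less.prems by simp
  show ?case
  proof (cases "- Min Y \<in> Y")
    case True
    have "corr (desc_list (Y - {Min Y, - Min Y})) = 0"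
    proof (rule less.hyps)
      show "card (Y - {Min Y, - Min Y}) < card Y"
        using fin ne True by (intro psubset_card_mono) auto
      show "admissible (Y - {Min Y, - Min Y})" using less.prems admissible_subset by blast
      show "z \<in> Y - {Min Y, - Min Y}" using less.prems True M by auto
    qed (use less.prems in auto)
    then show ?thesis using corr_Min_neg[OF less.prems(1) ne M] by simp
  next
    case False
    then show ?thesis using corr_Min_neg[OF less.prems(1) ne M] by simp
  qed
qed

text \<open>Adding the elements of \<open>V\<close> in increasing order makes \<open>- a\<close> the
  new minimum. Between \<open>- a\<close> and \<open>a\<close> lie the earlier part of
  \<open>V\<close> and its negatives in equal number, so only the elements of \<open>U\<close> below
  \<open>a\<close> affect the sign.\<close>

lemma corr_matched:
  assumes "finite V" "admissible (U \<union> V \<union> uminus ` V)"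
    "\<And>u. u \<in> U \<Longrightarrow> 0 \<le> u" "\<And>v. v \<in> V \<Longrightarrow> 0 < v" "U \<inter> V = {}"
  shows "corr (desc_list (U \<union> V \<union> uminus ` V)) =
    (\<Prod>a\<in>V. (-1) ^ card {u \<in> U. u < a} * - ((-1) ^ nat a)) * corr (desc_list U)"
  using assms
proof (induction V rule: finite_linorder_max_induct)
  case empty
  then show ?case by simp
next
  case (insert a V)
  let ?Y = "U \<union> insert a V \<union> uminus ` insert a V"
  have a: "a > 0" and aV: "a \<notin> V" and aU: "a \<notin> U" using insert by auto
  have fin: "finite ?Y" "finite U" using insert.prems(1) by (auto simp: admissible_def)
  have Min: "Min ?Y = - a"
  proof (rule Min_eqI[OF fin(1)])
    fix y assume "y \<in> ?Y"
    then show "- a \<le> y" using insert.hyps insert.prems a by force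
  qed auto
  have Vpos: "0 < v" "v < a" if "v \<in> V" for v using insert.hyps insert.prems(3) that by auto
  have Unn: "0 \<le> u" "u \<notin> V" if "u \<in> U" for u using insert.prems that by auto
  have "{y \<in> ?Y. - a < y \<and> y < a} = {u \<in> U. u < a} \<union> (V \<union> uminus ` V)"
  proof (intro equalityI subsetI)
    fix y assume "y \<in> {u \<in> U. u < a} \<union> (V \<union> uminus ` V)"
    then show "y \<in> {y \<in> ?Y. - a < y \<and> y < a}"
      using Vpos[of y] Vpos[of "- y"] Unn[of y] a by auto
  qed auto
  moreover have "{u \<in> U. u < a} \<inter> (V \<union> uminus ` V) = {}" "V \<inter> uminus ` V = {}"
  proof -
    have "- v \<notin> V" if "v \<in> V" for v using Vpos(1)[of v] Vpos(1)[of "- v"] that by auto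
    moreover have "- v \<notin> U" if "v \<in> V" for v using Vpos(1)[of v] Unn(1)[of "- v"] that by auto
    ultimately show "{u \<in> U. u < a} \<inter> (V \<union> uminus ` V) = {}" "V \<inter> uminus ` V = {}"
      using Unn(2) by auto
  qed
  ultimately have "card {y \<in> ?Y. - a < y \<and> y < a} = card {u \<in> U. u < a} + (card V + card V)"
    using fin insert.hyps by (simp add: card_Un_disjoint card_image)
  then have sgn: "(-1) ^ card {y \<in> ?Y. - a < y \<and> y < a} = ((-1) ^ card {u \<in> U. u < a} :: 'a)"
    by (simp add: power_add power_mult_distrib[symmetric])
  have rest: "?Y - {- a, a} = U \<union> V \<union> uminus ` V"
    using Vpos Unn a aU aV by (auto dest: Vpos Unn)
  have "corr (desc_list ?Y) = (-1) ^ card {u \<in> U. u < a} * - ((-1) ^ nat a) * corr (desc_list (U \<union> V \<union> uminus ` V))"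
    using corr_Min_neg[OF insert.prems(1), unfolded Min minus_minus sgn rest] a by simp
  also have "corr (desc_list (U \<union> V \<union> uminus ` V)) =
      (\<Prod>a\<in>V. (-1) ^ card {u \<in> U. u < a} * - ((-1) ^ nat a)) * corr (desc_list U)"
  proof (rule insert.IH)
    show "admissible (U \<union> V \<union> uminus ` V)" using admissible_subset[OF insert.prems(1)] by auto
  qed (use insert.prems in auto)
  finally show ?case using insert.hyps aV by (simp add: mult_ac)
qed

lemma admissible_Cons:
  assumes "admissible (set (y # ys))" "sorted_wrt (>) (y # ys)" "\<And>z. z \<in> set (y # ys) \<Longrightarrow> z \<ge> 0"
    and "z \<in> set ys"
  shows "pair_corr y z = pair_q y z"
proof -
  have "z < y" "z \<ge> 0" using assms by auto
  then show ?thesis using admissible_pair_corr[OF assms(1), of y z] assms(4) by auto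
qed

text \<open>The correlation of \<open>y\<close> with 0 is \<open>q y\<close>, which is also its
  mass. If \<open>y\<close> is followed by an odd number of entries of \<open>ys\<close>, appending
  0 creates a mass term and a pairing with 0 that cancel; otherwise the pairing with 0 takes over
  the role of the mass term of \<open>corr ys\<close>. Thus an exponent 0 may be dropped, just as a
  part 0 may.\<close>

lemma corr_append_0:
  assumes "admissible (insert 0 (set ys))" "sorted_wrt (>) ys" "\<And>z. z \<in> set ys \<Longrightarrow> z > 0"
  shows "corr (ys @ [0]) = corr ys"
  using assms
proof (induction "length ys" arbitrary: ys rule: less_induct)
  case less
  show ?case
  proof (cases ys)
    case Nil
    have "mass 0 = q 0" by (rule mass_eq) simp
    then show ?thesis using corr_Cons[of 0 "[]"] by (simp add: Nil q_0)
  next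
    case (Cons y zs)
    have y: "y > 0" "\<bar>y\<bar> \<le> int b" using less.prems Cons by (auto simp: admissible_def)
    have pc: "pair_corr y 0 = q y"
      using admissible_pair_corr[OF less.prems(1), of y 0] y Cons by (auto simp: pair_q_0)
    have IH: "corr (xs @ [0]) = corr xs" if "length xs < length ys" "set xs \<subseteq> set ys" "sorted_wrt (>) xs" for xs
    proof (rule less.hyps)
      show "admissible (insert 0 (set xs))" using admissible_subset[OF less.prems(1)] that by blast
    qed (use that less.prems in auto)
    have zs: "corr (zs @ [0]) = corr zs" using less.prems Cons by (intro IH) auto
    have rem1: "remove_nth j (zs @ [0]) = remove_nth j zs @ [0]" "(zs @ [0]) ! j = zs ! j" if "j < length zs" for j
      using that by (auto simp: remove_nth_def nth_append)
    have rem2: "corr (remove_nth j zs @ [0]) = corr (remove_nth j zs)" if "j < length zs" for j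
    proof (rule IH)
      show "set (remove_nth j zs) \<subseteq> set ys"
        using Cons by (auto simp: remove_nth_def dest: in_set_takeD in_set_dropD)
      show "sorted_wrt (>) (remove_nth j zs)"
        using less.prems Cons that by (intro sorted_wrt_remove_nth) auto
    qed (use that Cons in auto)
    have last: "remove_nth (length zs) (zs @ [0]) = zs" by (simp add: remove_nth_def)
    have "corr (ys @ [0]) = (if even (Suc (length zs)) then q y * corr zs else 0) +
        (\<Sum>j<length zs. (-1) ^ j * pair_corr y (zs ! j) * corr (remove_nth j zs)) +
        (-1) ^ length zs * q y * corr zs"
      using corr_Cons[of y "zs @ [0]"] by (simp add: Cons zs rem1 rem2 last pc mass_eq y)
    also have "\<dots> = corr ys"
      using corr_Cons[of y zs] by (simp add: Cons mass_eq y)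
    finally show ?thesis .
  qed
qed

end

section \<open>Pfaffians\<close>

text \<open>The increasing enumeration of the indices other than 0 and \<open>Suc j\<close>.\<close>

definition skip :: "nat \<Rightarrow> nat \<Rightarrow> nat" where
  "skip j i = (if i < j then Suc i else Suc (Suc i))"

definition matchings :: "nat \<Rightarrow> (nat \<Rightarrow> nat) set" where
  "matchings k = {\<sigma>. \<sigma> permutes {..<2 * k} \<and> (\<forall>i<k. \<sigma> (2 * i) < \<sigma> (2 * i + 1)) \<and>
     (\<forall>i j. i < j \<and> j < k \<longrightarrow> \<sigma> (2 * i) < \<sigma> (2 * j))}"

text \<open>Puts the pair of 0 and \<open>Suc j\<close> in front of a matching of the remaining
  indices. Building it from two insertions makes the sign a product of two insertion signs.\<close>

definition extend_matching :: "nat \<Rightarrow> (nat \<Rightarrow> nat) \<Rightarrow> nat \<Rightarrow> nat" where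
  "extend_matching j \<tau> = permutation_insert 0 0 (permutation_insert 0 j \<tau>)"

lemma extend_matching_simps [simp]:
  "extend_matching j \<tau> 0 = 0" "extend_matching j \<tau> (Suc 0) = Suc j"
  "extend_matching j \<tau> (Suc (Suc i)) = skip j (\<tau> i)"
  by (auto simp: extend_matching_def permutation_insert_expand skip_def)

lemma skip_less_iff [simp]: "skip j a < skip j b \<longleftrightarrow> a < b"
  by (auto simp: skip_def)

lemma zero_less_skip [simp]: "0 < skip j a"
  by (simp add: skip_def)

lemma permutes_extend_matching:
  assumes "\<tau> permutes {..<2 * k}" "j < 2 * k + 1"
  shows "extend_matching j \<tau> permutes {..<2 * Suc k}"
    and "sign (extend_matching j \<tau>) = (-1) ^ j * sign \<tau>"
proof -
  have t: "\<tau> permutes {0..<2 * k}" using assms by (simp add: atLeast0LessThan)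
  have r: "permutation_insert 0 j \<tau> permutes {0..<Suc (2 * k)}"
    by (rule permutation_insert_permutes[OF t]) (use assms in auto)
  then have "permutation_insert 0 0 (permutation_insert 0 j \<tau>) permutes {0..<Suc (Suc (2 * k))}"
    by (rule permutation_insert_permutes) auto
  then show "extend_matching j \<tau> permutes {..<2 * Suc k}"
    by (simp add: extend_matching_def atLeast0LessThan)
  have "(of_int (sign (extend_matching j \<tau>)) :: int) = (-1) ^ j * of_int (sign \<tau>)"
    using signof_permutation_insert[OF r, of 0 0, where 'a = int]
      signof_permutation_insert[OF t, of 0 j, where 'a = int] assms
    by (simp add: extend_matching_def)
  then show "sign (extend_matching j \<tau>) = (-1) ^ j * sign \<tau>" by simp
qed

lemma extend_matching_in:
  assumes "\<tau> \<in> matchings k" "j < 2 * k + 1"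
  shows "extend_matching j \<tau> \<in> matchings (Suc k)"
proof -
  have 1: "extend_matching j \<tau> (2 * i) < extend_matching j \<tau> (2 * i + 1)" if "i < Suc k" for i
    using assms that by (cases i) (auto simp: matchings_def)
  have 2: "extend_matching j \<tau> (2 * i) < extend_matching j \<tau> (2 * i')" if "i < i'" "i' < Suc k" for i i'
    using assms that by (cases i; cases i') (auto simp: matchings_def)
  show ?thesis using permutes_extend_matching[of \<tau> k j] assms 1 2
    by (auto simp: matchings_def)
qed

lemma matchings_Suc:
  assumes "\<sigma> \<in> matchings (Suc k)"
  obtains j \<tau> where "j < 2 * k + 1" "\<tau> \<in> matchings k" "\<sigma> = extend_matching j \<tau>"
proof -
  have s: "\<sigma> permutes {..<2 * Suc k}" and s1: "\<And>i. i < Suc k \<Longrightarrow> \<sigma> (2 * i) < \<sigma> (2 * i + 1)"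
    and s2: "\<And>i j. i < j \<Longrightarrow> j < Suc k \<Longrightarrow> \<sigma> (2 * i) < \<sigma> (2 * j)"
    using assms by (auto simp: matchings_def)
  \<comment> \<open>In the second slot of a pair 0 would exceed its partner, and in a later first
    slot it would exceed the first entry of the list; both are impossible.\<close>
  have s0: "\<sigma> 0 = 0"
  proof -
    have "0 \<in> \<sigma> ` {..<2 * Suc k}" using permutes_image[OF s] by simp
    then obtain l where l: "l < 2 * Suc k" "\<sigma> l = 0" by auto
    have "l = 0"
    proof (cases "even l")
      case True
      then obtain i where i: "l = 2 * i" by (rule evenE)
      then show ?thesis using s2[of 0 i] l by (cases "i = 0") auto
    next
      case False
      then obtain i where i: "l = 2 * i + 1" by (rule oddE)
      then show ?thesis using s1[of i] l by auto
    qed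
    then show ?thesis using l by simp
  qed
  define j where "j = \<sigma> 1 - 1"
  have s1': "\<sigma> 1 = Suc j" using s1[of 0] s0 by (simp add: j_def)
  have "\<sigma> 1 \<in> {..<2 * Suc k}" using permutes_in_image[OF s, of 1] by simp
  then have j: "j < 2 * k + 1" using s1' by simp
  have "\<sigma> \<in> {p. p permutes {0..<Suc (2 * k + 1)} \<and> p 0 = 0}"
    using s s0 by (simp add: atLeast0LessThan)
  then obtain \<rho> where r: "\<rho> permutes {0..<2 * k + 1}" "\<sigma> = permutation_insert 0 0 \<rho>"
    using permutation_fix[of 0 "2 * k + 1" 0] by auto
  have "\<rho> 0 = j" using s1' r by (simp add: permutation_insert_expand)
  then have "\<rho> \<in> {p. p permutes {0..<Suc (2 * k)} \<and> p 0 = j}" using r by simp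
  then obtain \<tau> where t: "\<tau> permutes {0..<2 * k}" "\<rho> = permutation_insert 0 j \<tau>"
    using permutation_fix[of 0 "2 * k" j] j by auto
  have st: "\<sigma> = extend_matching j \<tau>" by (simp add: extend_matching_def r t)
  have "\<tau> (2 * i) < \<tau> (2 * i + 1)" if "i < k" for i
    using s1[of "Suc i"] that by (simp add: st)
  moreover have "\<tau> (2 * i) < \<tau> (2 * i')" if "i < i'" "i' < k" for i i'
    using s2[of "Suc i" "Suc i'"] that by (simp add: st)
  ultimately have "\<tau> \<in> matchings k" using t by (auto simp: matchings_def atLeast0LessThan)
  then show ?thesis using that j st by blast
qed

lemma pfaffian_0 [simp]: "pfaffian 0 A = 1"
proof -
  have "{\<sigma> :: nat \<Rightarrow> nat. \<sigma> permutes {..<2 * 0} \<and> (\<forall>i<0. \<sigma> (2 * i) < \<sigma> (2 * i + 1)) \<and>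
      (\<forall>i j. i < j \<and> j < 0 \<longrightarrow> \<sigma> (2 * i) < \<sigma> (2 * j))} = {id}"
    by auto
  then show ?thesis by (simp add: pfaffian_def)
qed

text \<open>Matchings are grouped by the partner \<open>Suc j\<close> of index 0, and
  \<open>skip j\<close> renumbers the rest; this is the expansion along the first row.\<close>

lemma pfaffian_Suc:
  "pfaffian (Suc k) A =
    (\<Sum>j<2 * k + 1. (-1) ^ j * A 0 (Suc j) * pfaffian k (\<lambda>i i'. A (skip j i) (skip j i')))"
proof -
  let ?f = "\<lambda>(j, \<tau>). extend_matching j \<tau>"
  let ?D = "{..<2 * k + 1} \<times> matchings k"
  have inj: "inj_on ?f ?D"
  proof (rule inj_onI, clarify)
    fix j \<tau> j' \<tau>' assume t: "\<tau> \<in> matchings k" "\<tau>' \<in> matchings k"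
      and j: "j < 2 * k + 1" "j' < 2 * k + 1" and eq: "extend_matching j \<tau> = extend_matching j' \<tau>'"
    have jj: "j = j'" using fun_cong[OF eq, of "Suc 0"] by simp
    have "\<tau> i = \<tau>' i" for i
      using fun_cong[OF eq, of "Suc (Suc i)"] skip_less_iff[of j "\<tau> i" "\<tau>' i"]
        skip_less_iff[of j "\<tau>' i" "\<tau> i"] jj by (simp del: skip_less_iff)
    then show "j = j' \<and> \<tau> = \<tau>'" using jj by auto
  qed
  have img: "matchings (Suc k) = ?f ` ?D"
    using extend_matching_in by (auto elim!: matchings_Suc)
  have "pfaffian (Suc k) A = (\<Sum>\<sigma>\<in>matchings (Suc k). of_int (sign \<sigma>) *
      (\<Prod>i<Suc k. A (\<sigma> (2 * i)) (\<sigma> (2 * i + 1))))"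
    by (simp add: pfaffian_def matchings_def)
  also have "\<dots> = (\<Sum>(j, \<tau>)\<in>?D. (-1) ^ j * A 0 (Suc j) * (of_int (sign \<tau>) *
      (\<Prod>i<k. A (skip j (\<tau> (2 * i))) (skip j (\<tau> (2 * i + 1))))))"
    unfolding img
  proof (subst sum.reindex[OF inj], rule sum.cong[OF refl], clarify)
    fix j \<tau> assume "j < 2 * k + 1" "\<tau> \<in> matchings k"
    then have "sign (extend_matching j \<tau>) = (-1) ^ j * sign \<tau>"
      by (intro permutes_extend_matching) (auto simp: matchings_def)
    then show "((\<lambda>\<sigma>. of_int (sign \<sigma>) * (\<Prod>i<Suc k. A (\<sigma> (2 * i)) (\<sigma> (2 * i + 1)))) \<circ> ?f) (j, \<tau>) =
      (-1) ^ j * A 0 (Suc j) * (of_int (sign \<tau>) *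
      (\<Prod>i<k. A (skip j (\<tau> (2 * i))) (skip j (\<tau> (2 * i + 1)))))"
      by (simp add: prod.lessThan_Suc_shift mult_ac del: prod.lessThan_Suc)
  qed
  also have "\<dots> = (\<Sum>j<2 * k + 1. (-1) ^ j * A 0 (Suc j) * pfaffian k (\<lambda>i i'. A (skip j i) (skip j i')))"
    unfolding sum.cartesian_product[symmetric]
    by (simp add: pfaffian_def matchings_def sum_distrib_left)
  finally show ?thesis .
qed

lemma pfaffian_cong:
  assumes "\<And>i j. i < 2 * k \<Longrightarrow> j < 2 * k \<Longrightarrow> A i j = B i j"
  shows "pfaffian k A = pfaffian k B"
  unfolding pfaffian_def
proof (intro sum.cong refl arg_cong2[of _ _ _ _ "(*)"] prod.cong, clarsimp)
  fix \<sigma> :: "nat \<Rightarrow> nat" and i assume "\<sigma> permutes {..<2 * k}" "i < k"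
  then have "\<sigma> (2 * i) \<in> {..<2 * k}" "\<sigma> (Suc (2 * i)) \<in> {..<2 * k}"
    by (simp_all only: permutes_in_image) auto
  then show "A (\<sigma> (2 * i)) (\<sigma> (Suc (2 * i))) = B (\<sigma> (2 * i)) (\<sigma> (Suc (2 * i)))"
    using assms by simp
qed

definition nth_or_zero :: "'a::zero list \<Rightarrow> nat \<Rightarrow> 'a" where
  "nth_or_zero xs i = (if i < length xs then xs ! i else 0)"

context schur_q_system
begin

definition pair_skew :: "int \<Rightarrow> int \<Rightarrow> 'a" where
  "pair_skew y z = (if y > z then pair_q y z else if y < z then - pair_q z y else 0)"

text \<open>Both sides satisfy the same expansion along the first entry. For even length this is
  immediate from \<open>corr_Cons\<close> and \<open>pfaffian_Suc\<close>; for odd length the mass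
  term plays the part of the pairing with the padding 0.\<close>

lemma corr_pfaffian:
  assumes "admissible (set ys)" "sorted_wrt (>) ys" "\<And>y. y \<in> set ys \<Longrightarrow> 0 < y"
  shows "corr ys = pfaffian ((length ys + 1) div 2)
    (\<lambda>i j. pair_skew (nth_or_zero ys i) (nth_or_zero ys j))"
  using assms
proof (induction "length ys" arbitrary: ys rule: less_induct)
  case less
  show ?case
  proof (cases ys)
    case Nil
    then show ?thesis by simp
  next
    case (Cons y zs)
    have y: "0 < y" "\<bar>y\<bar> \<le> int b" using less.prems Cons by (auto simp: admissible_def)
    have IH: "corr xs = pfaffian ((length xs + 1) div 2)
        (\<lambda>i j. pair_skew (nth_or_zero xs i) (nth_or_zero xs j))"
      if "length xs < length ys" "set xs \<subseteq> set ys" "sorted_wrt (>) xs" for xs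
      by (rule less.hyps) (use that less.prems admissible_subset[OF less.prems(1)] in auto)
    have pc: "pair_corr y z = pair_skew y z" if "z \<in> set zs" for z
    proof -
      have "z < y" using less.prems(2) that Cons by auto
      then show ?thesis using admissible_Cons[of y zs z] less.prems that Cons
        by (simp add: pair_skew_def order_less_imp_le)
    qed
    have rem: "corr (remove_nth j zs) = pfaffian (length zs div 2)
        (\<lambda>i i'. pair_skew (nth_or_zero ys (skip j i)) (nth_or_zero ys (skip j i')))"
      if j: "j < length zs" for j
    proof -
      have "corr (remove_nth j zs) = pfaffian ((length (remove_nth j zs) + 1) div 2)
        (\<lambda>i i'. pair_skew (nth_or_zero (remove_nth j zs) i) (nth_or_zero (remove_nth j zs) i'))"
      proof (rule IH)
        show "set (remove_nth j zs) \<subseteq> set ys"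
          using Cons by (auto simp: remove_nth_def dest: in_set_takeD in_set_dropD)
        show "sorted_wrt (>) (remove_nth j zs)"
          using less.prems Cons j by (intro sorted_wrt_remove_nth) auto
      qed (use j Cons in auto)
      moreover have "nth_or_zero (remove_nth j zs) i = nth_or_zero ys (skip j i)" for i
        using j by (auto simp: nth_or_zero_def nth_remove_nth Cons skip_def)
      moreover have "length (remove_nth j zs) + 1 = length zs" using j by simp
      ultimately show ?thesis by simp
    qed
    have nz: "nth_or_zero ys 0 = y" "\<And>j. j < length zs \<Longrightarrow> nth_or_zero ys (Suc j) = zs ! j"
      by (auto simp: nth_or_zero_def Cons)
    let ?S = "\<lambda>j i i'. pair_skew (nth_or_zero ys (skip j i)) (nth_or_zero ys (skip j i'))"
    show ?thesis
    proof (cases "even (length zs)")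
      case True
      then obtain k where k: "length zs = 2 * k" by (rule evenE)
      have "corr zs = pfaffian ((length zs + 1) div 2) (\<lambda>i j. pair_skew (nth_or_zero zs i) (nth_or_zero zs j))"
        using less.prems Cons by (intro IH) auto
      also have "\<dots> = pfaffian k (?S (2 * k))"
        unfolding k by (simp, rule pfaffian_cong) (auto simp: nth_or_zero_def skip_def Cons k)
      finally have last: "corr zs = \<dots>" .
      \<comment> \<open>Index \<open>Suc (2 * k)\<close> lies just past the list, so
        \<open>nth_or_zero\<close> supplies the padding 0.\<close>
      have 0: "pair_skew y (nth_or_zero ys (Suc (2 * k))) = q y"
        using y by (simp add: nth_or_zero_def Cons k pair_skew_def pair_q_0)
      have "corr ys = q y * corr zs + (\<Sum>j<2 * k. (-1) ^ j * pair_corr y (zs ! j) * corr (remove_nth j zs))"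
        using corr_Cons[of y zs] by (simp add: Cons k mass_eq y)
      also have "\<dots> = (\<Sum>j<2 * k + 1. (-1) ^ j * pair_skew (nth_or_zero ys 0) (nth_or_zero ys (Suc j)) *
          pfaffian k (?S j))"
        by (simp add: nz 0 last pc rem k)
      also have "\<dots> = pfaffian (Suc k) (\<lambda>i j. pair_skew (nth_or_zero ys i) (nth_or_zero ys j))"
        by (simp only: pfaffian_Suc)
      finally show ?thesis by (simp add: Cons k)
    next
      case False
      then obtain k where k: "length zs = 2 * k + 1" by (rule oddE)
      have "corr ys = (\<Sum>j<2 * k + 1. (-1) ^ j * pair_corr y (zs ! j) * corr (remove_nth j zs))"
        using corr_Cons[of y zs] by (simp add: Cons k)
      also have "\<dots> = (\<Sum>j<2 * k + 1. (-1) ^ j * pair_skew (nth_or_zero ys 0) (nth_or_zero ys (Suc j)) *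
          pfaffian k (?S j))"
        by (rule sum.cong[OF refl]) (use k in \<open>simp add: nz pc rem\<close>)
      also have "\<dots> = pfaffian (Suc k) (\<lambda>i j. pair_skew (nth_or_zero ys i) (nth_or_zero ys j))"
        by (simp only: pfaffian_Suc)
      finally show ?thesis by (simp add: Cons k)
    qed
  qed
qed

end

section \<open>Exponential series\<close>

unbundle fps_syntax
no_notation vec_index (infixl "$" 100)

lemma const_add: "const (a + b) = const a + (const b :: 'k::field_char_0 polys)"
  by (simp add: const_def single_add)

lemma const_mult: "const (a * b) = const a * (const b :: 'k::field_char_0 polys)"
  by (simp add: const_def mult_single)

lemma const_0: "const 0 = (0 :: 'k::field_char_0 polys)"
  by (simp add: const_def)

lemma const_1: "const 1 = (1 :: 'k::field_char_0 polys)"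
  by (simp add: const_def)

lemma comm_ring_hom_const: "comm_ring_hom (const :: 'k::field_char_0 \<Rightarrow> 'k polys)"
  by unfold_locales (simp_all add: const_add const_mult const_0 const_1)

lemma const_of_nat: "const (of_nat n) = (of_nat n :: 'k::field_char_0 polys)"
  by (induction n) (simp_all add: const_0 const_1 const_add)

lemma exp_series_nth:
  assumes "f $ 0 = 0" "n \<le> N"
  shows "exp_series f $ n = (\<Sum>i\<le>N. const (1 / fact i) * (f ^ i) $ n)"
proof -
  have "exp_series f $ n = (\<Sum>i\<le>n. const (1 / fact i) * (f ^ i) $ n)"
    by (simp add: exp_series_def fps_compose_nth atLeast0AtMost)
  also have "\<dots> = (\<Sum>i\<le>N. const (1 / fact i) * (f ^ i) $ n)"
    by (rule sum.mono_neutral_left) (use assms startsby_zero_power_prefix[OF assms(1)] in auto)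
  finally show ?thesis .
qed

text \<open>The binomial theorem gives a sum over \<open>i + j\<close> \<le> \<open>n\<close>. Since
  the series have no constant term, \<open>f ^ i * g ^ j\<close> has no coefficient \<open>n\<close>
  when \<open>i + j > n\<close>; the triangle can thus be enlarged to a square, where the sum
  factors.\<close>

lemma exp_series_add:
  fixes f g :: "'k::field_char_0 polys fps"
  assumes f: "f $ 0 = 0" and g: "g $ 0 = 0"
  shows "exp_series (f + g) = exp_series f * exp_series g"
proof (rule fps_ext)
  fix n
  let ?c = "\<lambda>i. const (1 / fact i) :: 'k polys"
  have binom: "?c k * of_nat (k choose i) = ?c i * ?c (k - i)" if "i \<le> k" for k i
  proof -
    have "1 / fact k * of_nat (k choose i) = 1 / fact i * (1 / fact (k - i) :: 'k)"
      using that by (simp add: binomial_fact)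
    then show ?thesis by (metis const_mult const_of_nat)
  qed
  have vanish: "(f ^ i * g ^ j) $ n = 0" if "n < i + j" for i j
  proof -
    have "(f ^ i) $ a * (g ^ j) $ (n - a) = 0" if "a \<le> n" for a
      using \<open>n < i + j\<close> startsby_zero_power_prefix[OF f, of i] startsby_zero_power_prefix[OF g, of j] that
      by (cases "a < i") auto
    then show ?thesis unfolding fps_mult_nth by (intro sum.neutral) auto
  qed
  have "exp_series (f + g) $ n = (\<Sum>k\<le>n. ?c k * ((f + g) ^ k) $ n)"
    by (rule exp_series_nth) (use assms in auto)
  also have "\<dots> = (\<Sum>k\<le>n. \<Sum>i\<le>k. ?c i * ?c (k - i) * (f ^ i * g ^ (k - i)) $ n)"
  proof (rule sum.cong[OF refl])
    fix k
    have "?c k * ((f + g) ^ k) $ n = (\<Sum>i\<le>k. ?c k * of_nat (k choose i) * (f ^ i * g ^ (k - i)) $ n)"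
      by (simp add: binomial_ring fps_sum_nth sum_distrib_left mult.assoc
          flip: fps_of_nat)
    also have "\<dots> = (\<Sum>i\<le>k. ?c i * ?c (k - i) * (f ^ i * g ^ (k - i)) $ n)"
      by (rule sum.cong[OF refl]) (simp add: binom)
    finally show "?c k * ((f + g) ^ k) $ n = \<dots>" .
  qed
  also have "\<dots> = (\<Sum>(i, j)\<in>{(i, j). i + j \<le> n}. ?c i * ?c j * (f ^ i * g ^ j) $ n)"
    by (rule sum.triangle_reindex_eq[symmetric])
  also have "\<dots> = (\<Sum>(i, j)\<in>{..n} \<times> {..n}. ?c i * ?c j * (f ^ i * g ^ j) $ n)"
  proof (rule sum.mono_neutral_left)
    show "\<forall>p\<in>{..n} \<times> {..n} - {(i, j). i + j \<le> n}.
        (case p of (i, j) \<Rightarrow> ?c i * ?c j * (f ^ i * g ^ j) $ n) = 0"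
    proof
      fix p assume "p \<in> {..n} \<times> {..n} - {(i, j). i + j \<le> n}"
      then obtain i j where p: "p = (i, j)" and "n < i + j" by (cases p) auto
      from vanish[OF this(2)] show "(case p of (i, j) \<Rightarrow> ?c i * ?c j * (f ^ i * g ^ j) $ n) = 0"
        by (simp add: p)
    qed
  qed auto
  also have "\<dots> = (\<Sum>i\<le>n. \<Sum>j\<le>n. \<Sum>a = 0..n. (?c i * (f ^ i) $ a) * (?c j * (g ^ j) $ (n - a)))"
    unfolding sum.cartesian_product[symmetric]
    by (simp add: fps_mult_nth sum_distrib_left mult_ac)
  also have "\<dots> = (\<Sum>a = 0..n. \<Sum>j\<le>n. \<Sum>i\<le>n. (?c i * (f ^ i) $ a) * (?c j * (g ^ j) $ (n - a)))"
    by (rule sum_swap3)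
  also have "\<dots> = (\<Sum>a = 0..n. (\<Sum>i\<le>n. ?c i * (f ^ i) $ a) * (\<Sum>j\<le>n. ?c j * (g ^ j) $ (n - a)))"
    by (subst sum.swap[of _ "{..n}" "{..n}"]) (simp add: sum_product)
  also have "\<dots> = (\<Sum>a = 0..n. exp_series f $ a * exp_series g $ (n - a))"
    by (rule sum.cong[OF refl]) (use assms in \<open>simp add: exp_series_nth[where N = n]\<close>)
  finally show "exp_series (f + g) $ n = (exp_series f * exp_series g) $ n"
    by (simp add: fps_mult_nth)
qed

lemma exp_series_0: "exp_series 0 = (1 :: 'k::field_char_0 polys fps)"
proof (rule fps_ext)
  fix n
  have "exp_series 0 $ n = (\<Sum>i\<le>n. const (1 / fact i) * (0 ^ i :: 'k polys fps) $ n)"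
    by (rule exp_series_nth) auto
  also have "\<dots> = (\<Sum>i\<in>{0}. const (1 / fact i) * (0 ^ i :: 'k polys fps) $ n)"
    by (rule sum.mono_neutral_right) (auto simp: power_0_left)
  finally show "exp_series 0 $ n = (1 :: 'k polys fps) $ n" by (simp add: const_1)
qed

section \<open>The substitutions z^2 and -z for z in power series\<close>

definition fps_dilate :: "'a::comm_ring_1 fps \<Rightarrow> 'a fps" where
  "fps_dilate f = Abs_fps (\<lambda>n. if even n then f $ (n div 2) else 0)"

lemma fps_dilate_nth: "fps_dilate f $ n = (if even n then f $ (n div 2) else 0)"
  by (simp add: fps_dilate_def)

lemma sum_even_indices:
  fixes f :: "nat \<Rightarrow> 'a::comm_monoid_add"
  assumes "n div 2 \<le> N" "\<And>i. i \<le> N \<Longrightarrow> n < 2 * i \<Longrightarrow> f i = 0"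
  shows "(\<Sum>i = 0..n. if even i then f (i div 2) else 0) = (\<Sum>i\<le>N. f i)"
proof -
  have "(\<Sum>i = 0..n. if even i then f (i div 2) else 0) = (\<Sum>i | i \<le> n \<and> even i. f (i div 2))"
    by (rule sum.mono_neutral_cong_right) auto
  also have "\<dots> = (\<Sum>i\<le>n div 2. f i)"
    by (rule sum.reindex_bij_witness[of _ "\<lambda>i. 2 * i" "\<lambda>i. i div 2"]) auto
  also have "\<dots> = (\<Sum>i\<le>N. f i)"
  proof (rule sum.mono_neutral_left)
    show "\<forall>i\<in>{..N} - {..n div 2}. f i = 0"
    proof
      fix i assume "i \<in> {..N} - {..n div 2}"
      then show "f i = 0" using assms(2)[of i] by auto
    qed
  qed (use assms in auto)
  finally show ?thesis .
qed

lemma fps_dilate_mult: "fps_dilate (f * g) = fps_dilate f * fps_dilate g"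
proof (rule fps_ext)
  fix n
  have "(fps_dilate f * fps_dilate g) $ n =
      (\<Sum>i = 0..n. if even i then (if even n then f $ (i div 2) * g $ (n div 2 - i div 2) else 0) else 0)"
    unfolding fps_mult_nth by (rule sum.cong[OF refl]) (auto simp: fps_dilate_nth elim!: evenE simp flip: diff_mult_distrib2)
  also have "\<dots> = (\<Sum>i\<le>n div 2. if even n then f $ i * g $ (n div 2 - i) else 0)"
    by (rule sum_even_indices) auto
  finally show "fps_dilate (f * g) $ n = (fps_dilate f * fps_dilate g) $ n"
    by (simp add: fps_dilate_nth fps_mult_nth atLeast0AtMost)
qed

lemma fps_dilate_power: "fps_dilate (f ^ i) = fps_dilate f ^ i"
proof (induction i)
  case 0
  show ?case by (rule fps_ext) (auto simp: fps_dilate_nth)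
qed (simp add: fps_dilate_mult)

lemma exp_series_dilate:
  assumes "f $ 0 = 0"
  shows "exp_series (fps_dilate f) = fps_dilate (exp_series f)"
proof (rule fps_ext)
  fix n
  have "exp_series (fps_dilate f) $ n = (\<Sum>i\<le>n. const (1 / fact i) * (fps_dilate f ^ i) $ n)"
    by (rule exp_series_nth) (use assms in \<open>auto simp: fps_dilate_nth\<close>)
  then show "exp_series (fps_dilate f) $ n = fps_dilate (exp_series f) $ n"
    using assms by (simp add: fps_dilate_power[symmetric] exp_series_nth[where N = n] fps_dilate_nth)
qed

definition fps_reflect :: "'a::comm_ring_1 fps \<Rightarrow> 'a fps" where
  "fps_reflect f = Abs_fps (\<lambda>n. (-1) ^ n * f $ n)"

lemma fps_reflect_nth: "fps_reflect f $ n = (-1) ^ n * f $ n"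
  by (simp add: fps_reflect_def)

lemma fps_reflect_mult: "fps_reflect (f * g) = fps_reflect f * fps_reflect g"
proof (rule fps_ext)
  fix n
  have "(-1) ^ n * (f $ i * g $ (n - i)) = ((-1) ^ i * f $ i) * ((-1) ^ (n - i) * g $ (n - i))" if "i \<le> n" for i
  proof -
    have "(-1 :: 'a) ^ n = (-1) ^ i * (-1) ^ (n - i)" using that by (simp flip: power_add)
    then show ?thesis by (simp add: mult_ac)
  qed
  then show "fps_reflect (f * g) $ n = (fps_reflect f * fps_reflect g) $ n"
    by (simp add: fps_reflect_nth fps_mult_nth sum_distrib_left)
qed

lemma fps_reflect_power: "fps_reflect (f ^ i) = fps_reflect f ^ i"
proof (induction i)
  case 0
  show ?case by (rule fps_ext) (auto simp: fps_reflect_nth)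
qed (simp add: fps_reflect_mult)

lemma exp_series_reflect:
  assumes "f $ 0 = 0"
  shows "exp_series (fps_reflect f) = fps_reflect (exp_series f)"
proof (rule fps_ext)
  fix n
  have "exp_series (fps_reflect f) $ n = (\<Sum>i\<le>n. const (1 / fact i) * (fps_reflect f ^ i) $ n)"
    by (rule exp_series_nth) (use assms in \<open>auto simp: fps_reflect_nth\<close>)
  then show "exp_series (fps_reflect f) $ n = fps_reflect (exp_series f) $ n"
    using assms by (simp add: fps_reflect_power[symmetric] exp_series_nth[where N = n] fps_reflect_nth
        sum_distrib_left mult_ac)
qed

lemma q_poly_0: "q_poly u 0 = 1"
  by (simp add: q_poly_def exp_series_def const_1)

text \<open>The exponent is an odd series, so substituting -z negates it and the two exponentials
  multiply to 1.\<close>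

lemma q_poly_alternating:
  assumes "n > 0"
  shows "(\<Sum>i\<le>n. (-1) ^ i * q_poly u i * q_poly u (n - i)) = 0"
proof -
  define f where "f = Abs_fps (\<lambda>j. if odd j then u j else 0)"
  have f0: "f $ 0 = 0" by (simp add: f_def)
  have "fps_reflect f = - f" by (rule fps_ext) (simp add: f_def fps_reflect_nth)
  then have "fps_reflect (exp_series f) * exp_series f = 1"
    using exp_series_add[of "- f" f] exp_series_reflect[OF f0] f0 by (simp add: exp_series_0)
  then have "(fps_reflect (exp_series f) * exp_series f) $ n = 0" using assms by simp
  then show ?thesis
    by (simp add: fps_mult_nth fps_reflect_nth q_poly_def f_def atLeast0AtMost)
qed

definition q_int :: "(nat \<Rightarrow> 'k::field_char_0 polys) \<Rightarrow> int \<Rightarrow> 'k polys" where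
  "q_int u k = (if k < 0 then 0 else q_poly u (nat k))"

text \<open>The even part of the exponent is a dilated series and the odd part defines
  \<open>q_poly\<close>. Beyond \<open>B\<close> the index \<open>k - 2 * \<beta>\<close> is
  negative, so the sum may stop there.\<close>

lemma h_poly_decompose:
  assumes "k \<le> 2 * int B"
  shows "h_poly u k = (\<Sum>\<beta>\<in>{0..int B}. h_poly (\<lambda>j. u (2 * j)) \<beta> * q_int u (k - 2 * \<beta>))"
proof (cases "k < 0")
  case True
  then show ?thesis by (simp add: h_poly_def q_int_def)
next
  case False
  define n where "n = nat k"
  define f where "f = Abs_fps (\<lambda>j. if odd j then u j else 0)"
  define g where "g = Abs_fps (\<lambda>j. if j = 0 then 0 else u (2 * j))"
  have "Abs_fps (\<lambda>j. if j = 0 then 0 else u j) = fps_dilate g + f"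
    by (rule fps_ext) (auto simp: fps_dilate_nth f_def g_def elim: evenE)
  then have "exp_series (Abs_fps (\<lambda>j. if j = 0 then 0 else u j)) = fps_dilate (exp_series g) * exp_series f"
    by (simp add: exp_series_add exp_series_dilate fps_dilate_nth f_def g_def)
  then have "h_poly u k = (fps_dilate (exp_series g) * exp_series f) $ n"
    using False by (simp add: h_poly_def n_def)
  also have "\<dots> = (\<Sum>i = 0..n. if even i then exp_series g $ (i div 2) * q_int u (k - 2 * int (i div 2)) else 0)"
    unfolding fps_mult_nth
  proof (rule sum.cong[OF refl])
    fix i assume i: "i \<in> {0..n}"
    show "fps_dilate (exp_series g) $ i * exp_series f $ (n - i) =
        (if even i then exp_series g $ (i div 2) * q_int u (k - 2 * int (i div 2)) else 0)"
    proof (cases "even i")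
      case True
      then have "k - 2 * int (i div 2) = int (n - i)" using i False by (auto simp: n_def elim!: evenE)
      then show ?thesis using True by (simp add: fps_dilate_nth q_int_def q_poly_def f_def)
    qed (simp add: fps_dilate_nth)
  qed
  also have "\<dots> = (\<Sum>i\<le>B. exp_series g $ i * q_int u (k - 2 * int i))"
    by (rule sum_even_indices) (use assms False in \<open>auto simp: n_def q_int_def\<close>)
  also have "\<dots> = (\<Sum>\<beta>\<in>{0..int B}. h_poly (\<lambda>j. u (2 * j)) \<beta> * q_int u (k - 2 * \<beta>))"
    by (rule sum.reindex_bij_witness[of _ nat int]) (auto simp: h_poly_def g_def)
  finally show ?thesis .
qed

section \<open>Rectangular Schur functions\<close>

text \<open>An additional row belongs to a part 0 and has \<open>h_poly\<close> at negative indices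
  left of a diagonal entry 1, so enlarging the matrix keeps the determinant. This permits matrix
  sizes that only bound the number of parts.\<close>

lemma schur_eq_det:
  assumes "antimono lam" "\<And>i. i \<ge> n \<Longrightarrow> lam i = 0"
  shows "schur lam u = det (mat n n (\<lambda>(i, j). h_poly u (int (lam i) + int j - int i)))"
proof -
  let ?A = "\<lambda>n. mat n n (\<lambda>(i, j). h_poly u (int (lam i) + int j - int i))"
  let ?l = "part_length lam"
  have sub: "{i. lam i \<noteq> 0} \<subseteq> {..<n}"
  proof
    fix i assume "i \<in> {i. lam i \<noteq> 0}"
    then show "i \<in> {..<n}" using assms(2)[of i] by (cases "i < n") auto
  qed
  then have fin: "finite {i. lam i \<noteq> 0}" by (rule finite_subset) simp
  have supp: "{i. lam i \<noteq> 0} = {..<?l}"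
  proof -
    have "{i. lam i \<noteq> 0} = {..<k}" if "k = (LEAST k. lam k = 0)" for k
    proof -
      have "lam k = 0" unfolding that by (rule LeastI[of _ n]) (simp add: assms(2))
      then have "lam i = 0" if "k \<le> i" for i using antimonoD[OF assms(1) that] by simp
      moreover have "lam i \<noteq> 0" if "i < k" for i using not_less_Least that \<open>k = _\<close> by blast
      ultimately have "lam i \<noteq> 0 \<longleftrightarrow> i < k" for i by (cases "i < k") auto
      then show ?thesis by auto
    qed
    from this[OF refl] show ?thesis by (simp add: part_length_def)
  qed
  have zero: "lam i = 0" if "i \<ge> ?l" for i
  proof -
    have "i \<notin> {i. lam i \<noteq> 0}" unfolding supp using that by simp
    then show ?thesis by simp
  qed
  have ln: "?l \<le> n" using sub card_mono[OF _ sub] by (simp add: part_length_def)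
  have "det (?A n') = det (?A ?l)" if "?l \<le> n'" for n'
    using that
  proof (induction n' rule: dec_induct)
    case (step k)
    have last: "?A (Suc k) $$ (k, j) = (if j = k then 1 else 0)" if "j < Suc k" for j
    proof -
      have "h_poly u 0 = 1" by (simp add: h_poly_def exp_series_def const_1)
      then show ?thesis using that zero[OF step(1)] by (auto simp: h_poly_def)
    qed
    have "det (?A (Suc k)) = (\<Sum>j<Suc k. ?A (Suc k) $$ (k, j) * cofactor (?A (Suc k)) k j)"
      by (rule laplace_expansion_row) auto
    also have "\<dots> = (\<Sum>j<Suc k. if j = k then cofactor (?A (Suc k)) k j else 0)"
      by (rule sum.cong[OF refl]) (subst last, auto)
    also have "\<dots> = cofactor (?A (Suc k)) k k" by simp
    also have "mat_delete (?A (Suc k)) k k = ?A k"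
      by (rule eq_matI) (auto simp: mat_delete_def)
    then have "cofactor (?A (Suc k)) k k = det (?A k)" by (simp add: cofactor_def)
    finally show ?case using step.IH by simp
  qed simp
  from this[OF ln] show ?thesis by (simp add: schur_def)
qed

section \<open>Q-functions as lists of parts, and masses for the given variables\<close>

lemma strict_partition_of_eq: "strict_partition_of A = nth_or_zero (desc_list A)"
  by (rule ext) (simp add: strict_partition_of_def nth_or_zero_def desc_list_def)

lemma part_length_strict_partition_of:
  assumes "finite A" "0 \<notin> A"
  shows "part_length (strict_partition_of A) = card A"
proof -
  have "desc_list A ! i \<noteq> 0" if "i < card A" for i
  proof -
    have "desc_list A ! i \<in> A" using nth_mem[of i "desc_list A"] assms that by simp
    then show ?thesis using assms by metis
  qed
  then have "{i. strict_partition_of A i \<noteq> 0} = {..<card A}"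
    by (auto simp: strict_partition_of_eq nth_or_zero_def)
  then show ?thesis by (simp add: part_length_def)
qed

lemma desc_list_image_int: "finite A \<Longrightarrow> desc_list (int ` A) = map int (desc_list A)"
proof -
  assume A: "finite A"
  have "sorted_wrt (>) (map int (desc_list A))"
    using sorted_wrt_desc_list[of A] by (simp add: sorted_wrt_map)
  then have "desc_list (set (map int (desc_list A))) = map int (desc_list A)"
    by (rule desc_list_set)
  then show ?thesis using A by simp
qed

lemma exists_schur_q_system:
  fixes u :: "nat \<Rightarrow> 'k::field_char_0 polys"
  shows "\<exists>c. schur_q_system const (q_int u) c b"
proof -
  have inj: "inj_on (pt :: nat \<Rightarrow> 'k) {..2 * b}"
    by (auto simp: inj_on_def pt_def simp del: of_nat_Suc)
  \<comment> \<open>The masses are first found for exponents from 0 to \<open>2 * b\<close>;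
    multiplying each weight by \<open>pt p ^ b\<close> then shifts the range to \<open>- b\<close>
    up to \<open>b\<close>.\<close>
  obtain c' where c': "\<And>j. j \<le> 2 * b \<Longrightarrow>
      q_int u (int j - int b) = (\<Sum>p\<le>2 * b. c' p * const (pt p ^ j))"
    using exists_point_masses[OF comm_ring_hom_const inj, of "\<lambda>j. q_int u (int j - int b)"] by blast
  define c where "c p = c' p * const (pt p ^ b)" for p
  have masses: "q_int u k = (\<Sum>p\<le>2 * b. c p * const (pt p powi k))" if "\<bar>k\<bar> \<le> int b" for k
  proof -
    define j where "j = nat (k + int b)"
    have j: "j \<le> 2 * b" "k = int j - int b" using that by (auto simp: j_def)
    have "pt p ^ b * (pt p :: 'k) powi k = pt p ^ j" for p
    proof -
      have "pt p ^ b * (pt p :: 'k) powi k = pt p powi (int b + k)"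
        using pt_nonzero[of p, where 'a = 'k] by (simp add: power_int_add)
      then show ?thesis using j by simp
    qed
    then show ?thesis using c'[OF j(1)] j(2) by (simp add: c_def mult.assoc flip: const_mult)
  qed
  interpret comm_ring_hom "const :: 'k \<Rightarrow> 'k polys" by (rule comm_ring_hom_const)
  have "schur_q_system const (q_int u) c b"
  proof
    fix n :: nat assume "n > 0"
    have "(\<Sum>i\<le>n. (-1) ^ i * q_int u (int i) * q_int u (int (n - i))) =
        (\<Sum>i\<le>n. (-1) ^ i * q_poly u i * q_poly u (n - i))"
      by (rule sum.cong[OF refl]) (auto simp: q_int_def nat_diff_distrib)
    then show "(\<Sum>i\<le>n. (-1) ^ i * q_int u (int i) * q_int u (int (n - i))) = 0"
      using q_poly_alternating[OF \<open>n > 0\<close>] by simp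
  qed (use masses in \<open>auto simp: q_int_def q_poly_0\<close>)
  then show ?thesis by blast
qed

text \<open>
  A pair \<open>(U, V)\<close> encodes the set \<open>U \<union> V \<union> - V\<close> of exponents: these are the sets
  whose negative elements are all matched by their opposites.
\<close>

definition window :: "int \<Rightarrow> int set" where
  "window M = {a. 0 \<le> a \<and> a \<le> M \<and> even (M - a)}"

definition exponent_pairs :: "int \<Rightarrow> nat \<Rightarrow> (int set \<times> int set) set" where
  "exponent_pairs M n = {(U, V). U \<subseteq> window M \<and> V \<subseteq> window M - {0} \<and> U \<inter> V = {} \<and>
     card U + 2 * card V = n}"

definition exponents :: "int set \<Rightarrow> int set \<Rightarrow> int set" where
  "exponents U V = U \<union> V \<union> uminus ` V"

text \<open>The scalar that \<open>corr_matched\<close> splits off; \<open>delta_filled\<close>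
  identifies it with the sign of a partition.\<close>

definition pair_sign :: "int set \<Rightarrow> int set \<Rightarrow> 'a::comm_ring_1" where
  "pair_sign U V = (\<Prod>a\<in>V. (-1) ^ card {u \<in> U. u < a} * - ((-1) ^ nat a))"

lemma finite_window [simp]: "finite (window M)"
  by (rule finite_subset[of _ "{0..M}"]) (auto simp: window_def)

lemma card_exponents:
  assumes "finite U" "finite V" "U \<inter> V = {}" "\<And>a. a \<in> U \<Longrightarrow> 0 \<le> a" "\<And>a. a \<in> V \<Longrightarrow> 0 < a"
  shows "card (exponents U V) = card U + 2 * card V"
proof -
  have "a \<notin> U \<union> V" if "- a \<in> V" for a using assms(4)[of a] assms(5)[of a] assms(5)[of "- a"] that by auto
  then have "(U \<union> V) \<inter> uminus ` V = {}" by auto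
  then show ?thesis using assms by (simp add: exponents_def card_Un_disjoint card_image)
qed

lemma exponent_pairsD:
  assumes "(U, V) \<in> exponent_pairs M n"
  shows "finite U" "finite V" "U \<inter> V = {}" "U \<subseteq> window M" "V \<subseteq> window M" "0 \<notin> V"
    "\<And>a. a \<in> U \<Longrightarrow> 0 \<le> a" "\<And>a. a \<in> V \<Longrightarrow> 0 < a"
    "finite (exponents U V)" "card (exponents U V) = n"
proof -
  show *: "finite U" "finite V" "U \<inter> V = {}" "U \<subseteq> window M" "V \<subseteq> window M" "0 \<notin> V"
    using assms finite_subset[OF _ finite_window] by (auto simp: exponent_pairs_def)
  show nn: "0 \<le> a" if "a \<in> U" for a using * that by (auto simp: window_def)
  show pos: "0 < a" if "a \<in> V" for a
    using assms that by (auto simp: exponent_pairs_def window_def less_le)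
  show "finite (exponents U V)" using * by (simp add: exponents_def)
  show "card (exponents U V) = n"
    using card_exponents[OF *(1-3) nn pos] assms by (simp add: exponent_pairs_def)
qed

context schur_q_system
begin

text \<open>First \<open>corr_matched\<close> removes \<open>V\<close> and its negatives, then
  \<open>corr_append_0\<close> removes an exponent 0, leaving positive exponents as in a
  Q-function.\<close>

lemma corr_exponents:
  assumes "(U, V) \<in> exponent_pairs M n" "M \<le> int b"
  shows "corr (desc_list (exponents U V)) = pair_sign U V * corr (desc_list (U - {0}))"
proof -
  note P = exponent_pairsD[OF assms(1)]
  have par: "even (M - y)" "\<bar>y\<bar> \<le> int b" if "y \<in> exponents U V" for y
    using P(4,5) that assms(2) by (auto simp: exponents_def window_def)
  have even_diff: "even (y - z)" if "even (M - y)" "even (M - z)" for y z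
    using that by presburger
  have adm: "admissible (exponents U V)"
    unfolding admissible_def using P(9) par even_diff by blast
  have "corr (desc_list (exponents U V)) = pair_sign U V * corr (desc_list U)"
    using corr_matched[of V U] P adm by (simp add: exponents_def pair_sign_def)
  also have "corr (desc_list U) = corr (desc_list (U - {0}))"
  proof (cases "0 \<in> U")
    case True
    have "Min U = 0" by (rule Min_eqI) (use P True in auto)
    then have "desc_list U = desc_list (U - {0}) @ [0]" using desc_list_Min[of U] P True by auto
    moreover have "corr (desc_list (U - {0}) @ [0]) = corr (desc_list (U - {0}))"
    proof (rule corr_append_0)
      show "admissible (insert 0 (set (desc_list (U - {0}))))"
        using True P by (intro admissible_subset[OF adm]) (auto simp: exponents_def)
      show "0 < z" if "z \<in> set (desc_list (U - {0}))" for z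
        using that P by (auto simp: less_le)
    qed (rule sorted_wrt_desc_list)
    ultimately show ?thesis by simp
  qed simp
  finally show ?thesis .
qed

end

lemma Q_fun_eq_corr:
  fixes u :: "nat \<Rightarrow> 'k::field_char_0 polys"
  assumes "schur_q_system const (q_int u) c b"
    and A: "finite A" "0 \<notin> A" "\<And>a. a \<in> A \<Longrightarrow> a \<le> b" "\<And>a a'. a \<in> A \<Longrightarrow> a' \<in> A \<Longrightarrow> even (int a - int a')"
  shows "Q_fun (strict_partition_of A) u =
    point_masses.corr const {..2 * b} pt (\<lambda>y p. c p * const (pt p powi y)) (desc_list (int ` A))"
proof -
  interpret schur_q_system const "q_int u" c b by (rule assms)
  have adm: "admissible (set (desc_list (int ` A)))"
  proof -
    have "\<forall>y\<in>int ` A. \<forall>z\<in>int ` A. even (y - z)" using A(4) by blast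
    moreover have "\<forall>y\<in>int ` A. \<bar>y\<bar> \<le> int b" using A(3) by auto
    moreover have "finite (int ` A)" "set (desc_list (int ` A)) = int ` A" using A(1) by simp_all
    ultimately show ?thesis unfolding admissible_def by metis
  qed
  have skew: "pair_skew (int x) (int y) = Q_pair u x y" for x y
  proof -
    have gt: "pair_q (int x) (int y) = Q_pair_gt u x y" for x y
    proof -
      have "(\<Sum>i = 1..y. (-1) ^ i * q_int u (int x + int i) * q_int u (int y - int i)) =
          (\<Sum>i = 1..y. (-1) ^ i * q_poly u (x + i) * q_poly u (y - i))"
        by (rule sum.cong[OF refl]) (auto simp: q_int_def nat_add_distrib nat_diff_distrib)
      then show ?thesis by (simp add: pair_q_def Q_pair_gt_def q_int_def)
    qed
    show ?thesis by (simp add: pair_skew_def Q_pair_def gt)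
  qed
  have "corr (desc_list (int ` A)) = pfaffian ((card A + 1) div 2)
      (\<lambda>i j. pair_skew (nth_or_zero (desc_list (int ` A)) i) (nth_or_zero (desc_list (int ` A)) j))"
  proof (subst corr_pfaffian[OF adm sorted_wrt_desc_list])
    fix y assume "y \<in> set (desc_list (int ` A))"
    then obtain a where "y = int a" "a \<in> A" using A(1) by auto
    then show "0 < y" using A(2) by (cases "a = 0") auto
  qed (simp add: card_image)
  also have "nth_or_zero (desc_list (int ` A)) = (\<lambda>i. int (strict_partition_of A i))"
    using A(1) by (auto simp: desc_list_image_int strict_partition_of_eq nth_or_zero_def)
  finally show ?thesis
    using A(1,2) by (simp add: Q_fun_def part_length_strict_partition_of skew)
qed

text \<open>The left side is the Jacobi-Trudi determinant of the rectangle with \<open>n\<close>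
  rows of length \<open>M + 1 - n\<close>; reversing its rows makes it a Hankel determinant. In the
  expansion over sets of exponents, \<open>corr_unmatched_neg\<close> leaves only those coming from
  \<open>exponent_pairs\<close>.\<close>

theorem rectangle_expansion:
  fixes u :: "nat \<Rightarrow> 'k::field_char_0 polys" and M :: int and n :: nat
  assumes nM: "int n \<le> M + 1"
  shows "det (mat n n (\<lambda>(i, j). h_poly u (M + 1 - int n + int j - int i))) =
    (\<Sum>(U, V)\<in>exponent_pairs M n. pair_sign U V * Q_fun (strict_partition_of (nat ` (U - {0}))) u *
       det (mat n n (\<lambda>(i, j). h_poly (\<lambda>j. u (2 * j))
         ((M - 2 * int n + 2 + 2 * int j - sorted_list_of_set (exponents U V) ! i) div 2))))"
proof -
  \<comment> \<open>With this \<open>s\<close> the largest Hankel index \<open>s + 2 * n - 2\<close>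
    is \<open>M\<close>. The choice of \<open>B\<close> satisfies \<open>h_poly_decompose\<close> up
    to \<open>M\<close> and lets the exponents reach down to \<open>- M\<close>; \<open>b\<close>
    bounds everything that occurs.\<close>
  define s where "s = M - 2 * int n + 2"
  define B where "B = nat (M + 1)"
  define b where "b = nat (\<bar>s\<bar> + 2 * int n + 2 * int B + \<bar>M\<bar>)"
  obtain c where "schur_q_system const (q_int u) c b" using exists_schur_q_system by blast
  then interpret schur_q_system const "q_int u" c b .
  let ?e = "\<lambda>k. h_poly (\<lambda>j. u (2 * j)) k"
  \<comment> \<open>Truncated because \<open>hankel_expansion\<close> asks for finite support; the
    determinants that survive have indices at most \<open>B\<close>, where nothing is lost.\<close>
  define e where "e k = (if k < 0 \<or> k > int B then 0 else ?e k)" for k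
  let ?P = "(\<lambda>(U, V). exponents U V) ` exponent_pairs M n"
  let ?D = "\<lambda>I. det (mat n n (\<lambda>(i, j). e ((s + 2 * int i - desc_list I ! j) div 2)))"
  define Y where "Y = (\<lambda>k. s + 2 * k) ` {- int B..<int n}"
  have finY: "finite Y" by (simp add: Y_def)
  have Mb: "M \<le> int b" by (simp add: b_def)
  have hankel: "det (mat n n (\<lambda>(i, j). h_poly u (s + int i + int j))) =
    (\<Sum>I | I \<subseteq> Y \<and> card I = n.
       ?D I * corr (desc_list I))"
    unfolding Y_def
  proof (rule hankel_expansion)
    fix k assume k: "s \<le> k" "k \<le> s + 2 * int n - 2"
    have "h_poly u k = (\<Sum>\<beta>\<in>{0..int B}. ?e \<beta> * q_int u (k - 2 * \<beta>))"
      by (rule h_poly_decompose) (use k nM in \<open>auto simp: s_def B_def\<close>)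
    also have "\<dots> = (\<Sum>\<beta>\<in>{0..int B}. e \<beta> * q_int u (k - 2 * \<beta>))"
      by (rule sum.cong) (auto simp: e_def)
    finally show "h_poly u k = \<dots>" .
  qed (auto simp: e_def b_def)
  \<comment> \<open>Row reversal. Its sign enters once for the Hankel matrix and once for the minor
    of \<open>e\<close>, and the two cancel by \<open>sq\<close>.\<close>
  define \<rho> where "\<rho> i = (if i < n then n - 1 - i else i)" for i
  have \<rho>: "\<rho> permutes {..<n}"
  proof (rule bij_imp_permutes)
    show "bij_betw \<rho> {..<n} {..<n}"
      by (rule bij_betw_byWitness[of _ \<rho>]) (auto simp: \<rho>_def)
  qed (auto simp: \<rho>_def)
  have sq: "of_int (sign \<rho>) * (of_int (sign \<rho>) * x) = (x :: 'k polys)" for x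
    by (cases "sign \<rho> = 1") (auto simp: sign_def split: if_splits)
  let ?sg = "of_int (sign \<rho>) :: 'k polys"
  have "det (mat n n (\<lambda>(i, j). h_poly u (M + 1 - int n + int j - int i))) =
      ?sg * det (mat n n (\<lambda>(i, j). h_poly u (s + int i + int j)))"
  proof -
    have "mat n n (\<lambda>(i, j). h_poly u (M + 1 - int n + int j - int i)) =
        mat n n (\<lambda>(i, j). h_poly u (s + int (\<rho> i) + int j))"
      by (rule eq_matI) (auto simp: \<rho>_def s_def of_nat_diff algebra_simps intro!: arg_cong[of _ _ "h_poly u"])
    then show ?thesis using det_mat_permute_rows[OF \<rho>, of "\<lambda>i j. h_poly u (s + int i + int j)"] by simp
  qed
  also have "\<dots> = (\<Sum>I | I \<subseteq> Y \<and> card I = n.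
      ?sg * ?D I * corr (desc_list I))"
    by (simp add: hankel sum_distrib_left mult.assoc)
  also have "\<dots> = (\<Sum>I\<in>?P.
      ?sg * ?D I * corr (desc_list I))"
  proof (rule sum.mono_neutral_right)
    show "finite {I. I \<subseteq> Y \<and> card I = n}" using finY by simp
    show "?P \<subseteq> {I. I \<subseteq> Y \<and> card I = n}"
    proof clarify
      fix U V assume P: "(U, V) \<in> exponent_pairs M n"
      note P' = exponent_pairsD[OF P]
      have "y \<in> Y" if "y \<in> exponents U V" for y
      proof -
        have y: "- M \<le> y" "y \<le> M" "even (M - y)"
          using that P'(4,5) by (auto simp: exponents_def window_def)
        then have "y = s + 2 * ((y - s) div 2)" unfolding s_def by presburger
        moreover have "(y - s) div 2 \<in> {- int B..<int n}"
          using y nM by (auto simp: s_def B_def)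
        ultimately show ?thesis unfolding Y_def by (rule image_eqI)
      qed
      then show "exponents U V \<subseteq> Y \<and> card (exponents U V) = n" using P'(10) by blast
    qed
    show "\<forall>I\<in>{I. I \<subseteq> Y \<and> card I = n} - ?P.
      ?sg * ?D I * corr (desc_list I) = 0"
    proof
      fix I assume I: "I \<in> {I. I \<subseteq> Y \<and> card I = n} - ?P"
      have finI: "finite I" using I finY by (auto intro: finite_subset)
      have Iy: "y \<le> M" "even (M - y)" "\<bar>y\<bar> \<le> int b" if "y \<in> I" for y
      proof -
        have "y \<in> Y" using that I by blast
        then obtain k where "y = s + 2 * k" "- int B \<le> k" "k < int n" by (auto simp: Y_def)
        then show "y \<le> M" "even (M - y)" "\<bar>y\<bar> \<le> int b" by (auto simp: s_def b_def)
      qed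
      \<comment> \<open>Otherwise \<open>I\<close> would be \<open>exponents U V\<close>, with
        \<open>V\<close> the positive elements whose opposites belong to \<open>I\<close>.\<close>
      have "\<exists>z\<in>I. z < 0 \<and> - z \<notin> I"
      proof (rule ccontr)
        assume "\<not> ?thesis"
        then have m: "- z \<in> I" if "z \<in> I" "z < 0" for z using that by blast
        define V where "V = {a \<in> I. 0 < a \<and> - a \<in> I}"
        define U where "U = {a \<in> I. 0 \<le> a \<and> a \<notin> V}"
        have IUV: "I = exponents U V"
        proof (intro equalityI subsetI)
          fix y assume y: "y \<in> I"
          show "y \<in> exponents U V"
          proof (cases "y < 0")
            case True
            then have "- y \<in> V" using m[OF y] y by (simp add: V_def)
            then show ?thesis by (force simp: exponents_def)
          next
            case False
            then show ?thesis using y by (auto simp: exponents_def U_def)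
          qed
        qed (auto simp: exponents_def U_def V_def)
        have "card I = card U + 2 * card V"
          unfolding IUV by (rule card_exponents) (use finI in \<open>auto simp: U_def V_def\<close>)
        moreover have "U \<subseteq> window M" "V \<subseteq> window M - {0}" "U \<inter> V = {}"
          using Iy by (auto simp: U_def V_def window_def)
        ultimately have "(U, V) \<in> exponent_pairs M n" using I by (simp add: exponent_pairs_def)
        then show False using I IUV by force
      qed
      then obtain z where z: "z \<in> I" "z < 0" "- z \<notin> I" by blast
      have "even (y - y')" if "y \<in> I" "y' \<in> I" for y y'
        using Iy(2)[OF that(1)] Iy(2)[OF that(2)] by presburger
      then have "admissible I" unfolding admissible_def using finI Iy(3) by blast
      then show "?sg * ?D I * corr (desc_list I) = 0"
        using corr_unmatched_neg z by simp
    qed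
  qed
  also have "\<dots> = (\<Sum>(U, V)\<in>exponent_pairs M n. ?sg * det (mat n n (\<lambda>(i, j). e ((s + 2 * int i -
      desc_list (exponents U V) ! j) div 2))) * corr (desc_list (exponents U V)))"
  proof (subst sum.reindex)
    show "inj_on (\<lambda>(U, V). exponents U V) (exponent_pairs M n)"
    proof (rule inj_onI, clarify)
      fix U V U' V' assume P: "(U, V) \<in> exponent_pairs M n" "(U', V') \<in> exponent_pairs M n"
        and eq: "exponents U V = exponents U' V'"
      have "V = {a \<in> exponents U V. 0 < a \<and> - a \<in> exponents U V}" "U = {a \<in> exponents U V. 0 \<le> a \<and> a \<notin> V}"
        if "(U, V) \<in> exponent_pairs M n" for U V
        using exponent_pairsD(3,7,8)[OF that] by (force simp: exponents_def)+
      from this[OF P(1)] this[OF P(2)] eq show "U = U' \<and> V = V'" by metis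
    qed
  qed (simp add: case_prod_unfold)
  also have "\<dots> = (\<Sum>(U, V)\<in>exponent_pairs M n. pair_sign U V * Q_fun (strict_partition_of (nat ` (U - {0}))) u *
       det (mat n n (\<lambda>(i, j). ?e ((M - 2 * int n + 2 + 2 * int j - sorted_list_of_set (exponents U V) ! i) div 2))))"
  proof (rule sum.cong[OF refl], clarify)
    fix U V assume P: "(U, V) \<in> exponent_pairs M n"
    note P' = exponent_pairsD[OF P]
    let ?X = "exponents U V"
    have X: "- M \<le> y" "y \<le> M" if "y \<in> ?X" for y using that P'(4,5) by (auto simp: exponents_def window_def)
    have nth: "sorted_list_of_set ?X ! \<rho> i = desc_list ?X ! i" if "i < n" for i
      using that P'(9,10) by (simp add: desc_list_def rev_nth \<rho>_def)
    have dX: "desc_list ?X ! i \<in> ?X" if "i < n" for i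
      using that P'(9,10) nth_mem[of i "desc_list ?X"] by simp
    have "mat n n (\<lambda>(i, j). ?e ((s + 2 * int j - sorted_list_of_set ?X ! \<rho> i) div 2)) =
        mat n n (\<lambda>(i, j). e ((s + 2 * int j - desc_list ?X ! i) div 2))"
    proof (rule eq_matI, goal_cases)
      case (1 i j)
      then have ij: "i < n" "j < n" by auto
      have "(s + 2 * int j - desc_list ?X ! i) div 2 \<le> int B"
        using X[OF dX[OF ij(1)]] ij nM by (auto simp: s_def B_def)
      then show ?case using ij by (simp add: nth e_def h_poly_def)
    qed auto
    then have "?sg * det (mat n n (\<lambda>(i, j). ?e ((s + 2 * int j - sorted_list_of_set ?X ! i) div 2))) =
        det (mat n n (\<lambda>(i, j). e ((s + 2 * int j - desc_list ?X ! i) div 2)))"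
      using det_mat_permute_rows[OF \<rho>, of "\<lambda>i j. ?e ((s + 2 * int j - sorted_list_of_set ?X ! i) div 2)"] by simp
    also have "\<dots> = ?D ?X"
      by (rule det_mat_transpose)
    finally have 1: "?sg * ?D ?X =
        det (mat n n (\<lambda>(i, j). ?e ((s + 2 * int j - sorted_list_of_set ?X ! i) div 2)))"
      using sq by metis
    have U: "int ` nat ` (U - {0}) = U - {0}" using P'(7) by (force simp: image_iff)
    have "Q_fun (strict_partition_of (nat ` (U - {0}))) u = corr (desc_list (int ` nat ` (U - {0})))"
    proof (rule Q_fun_eq_corr)
      show "schur_q_system const (q_int u) c b" by unfold_locales
      show "a \<le> b" if "a \<in> nat ` (U - {0})" for a
        using that P'(4) Mb by (auto simp: window_def)
      show "even (int a - int a')" if "a \<in> nat ` (U - {0})" "a' \<in> nat ` (U - {0})" for a a'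
      proof -
        have "int a \<in> U" "int a' \<in> U" using that U by blast+
        then have "even (M - int a)" "even (M - int a')" using P'(4) by (auto simp: window_def)
        then show ?thesis by presburger
      qed
      show "0 \<notin> nat ` (U - {0})"
      proof
        assume "0 \<in> nat ` (U - {0})"
        then obtain y where "0 = nat y" "y \<in> U - {0}" by (rule imageE)
        then show False using P'(7)[of y] by simp
      qed
      show "finite (nat ` (U - {0}))" using P'(1) by simp
    qed
    then have 2: "corr (desc_list ?X) = pair_sign U V * Q_fun (strict_partition_of (nat ` (U - {0}))) u"
      using corr_exponents[OF P Mb] U by simp
    show "?sg * ?D ?X * corr (desc_list ?X) =
       pair_sign U V * Q_fun (strict_partition_of (nat ` (U - {0}))) u *
       det (mat n n (\<lambda>(i, j). ?e ((M - 2 * int n + 2 + 2 * int j - sorted_list_of_set ?X ! i) div 2)))"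
      unfolding 1 2 unfolding s_def by (simp only: mult_ac)
  qed
  finally show ?thesis .
qed

section \<open>Fillings of a core\<close>

lemma nat_mod_4: "int j = 4 * t + int r \<Longrightarrow> r < 4 \<Longrightarrow> j mod 4 = r"
  using zmod_int[of j 4] by simp

lemma dec_enum_eq:
  assumes "\<And>i j. i < j \<Longrightarrow> D j < D i" "range D = A"
  shows "dec_enum A i = D i"
proof (induction i)
  case 0
  have "D j \<le> D 0" for j using assms(1)[of 0 j] by (cases j) auto
  then show ?case using assms(2) by (auto intro!: Greatest_equality)
next
  case (Suc i)
  have "D j \<le> D (Suc i)" if "D j < D i" for j
  proof -
    have "\<not> j \<le> i" using assms(1)[of j i] that by (cases "j = i") auto
    then show ?thesis using assms(1)[of "Suc i" j] by (cases "j = Suc i") auto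
  qed
  moreover have "D (Suc i) \<in> A" using assms(2) by blast
  ultimately show ?case using assms Suc by (auto intro!: Greatest_equality)
qed

lemma dec_enum_Un_lessThan:
  fixes A :: "int set"
  assumes A: "finite A" "\<And>a. a \<in> A \<Longrightarrow> b \<le> a"
  defines "D \<equiv> \<lambda>i. if i < card A then desc_list A ! i else b - 1 - int (i - card A)"
  shows "dec_enum (A \<union> {x. x < b}) i = D i" "\<And>i j. i < j \<Longrightarrow> D j < D i"
proof -
  have nth: "desc_list A ! i \<in> A" if "i < card A" for i
    using that A nth_mem[of i "desc_list A"] by simp
  show dec: "D j < D i" if "i < j" for i j
  proof (cases "j < card A")
    case True
    then show ?thesis using that sorted_wrt_nth_less[OF sorted_wrt_desc_list, of i j A] by (simp add: D_def)
  next
    case False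
    then show ?thesis using that A(2)[OF nth[of i]] by (auto simp: D_def)
  qed
  have "range D = A \<union> {x. x < b}"
  proof (intro equalityI subsetI)
    fix x assume "x \<in> A \<union> {x. x < b}"
    then consider "x \<in> set (desc_list A)" | "x < b" using A(1) by auto
    then show "x \<in> range D"
    proof cases
      case 1
      then obtain i where "i < card A" "desc_list A ! i = x" by (auto simp: in_set_conv_nth)
      then show ?thesis by (auto simp: D_def intro!: rev_image_eqI[of i])
    next
      case 2
      then show ?thesis by (intro rev_image_eqI[of "nat (b - 1 - x) + card A"]) (auto simp: D_def)
    qed
  qed (auto simp: D_def nth)
  then show "dec_enum (A \<union> {x. x < b}) i = D i" using dec by (intro dec_enum_eq)
qed

text \<open>The parameter \<open>c\<close> is the color being added: \<open>c = 1\<close> treats the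
  core with index \<open>m\<close>, \<open>c = 0\<close> the one with index \<open>- m\<close>. Both
  cores then have the parts \<open>2 * a - 1\<close> for positive
  \<open>a = M - 2 * i\<close>.\<close>

locale core_filling =
  fixes m c :: nat
  assumes c: "c = 0 \<or> c = 1"
begin

abbreviation top_exponent :: int ("M") where
  "M \<equiv> 2 * int m - int c"

abbreviation base :: "nat \<Rightarrow> nat" where
  "base \<equiv> core (if c = 1 then int m else - int m)"

text \<open>
  Row \<open>i\<close> (counted from 0) is labelled by \<open>a = M - 2 * i\<close>; for \<open>a > 0\<close> the core has the part
  \<open>2 * a - 1\<close> there, and exactly the columns \<open>2 * a\<close> and \<open>2 * a + 1\<close> may be filled.
\<close>

definition row_value :: "int set \<Rightarrow> int set \<Rightarrow> int \<Rightarrow> int" where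
  "row_value U V a = (if a < 0 then 0 else if a = 0 then (if 0 \<in> U then 1 else 0)
     else if a \<in> U then 2 * a else if (a \<in> V) = (c = 1) then 2 * a - 1 else 2 * a + 1)"

definition filled :: "int set \<times> int set \<Rightarrow> nat \<Rightarrow> nat" where
  "filled = (\<lambda>(U, V) i. nat (row_value U V (M - 2 * int i)))"

text \<open>Describes the members of \<open>I_set c n base\<close> for all \<open>n\<close>
  together, by a condition on each row separately; see \<open>I_set_base\<close>.\<close>

definition fillable :: "(nat \<Rightarrow> nat) \<Rightarrow> bool" where
  "fillable mu \<longleftrightarrow> (\<forall>i. (0 < M - 2 * int i \<longrightarrow>
       2 * (M - 2 * int i) - 1 \<le> int (mu i) \<and> int (mu i) \<le> 2 * (M - 2 * int i) + 1) \<and>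
     (M - 2 * int i = 0 \<longrightarrow> mu i \<le> 1) \<and> (M - 2 * int i < 0 \<longrightarrow> mu i = 0))"

lemma base_eq: "int (base i) = (if 0 < M - 2 * int i then 2 * (M - 2 * int i) - 1 else 0)"
  using c by (auto simp: core_def)

lemma row_value_nonneg: "0 \<le> row_value U V a"
  by (simp add: row_value_def)

lemma int_filled: "int (filled (U, V) i) = row_value U V (M - 2 * int i)"
  by (simp add: filled_def row_value_nonneg)

lemma fillable_filled: "fillable (filled (U, V))"
  unfolding fillable_def
proof (intro allI conjI impI)
  fix i
  let ?a = "M - 2 * int i"
  show "2 * ?a - 1 \<le> int (filled (U, V) i)" "int (filled (U, V) i) \<le> 2 * ?a + 1" if "0 < ?a"
    using that unfolding int_filled by (auto simp: row_value_def)
  show "filled (U, V) i \<le> 1" if "?a = 0"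
    unfolding filled_def prod.case that by (simp add: row_value_def)
  show "filled (U, V) i = 0" if "?a < 0"
    using that unfolding filled_def prod.case by (simp add: row_value_def)
qed

text \<open>Consecutive labels differ by 2, so the largest value \<open>2 * (a - 2) + 1\<close> of a
  row with positive label is below the smallest value \<open>2 * a - 1\<close> of the row before.
  Strictness is thus automatic, and the rows can be filled independently.\<close>

lemma fillable_decreasing:
  assumes "fillable mu"
  shows "mu (Suc i) < mu i \<or> mu (Suc i) = 0"
proof -
  define a where "a = M - 2 * int i"
  have i: "0 < a \<longrightarrow> 2 * a - 1 \<le> int (mu i)" using assms by (simp add: fillable_def a_def)
  have "M - 2 * int (Suc i) = a - 2" by (simp add: a_def)
  then have s: "0 < a - 2 \<longrightarrow> int (mu (Suc i)) \<le> 2 * (a - 2) + 1" "a - 2 = 0 \<longrightarrow> mu (Suc i) \<le> 1"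
      "a - 2 < 0 \<longrightarrow> mu (Suc i) = 0"
    using assms unfolding fillable_def by metis+
  consider "0 < a - 2" | "a - 2 = 0" | "a - 2 < 0" by linarith
  then show ?thesis
  proof cases
    case 1
    then have "2 * a - 1 \<le> int (mu i)" "int (mu (Suc i)) \<le> 2 * (a - 2) + 1" using i s(1) by auto
    moreover have "2 * (a - 2) + 1 < 2 * a - 1" by simp
    ultimately have "int (mu (Suc i)) < int (mu i)" by (meson order.strict_trans1 order.strict_trans2)
    then show ?thesis by simp
  next
    case 2
    then have "2 * a - 1 \<le> int (mu i)" "mu (Suc i) \<le> 1" using i s(2) by auto
    then have "int (mu (Suc i)) < int (mu i)" using 2 by linarith
    then show ?thesis by simp
  next
    case 3
    then show ?thesis using s(3) by simp
  qed
qed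

lemma fillable_antimono: "fillable mu \<Longrightarrow> antimono mu"
  unfolding antimono_iff_le_Suc using fillable_decreasing by (metis less_or_eq_imp_le zero_le)

lemma fillable_zero: "fillable mu \<Longrightarrow> m < i \<Longrightarrow> mu i = 0"
  by (simp add: fillable_def)

lemma fillable_strict:
  assumes "fillable mu"
  shows "mu \<in> strict_partitions"
proof -
  have "{i. mu i \<noteq> 0} \<subseteq> {..m}" using fillable_zero[OF assms] by (metis (mono_tags) atMost_iff mem_Collect_eq not_le subsetI)
  then have "finite {i. mu i \<noteq> 0}" by (rule finite_subset) simp
  moreover have "inj_on mu {i. mu i \<noteq> 0}"
  proof (rule linorder_inj_onI)
    fix i j assume ij: "i < j" "i \<in> {i. mu i \<noteq> 0}" "j \<in> {i. mu i \<noteq> 0}"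
    have "mu j \<le> mu (Suc i)" using antimonoD[OF fillable_antimono[OF assms], of "Suc i" j] ij by simp
    then show "mu i \<noteq> mu j" using fillable_decreasing[OF assms, of i] ij by auto
  qed auto
  ultimately show ?thesis
    using fillable_antimono[OF assms] by (simp add: strict_partitions_def is_partition_def)
qed

lemma part_size_eq:
  assumes "\<And>i. m < i \<Longrightarrow> mu i = 0"
  shows "part_size mu = (\<Sum>i\<le>m. mu i)"
proof -
  have "i \<le> m" if "mu i \<noteq> 0" for i using assms[of i] that by (cases "i \<le> m") auto
  then show ?thesis unfolding part_size_def by (intro sum.mono_neutral_left) auto
qed

lemma node_color_window:
  assumes "0 < M - 2 * int i" "int j = 2 * (M - 2 * int i) \<or> int j = 2 * (M - 2 * int i) + 1"
  shows "node_color (i, j) = c"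
proof -
  have "int j = 4 * (int m - int i) - 2 * int c \<or> int j = 4 * (int m - int i) - 2 * int c + 1"
    using assms(2) by auto
  then have "j mod 4 = (if c = 0 then 0 else 2) \<or> j mod 4 = (if c = 0 then 1 else 3)"
    using c nat_mod_4[of j "int m - int i" 0] nat_mod_4[of j "int m - int i" 1]
      nat_mod_4[of j "int m - int i - 1" 2] nat_mod_4[of j "int m - int i - 1" 3]
    by (elim disjE) simp_all
  then show ?thesis using c by (auto simp: node_color_def)
qed

text \<open>In a row with positive label only two columns beyond the core have color
  \<open>c\<close> before the color changes. The row with label 0 exists only for
  \<open>c = 0\<close> and admits column 1 alone; later rows stay empty, by color if
  \<open>c = 1\<close> and by strictness if \<open>c = 0\<close>.\<close>

lemma I_set_base:
  "I_set c n base = {mu. fillable mu \<and> (\<Sum>i\<le>m. mu i) = (\<Sum>i\<le>m. base i) + n}"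
proof (intro equalityI subsetI)
  have base0: "base i = 0" if "m < i" for i
  proof -
    have "int (base i) = 0" using that by (simp only: base_eq) simp
    then show ?thesis by simp
  qed
  {
    fix mu assume mu: "mu \<in> I_set c n base"
    then have strict: "mu \<in> strict_partitions" and sub: "young_diagram base \<subseteq> young_diagram mu"
      and size: "part_size mu = part_size base + n"
      and col: "\<And>x. x \<in> young_diagram mu - young_diagram base \<Longrightarrow> node_color x = c"
      by (auto simp: I_set_def)
    have anti: "antimono mu" and inj: "inj_on mu {i. mu i \<noteq> 0}"
      using strict by (auto simp: strict_partitions_def is_partition_def)
    have c': "node_color (i, j) = c" if "base i < j" "j \<le> mu i" for i j
      by (rule col) (use that in \<open>auto simp: young_diagram_def\<close>)
    have lower: "base i \<le> mu i" for i
      using sub by (cases "base i = 0") (auto simp: young_diagram_def subset_iff)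
    have upper: "int (mu i) \<le> 2 * (M - 2 * int i) + 1" if a: "0 < M - 2 * int i" for i
    proof (rule ccontr)
      assume *: "\<not> ?thesis"
      \<comment> \<open>The first column beyond the two fillable ones; it has the other
        color.\<close>
      define j where "j = nat (2 * (M - 2 * int i) + 2)"
      have j: "int j = 2 * (M - 2 * int i) + 2" using a by (simp add: j_def)
      have "int (base i) < int j" "int j \<le> int (mu i)" using * a by (simp_all only: base_eq j) auto
      then have "node_color (i, j) = c" using c' by simp
      moreover have "int j = 4 * (int m - int i) - 2 * int c + 2" using j by simp
      then have "j mod 4 = (if c = 0 then 2 else 0)"
        using c nat_mod_4[of j "int m - int i" 2] nat_mod_4[of j "int m - int i" 0]
        by (elim disjE) simp_all
      ultimately show False using c by (auto simp: node_color_def split: if_splits)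
    qed
    have zero: "mu i \<le> 1" if "M - 2 * int i = 0" for i
    proof (rule ccontr)
      assume *: "\<not> ?thesis"
      have "int (base i) = 0" using that by (simp only: base_eq) simp
      then have "node_color (i, 2) = c" using c'[of i 2] * by simp
      moreover have "c = 0" using that c by presburger
      ultimately show False by (simp add: node_color_def)
    qed
    have neg: "mu i = 0" if "M - 2 * int i < 0" for i
    proof (rule ccontr)
      assume *: "\<not> ?thesis"
      have "int (base i) = 0" using that by (simp only: base_eq) simp
      then have "node_color (i, 1) = c" using c'[of i 1] * by simp
      then have c0: "c = 0" by (simp add: node_color_def)
      \<comment> \<open>Column 1 has color 0, so color alone does not exclude this row; a second
        part 1 below row \<open>m\<close> contradicts strictness.\<close>
      then have im: "m < i" using that by simp
      then have "mu i \<le> mu m" using antimonoD[OF anti, of m i] by simp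
      moreover have "mu m \<le> 1" using zero[of m] c0 by simp
      ultimately have "mu i = mu m" "mu m \<noteq> 0" using * by auto
      then have "i = m" using inj_onD[OF inj, of i m] * by auto
      then show False using im by simp
    qed
    have fill: "fillable mu"
      unfolding fillable_def
    proof (intro allI conjI impI)
      fix i assume a: "0 < M - 2 * int i"
      show "2 * (M - 2 * int i) - 1 \<le> int (mu i)"
        using lower[of i] base_eq[of i] a by (simp split: if_splits)
    qed (use upper zero neg in auto)
    moreover have "(\<Sum>i\<le>m. mu i) = (\<Sum>i\<le>m. base i) + n"
      using size part_size_eq[of mu, OF fillable_zero[OF fill]] part_size_eq[of base, OF base0] by simp
    ultimately show "mu \<in> {mu. fillable mu \<and> (\<Sum>i\<le>m. mu i) = (\<Sum>i\<le>m. base i) + n}" by simp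
  }
  {
    fix mu assume "mu \<in> {mu. fillable mu \<and> (\<Sum>i\<le>m. mu i) = (\<Sum>i\<le>m. base i) + n}"
    then have fill: "fillable mu" and size: "(\<Sum>i\<le>m. mu i) = (\<Sum>i\<le>m. base i) + n" by auto
    have lower: "base i \<le> mu i" for i
    proof -
      have "int (base i) \<le> int (mu i)" unfolding base_eq using fill by (simp add: fillable_def)
      then show ?thesis by simp
    qed
    have col: "node_color (i, j) = c" if j: "1 \<le> j" "j \<le> mu i" "\<not> j \<le> base i" for i j
    proof (cases "0 < M - 2 * int i")
      case True
      then have "int (mu i) \<le> 2 * (M - 2 * int i) + 1" using fill by (simp add: fillable_def)
      moreover have "int (base i) = 2 * (M - 2 * int i) - 1" using True base_eq[of i] by simp
      ultimately have "int j = 2 * (M - 2 * int i) \<or> int j = 2 * (M - 2 * int i) + 1" using j by linarith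
      then show ?thesis by (rule node_color_window[OF True])
    next
      case False
      have "M - 2 * int i = 0"
      proof (rule ccontr)
        assume "M - 2 * int i \<noteq> 0"
        then have "mu i = 0" using False fill by (auto simp: fillable_def)
        then show False using j by simp
      qed
      then have "mu i \<le> 1" "c = 0" using fill c by (auto simp: fillable_def) presburger
      then show ?thesis using j by (simp add: node_color_def)
    qed
    show "mu \<in> I_set c n base"
      unfolding I_set_def mem_Collect_eq
    proof (intro conjI ballI)
      show "mu \<in> strict_partitions" by (rule fillable_strict[OF fill])
      show "young_diagram base \<subseteq> young_diagram mu"
        using lower by (auto simp: young_diagram_def intro: order.trans)
      show "part_size mu = part_size base + n"
        using size part_size_eq[of mu, OF fillable_zero[OF fill]] part_size_eq[of base, OF base0] by simp
      fix x assume "x \<in> young_diagram mu - young_diagram base"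
      then obtain i j where "x = (i, j)" "1 \<le> j" "j \<le> mu i" "\<not> j \<le> base i"
        by (auto simp: young_diagram_def)
      then show "node_color x = c" using col by simp
    qed
  }
qed

section \<open>Sums over row labels and the size of a filling\<close>

lemma sum_rows:
  fixes f :: "int \<Rightarrow> 'b::comm_monoid_add"
  assumes "\<And>a. a < 0 \<Longrightarrow> f a = 0"
  shows "(\<Sum>i\<le>m. f (M - 2 * int i)) = (\<Sum>a\<in>window M. f a)"
proof -
  have "(\<Sum>a\<in>window M. f a) = (\<Sum>i | 2 * int i \<le> M. f (M - 2 * int i))"
  proof (rule sum.reindex_bij_witness[of _ "\<lambda>i. M - 2 * int i" "\<lambda>a. nat ((M - a) div 2)"])
    fix a assume a: "a \<in> window M"
    then have "(M - a) mod 2 = 0" "a \<le> M" "0 \<le> a" unfolding window_def by auto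
    then show "M - 2 * int (nat ((M - a) div 2)) = a" "nat ((M - a) div 2) \<in> {i. 2 * int i \<le> M}"
      by auto
    then show "f (M - 2 * int (nat ((M - a) div 2))) = f a" by simp
  qed (auto simp: window_def)
  also have "\<dots> = (\<Sum>i\<le>m. f (M - 2 * int i))"
    by (rule sum.mono_neutral_left) (use assms in auto)
  finally show ?thesis by simp
qed

lemma card_window: "card (window M - {0}) = m" "card (window M) = (if c = 1 then m else Suc m)"
proof -
  have "card (window M - {0}) = (\<Sum>a\<in>window M. if 0 < a then 1 else 0)"
    by (subst sum.inter_filter[symmetric, OF finite_window])
      (auto simp: window_def intro!: arg_cong[of _ _ card])
  also have "\<dots> = (\<Sum>i\<le>m. if 0 < M - 2 * int i then 1 else 0)"
    by (rule sum_rows[symmetric]) simp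
  also have "\<dots> = card {..<m}"
  proof -
    have "{i \<in> {..m}. 0 < M - 2 * int i} = {..<m}" using c by auto
    then show ?thesis by (subst sum.inter_filter[symmetric]) auto
  qed
  finally show 1: "card (window M - {0}) = m" by simp
  have "0 \<in> window M \<longleftrightarrow> c = 0" using c by (auto simp: window_def)
  then show "card (window M) = (if c = 1 then m else Suc m)"
    using 1 c card_Suc_Diff1[OF finite_window, of 0 M] by auto
qed

text \<open>A row in \<open>U\<close> gains one node. Two nodes are gained by the rows in
  \<open>V\<close> if \<open>c = 0\<close>, but by the rows outside \<open>U\<close> and
  \<open>V\<close> if \<open>c = 1\<close>; hence the number of exponents is \<open>n\<close> in one
  case and its complement \<open>2 * m - n\<close> in the other.\<close>

lemma filled_size:
  assumes UV: "U \<subseteq> window M" "V \<subseteq> window M - {0}" "U \<inter> V = {}"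
  shows "int (\<Sum>i\<le>m. filled (U, V) i) - int (\<Sum>i\<le>m. base i) =
    (if c = 1 then 2 * int m - int (card U) - 2 * int (card V) else int (card U) + 2 * int (card V))"
proof -
  let ?f = "\<lambda>a. row_value U V a - (if 0 < a then 2 * a - 1 else 0)"
  have "V \<subseteq> window M" using UV(2) by blast
  then have fin: "finite U" "finite V" using UV(1) by (auto intro: finite_subset[OF _ finite_window])
  have "int (\<Sum>i\<le>m. filled (U, V) i) - int (\<Sum>i\<le>m. base i) = (\<Sum>i\<le>m. ?f (M - 2 * int i))"
    by (simp only: of_nat_sum int_filled base_eq sum_subtractf)
  also have "\<dots> = (\<Sum>a\<in>window M. ?f a)"
    by (rule sum_rows) (simp add: row_value_def)
  also have "\<dots> = (\<Sum>a\<in>window M. (if a \<in> U then 1 else 0) + 2 * (if (a \<in> V) \<noteq> (c = 1) \<and> a \<notin> U then 1 else 0))"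
    by (rule sum.cong[OF refl]) (use UV c in \<open>auto simp: row_value_def window_def\<close>)
  also have "\<dots> = (\<Sum>a\<in>window M. if a \<in> U then 1 else 0) +
      2 * (\<Sum>a\<in>window M. if (a \<in> V) \<noteq> (c = 1) \<and> a \<notin> U then 1 else 0)"
    by (simp only: sum.distrib sum_distrib_left)
  also have "(\<Sum>a\<in>window M. if a \<in> U then 1 else 0) = int (card U)"
    using UV by (subst sum.inter_filter[symmetric]) (auto intro!: arg_cong[of _ _ card])
  also have "(\<Sum>a\<in>window M. if (a \<in> V) \<noteq> (c = 1) \<and> a \<notin> U then 1 else 0) =
      int (card {a \<in> window M. (a \<in> V) \<noteq> (c = 1) \<and> a \<notin> U})"
    by (subst sum.inter_filter[symmetric]) auto
  also have "int (card {a \<in> window M. (a \<in> V) \<noteq> (c = 1) \<and> a \<notin> U}) =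
      (if c = 1 then int m - int (card U) - int (card V) else int (card V))"
  proof (cases "c = 1")
    case True
    have "{a \<in> window M. (a \<in> V) \<noteq> (c = 1) \<and> a \<notin> U} = window M - (U \<union> V)" using True by auto
    moreover have "card (U \<union> V) = card U + card V" using fin UV by (simp add: card_Un_disjoint)
    moreover have "U \<union> V \<subseteq> window M" using UV by auto
    moreover have "card (U \<union> V) \<le> card (window M)" using \<open>U \<union> V \<subseteq> window M\<close> by (rule card_mono[OF finite_window])
    ultimately show ?thesis using True card_window fin by (simp add: card_Diff_subset of_nat_diff)
  next
    case False
    have "{a \<in> window M. (a \<in> V) \<noteq> (c = 1) \<and> a \<notin> U} = V" using False UV by auto
    then show ?thesis using False by simp
  qed
  finally show ?thesis using c by auto
qed

text \<open>With \<open>matched_rows\<close>, the inverse of \<open>filled\<close>: it recovers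
  \<open>U\<close>, whose rows carry an even part, or the part 1 at label 0. The label
  \<open>a\<close> sits in row \<open>(M - a) div 2\<close>.\<close>

definition full_rows :: "(nat \<Rightarrow> nat) \<Rightarrow> int set" where
  "full_rows mu = {a \<in> window M. int (mu (nat ((M - a) div 2))) = (if a = 0 then 1 else 2 * a)}"

definition matched_rows :: "(nat \<Rightarrow> nat) \<Rightarrow> int set" where
  "matched_rows mu = {a \<in> window M - {0}.
     int (mu (nat ((M - a) div 2))) = (if c = 1 then 2 * a - 1 else 2 * a + 1)}"

lemma fillable_surj:
  assumes "fillable mu"
  obtains U V where "U \<subseteq> window M" "V \<subseteq> window M - {0}" "U \<inter> V = {}" "mu = filled (U, V)"
proof -
  define U where "U = full_rows mu"
  define V where "V = matched_rows mu"
  note UV_defs = U_def V_def full_rows_def matched_rows_def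
  have disj: "U \<inter> V = {}" by (auto simp: UV_defs)
  have "mu i = filled (U, V) i" for i
  proof -
    let ?a = "M - 2 * int i"
    have row: "nat ((M - ?a) div 2) = i" by simp
    have w: "?a \<in> window M" if "0 \<le> ?a" using that by (simp add: window_def)
    have U: "?a \<in> U \<longleftrightarrow> int (mu i) = (if ?a = 0 then 1 else 2 * ?a)" if "0 \<le> ?a"
      using w[OF that] by (auto simp only: U_def full_rows_def mem_Collect_eq row)
    have V: "?a \<in> V \<longleftrightarrow> int (mu i) = (if c = 1 then 2 * ?a - 1 else 2 * ?a + 1)" if "0 < ?a"
    proof -
      have "?a \<in> window M - {0}" using w that by auto
      then show ?thesis by (auto simp only: V_def matched_rows_def mem_Collect_eq row)
    qed
    consider "?a < 0" | "?a = 0" | "0 < ?a" by linarith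
    then have "int (mu i) = row_value U V ?a"
    proof cases
      case 1
      then show ?thesis using assms by (simp add: fillable_def row_value_def)
    next
      case 2
      then have "mu i \<le> 1" using assms by (simp add: fillable_def)
      then show ?thesis using U 2 by (auto simp: row_value_def)
    next
      case 3
      then have "2 * ?a - 1 \<le> int (mu i)" "int (mu i) \<le> 2 * ?a + 1" using assms by (simp_all add: fillable_def)
      then have "int (mu i) = 2 * ?a - 1 \<or> int (mu i) = 2 * ?a \<or> int (mu i) = 2 * ?a + 1" by linarith
      moreover have "row_value U V a = y"
        if "0 < a" "y = 2 * a - 1 \<or> y = 2 * a \<or> y = 2 * a + 1" "a \<in> U \<longleftrightarrow> y = 2 * a"
          "a \<in> V \<longleftrightarrow> y = (if c = 1 then 2 * a - 1 else 2 * a + 1)" for a y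
        using that by (auto simp: row_value_def)
      ultimately show ?thesis using U V 3 by simp
    qed
    then show ?thesis using int_filled[of U V i] by simp
  qed
  then have "mu = filled (U, V)" by (rule ext)
  moreover have "U \<subseteq> window M" unfolding U_def full_rows_def by (rule Collect_restrict)
  moreover have "V \<subseteq> window M - {0}" unfolding V_def matched_rows_def by (rule Collect_restrict)
  ultimately show ?thesis using that disj by blast
qed

lemma rows_filled:
  assumes "U \<subseteq> window M" "V \<subseteq> window M - {0}" "U \<inter> V = {}"
  shows "full_rows (filled (U, V)) = U" "matched_rows (filled (U, V)) = V"
proof -
  have *: "int (filled (U, V) (nat ((M - a) div 2))) = row_value U V a" if "a \<in> window M" for a
  proof -
    have "(M - a) mod 2 = 0" "a \<le> M" using that unfolding window_def by auto
    then have "M - 2 * int (nat ((M - a) div 2)) = a" by auto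
    then show ?thesis by (simp only: int_filled)
  qed
  have w: "0 \<le> a" if "a \<in> U \<union> V" for a using that assms by (auto simp: window_def)
  have e: "{a \<in> S. int (filled (U, V) (nat ((M - a) div 2))) = g a} = {a \<in> S. row_value U V a = g a}"
    if "S \<subseteq> window M" for g S
    using * that by auto
  show "full_rows (filled (U, V)) = U"
    unfolding full_rows_def e[OF order_refl] using assms by (auto simp: row_value_def split: if_splits dest: w[OF UnI1] w[OF UnI2])
  show "matched_rows (filled (U, V)) = V"
    unfolding matched_rows_def e[OF Diff_subset] using assms by (auto simp: row_value_def split: if_splits dest: w[OF UnI1] w[OF UnI2])
qed

lemma inj_on_filled: "inj_on filled (exponent_pairs M k)"
proof (rule inj_onI, clarify)
  fix U V U' V' assume P: "(U, V) \<in> exponent_pairs M k" "(U', V') \<in> exponent_pairs M k"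
    and eq: "filled (U, V) = filled (U', V')"
  have "full_rows (filled (U, V)) = U \<and> matched_rows (filled (U, V)) = V"
    if "(U, V) \<in> exponent_pairs M k" for U V
    using that by (intro conjI rows_filled) (auto simp: exponent_pairs_def)
  from this[OF P(1)] this[OF P(2)] show "U = U' \<and> V = V'" unfolding eq by blast
qed

lemma I_set_eq_filled:
  assumes "int k = (if c = 1 then 2 * int m - int n else int n)"
  shows "I_set c n base = filled ` exponent_pairs M k"
proof (intro equalityI subsetI)
  fix mu assume "mu \<in> I_set c n base"
  then have mu: "fillable mu" "(\<Sum>i\<le>m. mu i) = (\<Sum>i\<le>m. base i) + n"
    unfolding I_set_base by blast+
  obtain U V where UV: "U \<subseteq> window M" "V \<subseteq> window M - {0}" "U \<inter> V = {}" "mu = filled (U, V)"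
    by (rule fillable_surj[OF mu(1)])
  have "int (\<Sum>i\<le>m. filled (U, V) i) - int (\<Sum>i\<le>m. base i) = int n"
    unfolding mu(2)[unfolded UV(4)] by simp
  then have "int (card U + 2 * card V) = int k"
    unfolding filled_size[OF UV(1-3)] using assms by (auto split: if_splits)
  then have "(U, V) \<in> exponent_pairs M k" using UV by (simp add: exponent_pairs_def)
  then show "mu \<in> filled ` exponent_pairs M k" using UV(4) by blast
next
  fix mu assume "mu \<in> filled ` exponent_pairs M k"
  then obtain U V where UV: "(U, V) \<in> exponent_pairs M k" "mu = filled (U, V)" by auto
  then have s: "U \<subseteq> window M" "V \<subseteq> window M - {0}" "U \<inter> V = {}" "card U + 2 * card V = k"
    by (auto simp: exponent_pairs_def)
  have "int (\<Sum>i\<le>m. filled (U, V) i) - int (\<Sum>i\<le>m. base i) = int n"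
    unfolding filled_size[OF s(1-3)] using assms s(4) by (auto split: if_splits)
  then have "int (\<Sum>i\<le>m. mu i) = int ((\<Sum>i\<le>m. base i) + n)"
    unfolding UV(2) of_nat_add by linarith
  then show "mu \<in> I_set c n base"
    unfolding I_set_base using fillable_filled UV(2) by (simp only: of_nat_eq_iff) simp
qed

end

section \<open>Quotients and signs\<close>

lemma card_int_eq:
  fixes f :: "int \<Rightarrow> int"
  assumes "finite A" "inj_on f A" "\<And>a. a \<in> A \<Longrightarrow> 0 \<le> f a"
  shows "finite {p. \<exists>a\<in>A. int p = f a}" "card {p. \<exists>a\<in>A. int p = f a} = card A"
proof -
  have "{p. \<exists>a\<in>A. int p = f a} = (\<lambda>a. nat (f a)) ` A"
  proof (intro equalityI subsetI)
    fix p assume "p \<in> {p. \<exists>a\<in>A. int p = f a}"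
    then obtain a where "a \<in> A" "int p = f a" by blast
    then show "p \<in> (\<lambda>a. nat (f a)) ` A" by (intro image_eqI[of _ _ a]) (auto dest: sym)
  qed (use assms(3) in auto)
  moreover have "inj_on (\<lambda>a. nat (f a)) A"
    using assms(2,3) eq_nat_nat_iff unfolding inj_on_def by blast
  ultimately show "finite {p. \<exists>a\<in>A. int p = f a}" "card {p. \<exists>a\<in>A. int p = f a} = card A"
    using assms(1) by (simp_all add: card_image)
qed

context core_filling
begin

text \<open>The labels have the parity of \<open>c\<close>, so \<open>matched_part\<close> is always
  1 modulo 4 and \<open>empty_part\<close> always 3. This is why the state \<open>a \<in> V\<close>
  means an unfilled row for \<open>c = 1\<close> and a doubly filled one for
  \<open>c = 0\<close>.\<close>

abbreviation matched_part :: "int \<Rightarrow> int" where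
  "matched_part a \<equiv> if c = 1 then 2 * a - 1 else 2 * a + 1"

abbreviation empty_part :: "int \<Rightarrow> int" where
  "empty_part a \<equiv> if c = 1 then 2 * a + 1 else 2 * a - 1"

lemma window_parity: "a \<in> window M \<Longrightarrow> \<exists>s. a = 2 * s + int c"
proof -
  assume "a \<in> window M"
  then have "even (M - a)" by (simp add: window_def)
  then obtain t where "M - a = 2 * t" by (rule dvdE)
  then have "a = 2 * (int m - int c - t) + int c" by simp
  then show ?thesis by blast
qed

lemma mem_parts_filled:
  "p \<in> nonzero_parts (filled (U, V)) \<longleftrightarrow> 0 < p \<and> (\<exists>a\<in>window M. int p = row_value U V a)"
proof
  assume p: "p \<in> nonzero_parts (filled (U, V))"
  then obtain i where i: "p = filled (U, V) i" "0 < p" by (auto simp: nonzero_parts_def)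
  then have v: "int p = row_value U V (M - 2 * int i)" by (simp only: int_filled)
  moreover have "0 \<le> M - 2 * int i"
    using v i(2) by (simp add: row_value_def split: if_splits)
  then have "M - 2 * int i \<in> window M" by (simp add: window_def)
  ultimately show "0 < p \<and> (\<exists>a\<in>window M. int p = row_value U V a)" using i(2) by blast
next
  assume "0 < p \<and> (\<exists>a\<in>window M. int p = row_value U V a)"
  then obtain a where a: "0 < p" "a \<in> window M" "int p = row_value U V a" by blast
  have "(M - a) mod 2 = 0" "a \<le> M" using a(2) unfolding window_def by auto
  then have "M - 2 * int (nat ((M - a) div 2)) = a" by auto
  then have "int (filled (U, V) (nat ((M - a) div 2))) = int p" by (simp only: int_filled a(3))
  then show "p \<in> nonzero_parts (filled (U, V))"
    using a(1) by (auto simp: nonzero_parts_def intro: rev_image_eqI)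
qed

context
  fixes U V :: "int set" and k :: nat
  assumes P: "(U, V) \<in> exponent_pairs M k"
begin

abbreviation parts :: "nat set" where
  "parts \<equiv> nonzero_parts (filled (U, V))"

abbreviation exponent_list :: "int list" where
  "exponent_list \<equiv> sorted_list_of_set (exponents U V)"

lemmas PD = exponent_pairsD[OF P]

lemma U_window: "a \<in> U \<Longrightarrow> a \<in> window M" and V_window: "a \<in> V \<Longrightarrow> a \<in> window M"
  using PD(4,5) by auto

lemma mem_exponents:
  "y \<in> exponents U V \<longleftrightarrow> (if 0 < y then y \<in> U \<or> y \<in> V else if y = 0 then 0 \<in> U else - y \<in> V)"
proof -
  have "y \<in> uminus ` V \<longleftrightarrow> - y \<in> V" by force
  then show ?thesis using PD(6) PD(7)[of y] PD(8)[of y] PD(8)[of "- y"]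
    by (auto simp: exponents_def)
qed

lemma even_parts: "p \<in> parts \<and> even p \<longleftrightarrow> (\<exists>a\<in>U - {0}. int p = 2 * a)"
proof
  assume p: "p \<in> parts \<and> even p"
  then obtain a where a: "0 < p" "a \<in> window M" "int p = row_value U V a" by (auto simp: mem_parts_filled)
  have "even (int p)" "0 < int p" using p a(1) by simp_all
  then have ev: "even (row_value U V a)" "0 < row_value U V a" by (simp_all only: a(3))
  have "0 \<le> a" using a(2) by (simp add: window_def)
  then have "a \<in> U \<and> a \<noteq> 0 \<and> row_value U V a = 2 * a"
    using ev unfolding row_value_def by (auto split: if_splits)
  then have "a \<in> U" "a \<noteq> 0" "int p = 2 * a" unfolding a(3) by auto
  then show "\<exists>a\<in>U - {0}. int p = 2 * a" by blast
next
  assume "\<exists>a\<in>U - {0}. int p = 2 * a"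
  then obtain a where a: "a \<in> U" "a \<noteq> 0" "int p = 2 * a" by blast
  then have "0 < a" using PD(7)[of a] by simp
  then have "int p = row_value U V a" "0 < p" using a by (auto simp: row_value_def)
  moreover have "even (int p)" using a by simp
  then have "even p" by simp
  ultimately show "p \<in> parts \<and> even p"
    unfolding mem_parts_filled using U_window[OF a(1)] by blast
qed

lemma mod_4_cases:
  assumes "a \<in> window M"
  shows "int p = 2 * a - 1 \<Longrightarrow> p mod 4 = (if c = 1 then 1 else 3)"
    "int p = 2 * a + 1 \<Longrightarrow> p mod 4 = (if c = 1 then 3 else 1)"
    "int p = 2 * a \<Longrightarrow> even p"
proof -
  obtain s where s: "a = 2 * s + int c" using window_parity[OF assms] by blast
  show "p mod 4 = (if c = 1 then 1 else 3)" if "int p = 2 * a - 1"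
    using that c nat_mod_4[of p s 1] nat_mod_4[of p "s - 1" 3] by (auto simp: s)
  show "p mod 4 = (if c = 1 then 3 else 1)" if "int p = 2 * a + 1"
    using that c nat_mod_4[of p s 1] nat_mod_4[of p s 3] by (auto simp: s)
  show "even p" if "int p = 2 * a"
  proof -
    have "even (int p)" using that by simp
    then show ?thesis by simp
  qed
qed

lemma odd_mod_4: "p mod 4 = 1 \<Longrightarrow> odd (p :: nat)" "p mod 4 = 3 \<Longrightarrow> odd p"
  by presburger+

lemma parts_mod_1:
  "p \<in> parts \<and> p mod 4 = 1 \<longleftrightarrow>
    (\<exists>a\<in>V. int p = matched_part a) \<or> (p = 1 \<and> 0 \<in> U)"
proof
  assume p: "p \<in> parts \<and> p mod 4 = 1"
  then obtain a where a: "0 < p" "a \<in> window M" "int p = row_value U V a" by (auto simp: mem_parts_filled)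
  have o: "odd p" using p odd_mod_4 by blast
  have an: "0 \<le> a" using a(2) by (simp add: window_def)
  show "(\<exists>a\<in>V. int p = matched_part a) \<or> (p = 1 \<and> 0 \<in> U)"
  proof (cases "a = 0")
    case True
    then show ?thesis using a(1,3) by (simp add: row_value_def split: if_splits)
  next
    case False
    then have "a \<notin> U" using o a mod_4_cases(3)[OF a(2), of p] an by (auto simp: row_value_def)
    moreover have "a \<in> V"
    proof (rule ccontr)
      assume "a \<notin> V"
      then have "int p = empty_part a"
        using a(3) False an \<open>a \<notin> U\<close> by (simp add: row_value_def)
      then show False using mod_4_cases(1,2)[OF a(2), of p] p by (auto split: if_splits)
    qed
    ultimately show ?thesis using a(3) False an by (auto simp: row_value_def)
  qed
next
  assume "(\<exists>a\<in>V. int p = matched_part a) \<or> (p = 1 \<and> 0 \<in> U)"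
  then show "p \<in> parts \<and> p mod 4 = 1"
  proof
    assume "\<exists>a\<in>V. int p = matched_part a"
    then obtain a where a: "a \<in> V" "int p = matched_part a" by blast
    have "a \<notin> U" "0 < a" using a PD(3,8) by auto
    then have "int p = row_value U V a" "0 < int p" using a by (auto simp: row_value_def)
    then show ?thesis
      using V_window[OF a(1)] mod_4_cases(1,2)[OF V_window[OF a(1)], of p] a(2)
      by (auto simp: mem_parts_filled split: if_splits)
  next
    assume "p = 1 \<and> 0 \<in> U"
    then show ?thesis using U_window[of 0] by (auto simp: mem_parts_filled row_value_def intro!: bexI[of _ 0])
  qed
qed

lemma parts_mod_3:
  "p \<in> parts \<and> p mod 4 = 3 \<longleftrightarrow>
    (\<exists>a\<in>window M - {0} - U - V. int p = empty_part a)"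
proof
  assume p: "p \<in> parts \<and> p mod 4 = 3"
  then obtain a where a: "0 < p" "a \<in> window M" "int p = row_value U V a" by (auto simp: mem_parts_filled)
  have o: "odd p" using p odd_mod_4 by blast
  have an: "0 \<le> a" using a(2) by (simp add: window_def)
  have a0: "a \<noteq> 0" using a p by (auto simp: row_value_def split: if_splits)
  have "a \<notin> U" using o a mod_4_cases(3)[OF a(2), of p] an a0 by (auto simp: row_value_def)
  moreover have "a \<notin> V"
  proof
    assume "a \<in> V"
    then have "int p = matched_part a"
      using a(3) a0 an \<open>a \<notin> U\<close> by (simp add: row_value_def)
    then show False using mod_4_cases(1,2)[OF a(2), of p] p by (auto split: if_splits)
  qed
  ultimately have "int p = empty_part a" "a \<in> window M - {0} - U - V"
    using a(2,3) a0 an by (auto simp: row_value_def)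
  then show "\<exists>a\<in>window M - {0} - U - V. int p = empty_part a" by blast
next
  assume "\<exists>a\<in>window M - {0} - U - V. int p = empty_part a"
  then obtain a where a: "a \<in> window M" "a \<noteq> 0" "a \<notin> U" "a \<notin> V"
    "int p = empty_part a" by blast
  have "0 < a" using a by (auto simp: window_def less_le)
  then have "int p = row_value U V a" "0 < int p" using a by (auto simp: row_value_def)
  then show "p \<in> parts \<and> p mod 4 = 3"
    using a(1) mod_4_cases(1,2)[OF a(1), of p] a(5) by (auto simp: mem_parts_filled split: if_splits)
qed

lemma quotient0_filled: "quotient0 (filled (U, V)) = strict_partition_of (nat ` (U - {0}))"
proof -
  have "{p div 2 | p. p \<in> parts \<and> even p} = nat ` (U - {0})"
  proof (intro equalityI subsetI)
    fix x assume "x \<in> {p div 2 | p. p \<in> parts \<and> even p}"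
    then obtain p a where "x = p div 2" "a \<in> U - {0}" "int p = 2 * a" unfolding even_parts by blast
    then have "x = nat a" by auto
    then show "x \<in> nat ` (U - {0})" using \<open>a \<in> U - {0}\<close> by blast
  next
    fix x assume "x \<in> nat ` (U - {0})"
    then obtain a where a: "x = nat a" "a \<in> U - {0}" by blast
    then have "int (2 * x) = 2 * a" using PD(7)[of a] by simp
    then have "2 * x \<in> parts \<and> even (2 * x)" using even_parts a(2) by blast
    then show "x \<in> {p div 2 | p. p \<in> parts \<and> even p}" by force
  qed
  then show ?thesis by (simp add: quotient0_def)
qed

text \<open>The map from \<open>x\<close> to \<open>- 2 * x - c\<close> carries the Maya diagram to
  the exponents. For \<open>x\<close> \<ge> 0 a part \<open>4 * x + 1\<close> is the matched part of
  \<open>2 * x + c\<close>, whose negative is an exponent. For \<open>x < 0\<close> a bead means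
  that \<open>- 2 * x - c\<close> is not an empty row: it lies in \<open>U\<close> or
  \<open>V\<close>, or it exceeds \<open>M\<close>, that is \<open>x < - m\<close>.\<close>

lemma mem_maya: "x \<in> maya (filled (U, V)) \<longleftrightarrow> - 2 * x - int c \<in> exponents U V \<or> x < - int m"
proof (cases "0 \<le> x")
  case True
  have "x \<in> maya (filled (U, V)) \<longleftrightarrow> 4 * nat x + 1 \<in> parts"
    using True by (auto simp: maya_def intro!: exI[of _ "nat x"])
  also have "\<dots> \<longleftrightarrow> 4 * nat x + 1 \<in> parts \<and> (4 * nat x + 1) mod 4 = 1"
    by simp
  also have "\<dots> \<longleftrightarrow> (\<exists>a\<in>V. 4 * x + 1 = matched_part a) \<or> (x = 0 \<and> 0 \<in> U)"
    unfolding parts_mod_1 using True by (auto simp: nat_eq_iff)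
  also have "\<dots> \<longleftrightarrow> 2 * x + int c \<in> V \<or> (x = 0 \<and> 0 \<in> U)"
  proof -
    have "4 * x + 1 = matched_part a \<longleftrightarrow> a = 2 * x + int c" for a
      using c by auto
    then show ?thesis by auto
  qed
  also have "\<dots> \<longleftrightarrow> - 2 * x - int c \<in> exponents U V"
  proof -
    have "0 \<in> U \<Longrightarrow> c = 0" using U_window[of 0] c by (auto simp: window_def)
    then show ?thesis using True PD(6) c unfolding mem_exponents by (auto simp: add.commute)
  qed
  finally show ?thesis using True by simp
next
  case False
  define j where "j = nat (- x - 1)"
  have j: "x = - int j - 1" using False by (simp add: j_def)
  have "x \<in> maya (filled (U, V)) \<longleftrightarrow> 4 * j + 3 \<notin> parts"
    unfolding j by (auto simp: maya_def)
  also have "4 * j + 3 \<in> parts \<longleftrightarrow>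
      4 * j + 3 \<in> parts \<and> (4 * j + 3) mod 4 = 3"
    by simp
  also have "\<dots> \<longleftrightarrow> - 2 * x - int c \<in> window M - {0} - U - V"
  proof -
    have "int (4 * j + 3) = empty_part a \<longleftrightarrow> a = - 2 * x - int c" for a
      using c by (auto simp: j)
    then show ?thesis unfolding parts_mod_3 by auto
  qed
  also have "- 2 * x - int c \<in> window M - {0} - U - V \<longleftrightarrow>
      \<not> (- 2 * x - int c \<in> exponents U V \<or> x < - int m)"
    unfolding mem_exponents using c by (auto simp: j window_def)
  finally show ?thesis by blast
qed

lemma charge_filled: "charge (filled (U, V)) = int k - int m"
proof -
  have k: "k = card U + 2 * card V" using P by (simp add: exponent_pairs_def)
  have c1: "c = 1 \<Longrightarrow> 0 \<notin> U" using U_window[of 0] by (auto simp: window_def)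
  let ?V = "{p. \<exists>a\<in>V. int p = matched_part a}" and ?Z = "if 0 \<in> U then {1 :: nat} else {}"
  have "{p \<in> parts. p mod 4 = 1} = ?V \<union> ?Z"
    using parts_mod_1 by (auto split: if_splits)
  moreover have "?V \<inter> ?Z = {}"
  proof (cases "0 \<in> U")
    case True
    then have "int 1 \<noteq> matched_part a" if "a \<in> V" for a
      using PD(8)[OF that] c1 by auto
    then show ?thesis using True by auto
  qed simp
  moreover have inj: "inj_on matched_part V" by (simp add: inj_on_def)
  have "0 \<le> matched_part a" if "a \<in> V" for a using PD(8)[OF that] by auto
  note card_int_eq[OF PD(2) inj this]
  ultimately have one: "card {p \<in> parts. p mod 4 = 1} = card V + (if 0 \<in> U then 1 else 0)"
    by (simp add: card_Un_disjoint)
  let ?W = "window M - {0} - U - V"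
  have Wpos: "0 < a" if "a \<in> ?W" for a using that by (auto simp: window_def less_le)
  have "{p \<in> parts. p mod 4 = 3} = {p. \<exists>a\<in>?W. int p = empty_part a}"
    using parts_mod_3 by blast
  also have "card \<dots> = card ?W"
  proof (rule card_int_eq(2))
    show "0 \<le> empty_part a" if "a \<in> ?W" for a using Wpos[OF that] by auto
  qed (auto simp: inj_on_def)
  also have "?W = (window M - {0}) - ((U - {0}) \<union> V)" by auto
  also have "int (card \<dots>) = int m - int (card (U - {0})) - int (card V)"
  proof -
    have sub: "(U - {0}) \<union> V \<subseteq> window M - {0}" using PD(4,5,6) by auto
    have "card ((U - {0}) \<union> V) = card (U - {0}) + card V"
      using PD(1,2,3) by (intro card_Un_disjoint) auto
    moreover have "card ((U - {0}) \<union> V) \<le> m" using card_mono[OF _ sub] card_window(1) by simp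
    moreover have "card ((window M - {0}) - ((U - {0}) \<union> V)) = m - card ((U - {0}) \<union> V)"
      using card_Diff_subset[OF _ sub] PD(1,2) card_window(1) by simp
    ultimately show ?thesis by simp
  qed
  finally have three: "int (card {p \<in> parts. p mod 4 = 3}) = int m - int (card (U - {0})) - int (card V)" .
  have "int (card (U - {0})) = int (card U) - (if 0 \<in> U then 1 else 0)"
    using PD(1) card_Suc_Diff1[of U 0] by (auto split: if_splits)
  then show ?thesis unfolding charge_def three one k by (simp split: if_splits)
qed

lemma exponents_parity: "y \<in> exponents U V \<Longrightarrow> \<exists>s. y = 2 * s - int c"
proof -
  assume y: "y \<in> exponents U V"
  then have "y \<in> window M \<or> - y \<in> window M" using PD(4,5) by (auto simp: exponents_def)
  then obtain s where "y = 2 * s + int c \<or> - y = 2 * s + int c" using window_parity by blast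
  then have "y = 2 * (s + int c) - int c \<or> y = 2 * (- s) - int c" by (elim disjE) auto
  then show ?thesis by blast
qed

lemma exponents_bound: "y \<in> exponents U V \<Longrightarrow> y \<le> M"
  using PD(4,5) by (auto simp: exponents_def window_def)

text \<open>The inverse of the substitution in \<open>mem_maya\<close>; it reverses order, so
  increasing exponents give decreasing beads.\<close>

definition bead :: "int \<Rightarrow> int" where
  "bead y = - ((y + int c) div 2)"

lemma bead_exponent: "y \<in> exponents U V \<Longrightarrow> - 2 * bead y - int c = y"
  using exponents_parity[of y] by (auto simp: bead_def)

lemma maya_filled: "maya (filled (U, V)) = bead ` exponents U V \<union> {x. x < - int m}"
proof -
  have "- 2 * x - int c \<in> exponents U V \<longleftrightarrow> x \<in> bead ` exponents U V" for x
  proof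
    assume "- 2 * x - int c \<in> exponents U V"
    moreover have "x = bead (- 2 * x - int c)" by (simp add: bead_def)
    ultimately show "x \<in> bead ` exponents U V" by (rule rev_image_eqI)
  next
    assume "x \<in> bead ` exponents U V"
    then obtain y where "y \<in> exponents U V" "x = bead y" by blast
    then show "- 2 * x - int c \<in> exponents U V" using bead_exponent[of y] by simp
  qed
  then show ?thesis using mem_maya by blast
qed

lemma desc_list_beads:
  "desc_list (bead ` exponents U V) = map bead (exponent_list)"
proof -
  have "sorted_wrt (<) (exponent_list)" by simp
  then have "sorted_wrt (\<lambda>x y. bead x > bead y) (exponent_list)"
  proof (rule sorted_wrt_mono_rel[rotated])
    fix x y assume "x \<in> set (exponent_list)" "y \<in> set (exponent_list)" "x < y"
    then show "bead y < bead x" using bead_exponent[of x] bead_exponent[of y] PD(9) by simp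
  qed
  then have "sorted_wrt (>) (map bead (exponent_list))" by (simp add: sorted_wrt_map)
  then have "desc_list (set (map bead (exponent_list))) = map bead (exponent_list)"
    by (rule desc_list_set)
  then show ?thesis using PD(9) by simp
qed

text \<open>Above the half-line below \<open>- m\<close> the Maya diagram has \<open>k\<close>
  beads, one for each exponent, and the charge is \<open>k - m\<close>. Hence all parts from index
  \<open>k\<close> on vanish and a Jacobi-Trudi matrix of size \<open>k\<close> suffices.\<close>

lemma schur_quotient1_filled:
  "schur (quotient1 (filled (U, V))) u = det (mat k k (\<lambda>(i, j). h_poly u
     ((M - 2 * int k + 2 + 2 * int j - exponent_list ! i) div 2)))"
proof -
  let ?X = "exponent_list"
  let ?A = "bead ` exponents U V"
  define D where "D i = (if i < card ?A then desc_list ?A ! i else - int m - 1 - int (i - card ?A))" for i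
  have inj: "inj_on bead (exponents U V)" using bead_exponent by (metis inj_onI)
  have cardA: "card ?A = k" using inj PD(10) by (simp add: card_image)
  have finA: "finite ?A" using PD(9) by simp
  have low: "- int m \<le> a" if "a \<in> ?A" for a
    using that bead_exponent exponents_bound by force
  have maya: "dec_enum (maya (filled (U, V))) i = D i" for i
    unfolding maya_filled D_def by (rule dec_enum_Un_lessThan(1)[OF finA low])
  have dec: "D j < D i" if "i < j" for i j
    using dec_enum_Un_lessThan(2)[OF finA low that] by (simp add: D_def)
  have D1: "D i = bead (?X ! i)" if "i < k" for i
    using that cardA PD(10) by (simp add: D_def desc_list_beads)
  have D2: "D i = - int m - 1 - int (i - k)" if "k \<le> i" for i
    using that by (simp add: D_def cardA)
  let ?l = "quotient1 (filled (U, V))"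
  have l: "?l i = nat (D i + int (i + 1) - (int k - int m))" for i
    unfolding quotient1_def maya charge_filled ..
  have "D (Suc i) + int (Suc i + 1) - z \<le> D i + int (i + 1) - z" for i z
    using dec[of i "Suc i"] by simp
  then have anti: "antimono ?l"
    unfolding antimono_iff_le_Suc l by (intro allI nat_mono)
  have zero: "?l i = 0" if "k \<le> i" for i
    using that unfolding l D2[OF that] by simp
  \<comment> \<open>Strict decrease, counted down from index \<open>k\<close>, shows that
    \<open>nat\<close> does not truncate.\<close>
  have "D i \<ge> - int m - 1 + int (k - i)" if "i \<le> k" for i
    using that
  proof (induction rule: inc_induct)
    case base
    then show ?case by (simp add: D2)
  next
    case (step i)
    then show ?case using dec[of i "Suc i"] by (simp add: of_nat_diff)
  qed
  then have pos: "int (?l i) = D i + int i + 1 - int k + int m" if "i < k" for i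
    using that unfolding l by (smt (verit) less_imp_le_nat nat_0_le of_nat_1 of_nat_add of_nat_diff)
  have "int (?l i) + int j - int i = (M - 2 * int k + 2 + 2 * int j - ?X ! i) div 2" if "i < k" for i j
  proof -
    have "?X ! i \<in> exponents U V" using that PD(9,10) nth_mem[of i ?X] by simp
    then have "?X ! i = - 2 * bead (?X ! i) - int c" using bead_exponent by simp
    then have "M - 2 * int k + 2 + 2 * int j - ?X ! i = 2 * (int m - int k + 1 + int j + bead (?X ! i))" by simp
    then show ?thesis using pos[OF that] D1[OF that] by simp
  qed
  then have "mat k k (\<lambda>(i, j). h_poly u (int (?l i) + int j - int i)) = mat k k (\<lambda>(i, j). h_poly u
     ((M - 2 * int k + 2 + 2 * int j - ?X ! i) div 2))"
    by (intro eq_matI) auto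
  moreover have "schur ?l u = det (mat k k (\<lambda>(i, j). h_poly u (int (?l i) + int j - int i)))"
    by (rule schur_eq_det[OF anti]) (rule zero)
  ultimately show ?thesis by simp
qed

text \<open>Beads that are 1 modulo 4 come from \<open>V\<close>, even ones from \<open>U\<close>
  and the extra bead at 0. If \<open>c = 1\<close>, every \<open>a\<close> is odd, the factor
  \<open>- ((-1) ^ nat a)\<close> is 1 and no bead is added. If \<open>c = 0\<close>, the factor is
  -1, and the bead at 0 compensates it by changing each count by one.\<close>

lemma delta_filled:
  "delta (if c = 1 then int m else - int m) (filled (U, V)) = (pair_sign U V :: 'r::comm_ring_1)"
proof -
  let ?k = "if c = 1 then int m else - int m"
  let ?B = "beads ?k (filled (U, V))"
  \<comment> \<open>Halves of the even bead positions. For \<open>c = 0\<close> and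
    \<open>m > 0\<close> this toggles 0: label 0 in \<open>U\<close> gives the part 1, which is odd
    and blocks the bead at 0, while an empty row with label 0 creates that bead.\<close>
  define U' where "U' = (if c = 1 then U else if 0 \<in> U then U - {0} else if 0 < m then insert 0 U else U)"
  have c1: "c = 1 \<Longrightarrow> 0 \<notin> U" using U_window[of 0] by (auto simp: window_def)
  have U'n: "0 \<le> a" if "a \<in> U'" for a using that PD(7) by (auto simp: U'_def split: if_splits)
  have finU': "finite U'" using PD(1) by (simp add: U'_def)
  have zero_bead: "0 \<in> ?B \<longleftrightarrow> c = 0 \<and> 0 < m \<and> 0 \<notin> U"
    using c by (auto simp: beads_def nonzero_parts_def filled_def row_value_def)
  have pos_bead: "p \<in> ?B \<longleftrightarrow> p \<in> parts" if "0 < p" for p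
    using that by (auto simp: beads_def)
  have ev: "p \<in> ?B \<and> even p \<longleftrightarrow> (\<exists>a\<in>U'. int p = 2 * a)" for p
  proof (cases "p = 0")
    case True
    then show ?thesis using zero_bead c c1 by (auto simp: U'_def)
  next
    case False
    then have "p \<in> ?B \<and> even p \<longleftrightarrow> (\<exists>a\<in>U - {0}. int p = 2 * a)"
      using pos_bead[of p] even_parts[of p] by simp
    also have "\<dots> \<longleftrightarrow> (\<exists>a\<in>U'. int p = 2 * a)" using False by (auto simp: U'_def)
    finally show ?thesis .
  qed
  have one: "q \<in> ?B \<and> q mod 4 = 1 \<longleftrightarrow>
      (\<exists>a\<in>V. int q = matched_part a) \<or> (q = 1 \<and> 0 \<in> U)" for q
  proof (cases "q = 0")
    case True
    have "matched_part a \<noteq> int q" if "a \<in> V" for a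
      using PD(8)[OF that] True by auto
    then show ?thesis using True by auto
  next
    case False
    then show ?thesis using pos_bead[of q] parts_mod_1[of q] by simp
  qed
  let ?q = "\<lambda>a. matched_part a"
  have disj: "u \<noteq> a" if "u \<in> U'" "a \<in> V" for u a
    using that PD(3,6) by (auto simp: U'_def split: if_splits)
  \<comment> \<open>The odd position differs by 1 from \<open>2 * a\<close>, and
    \<open>u \<noteq> a\<close>, so the choice between \<open>2 * a - 1\<close> and
    \<open>2 * a + 1\<close> does not matter.\<close>
  have lt: "2 * u < ?q a \<longleftrightarrow> u < a" if "u \<in> U'" "a \<in> V" for u a
    using disj[OF that] by auto
  let ?T = "{(p, q). p \<in> ?B \<and> q \<in> ?B \<and> even p \<and> q mod 4 = 1 \<and> p < q}"
  let ?S = "Sigma V (\<lambda>a. {u \<in> U'. u < a})"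
  have "bij_betw (\<lambda>(a, u). (nat (2 * u), nat (?q a))) ?S ?T"
  proof (rule bij_betw_imageI)
    have qpos: "0 \<le> ?q a" if "a \<in> V" for a using PD(8)[OF that] by auto
    show "inj_on (\<lambda>(a, u). (nat (2 * u), nat (?q a))) ?S"
    proof (rule inj_onI, clarify)
      fix a u a' u' assume A: "a \<in> V" "a' \<in> V" "u \<in> U'" "u' \<in> U'"
        and e: "nat (2 * u) = nat (2 * u')" "nat (?q a) = nat (?q a')"
      have "2 * u = 2 * u'" using e(1) U'n[OF A(3)] U'n[OF A(4)] by simp
      moreover have "?q a = ?q a'" using eq_nat_nat_iff[OF qpos[OF A(1)] qpos[OF A(2)]] e(2) by blast
      ultimately show "a = a' \<and> u = u'" by (auto split: if_splits)
    qed
    show "(\<lambda>(a, u). (nat (2 * u), nat (?q a))) ` ?S = ?T"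
    proof (intro equalityI subsetI)
      fix z assume "z \<in> (\<lambda>(a, u). (nat (2 * u), nat (?q a))) ` ?S"
      then obtain a u where z: "z = (nat (2 * u), nat (?q a))" and au: "a \<in> V" "u \<in> U'" "u < a" by auto
      have i: "int (nat (2 * u)) = 2 * u" "int (nat (?q a)) = ?q a" using U'n[OF au(2)] qpos[OF au(1)] by auto
      have "nat (2 * u) \<in> ?B \<and> even (nat (2 * u))" using ev i(1) au(2) by blast
      moreover have "nat (?q a) \<in> ?B \<and> nat (?q a) mod 4 = 1" using one i(2) au(1) by blast
      moreover have "int (nat (2 * u)) < int (nat (?q a))" unfolding i using lt au by blast
      then have "nat (2 * u) < nat (?q a)" by (simp only: of_nat_less_iff)
      ultimately show "z \<in> ?T" unfolding z by blast
    next
      fix z assume "z \<in> ?T"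
      then obtain p q where z: "z = (p, q)" "p \<in> ?B \<and> even p" "q \<in> ?B \<and> q mod 4 = 1" "p < q" by auto
      then obtain u where u: "u \<in> U'" "int p = 2 * u" using ev by blast
      \<comment> \<open>The bead at 1 coming from label 0 has only position 0 below it, which is
        then unoccupied.\<close>
      have "\<not> (q = 1 \<and> 0 \<in> U)"
      proof
        assume q: "q = 1 \<and> 0 \<in> U"
        then have "p = 0" using z by simp
        then show False using z zero_bead q by auto
      qed
      then obtain a where a: "a \<in> V" "int q = ?q a" using one z(3) by blast
      have "2 * u < ?q a" using z(4) u(2) a(2) by linarith
      then have "u < a" using lt u a by blast
      moreover have "z = (nat (2 * u), nat (?q a))" unfolding z(1) u(2)[symmetric] a(2)[symmetric] by simp
      ultimately show "z \<in> (\<lambda>(a, u). (nat (2 * u), nat (?q a))) ` ?S"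
        using u a by (intro image_eqI[of _ _ "(a, u)"]) auto
    qed
  qed
  then have "sign_exponent ?k (filled (U, V)) = card ?S"
    unfolding sign_exponent_def by (rule bij_betw_same_card[symmetric])
  also have "\<dots> = (\<Sum>a\<in>V. card {u \<in> U'. u < a})"
    using PD(2) finU' by (intro card_SigmaI) auto
  finally have "delta ?k (filled (U, V)) = (\<Prod>a\<in>V. (-1) ^ card {u \<in> U'. u < a} :: 'r)"
    by (simp add: delta_def power_sum)
  also have "\<dots> = pair_sign U V"
    unfolding pair_sign_def
  proof (rule prod.cong[OF refl])
    fix a assume a: "a \<in> V"
    then have a0: "0 < a" by (rule PD(8))
    obtain s where s: "a = 2 * s + int c" using window_parity V_window[OF a] by blast
    show "(-1) ^ card {u \<in> U'. u < a} = (-1) ^ card {u \<in> U. u < a} * - ((-1) ^ nat a :: 'r)"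
    proof (cases "c = 1")
      case True
      have "odd (nat a)" using a0 s True by (simp add: even_nat_iff)
      then show ?thesis by (simp add: U'_def True)
    next
      case False
      then have c0: "c = 0" using c by simp
      have e: "even (nat a)" using a0 s c0 by (simp add: even_nat_iff)
      have m: "0 < m" using V_window[OF a] a0 by (simp add: window_def c0)
      have finU: "finite {u \<in> U. u < a}" using PD(1) by simp
      have "card {u \<in> U'. u < a} = Suc (card {u \<in> U. u < a}) \<or> Suc (card {u \<in> U'. u < a}) = card {u \<in> U. u < a}"
      proof (cases "0 \<in> U")
        case True
        have "{u \<in> U'. u < a} = {u \<in> U. u < a} - {0}" using True c0 by (auto simp: U'_def)
        then show ?thesis using card_Suc_Diff1[OF finU, of 0] True a0 by simp
      next
        case False
        have "{u \<in> U'. u < a} = insert 0 {u \<in> U. u < a}" using False c0 m a0 by (auto simp: U'_def)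
        then show ?thesis using finU False by simp
      qed
      then have "(-1) ^ card {u \<in> U'. u < a} = - ((-1) ^ card {u \<in> U. u < a} :: 'r)"
      proof
        assume "Suc (card {u \<in> U'. u < a}) = card {u \<in> U. u < a}"
        from this[symmetric] show ?thesis by simp
      qed simp
      then show ?thesis using e by simp
    qed
  qed
  finally show ?thesis .
qed

end

text \<open>Writing \<open>k\<close> as the sum of the sizes of \<open>U \<union> V\<close> and
  \<open>V\<close>, at most \<open>card (window M)\<close> and \<open>m\<close>, gives
  \<open>2 * m\<close> for \<open>c = 1\<close> and \<open>2 * m + 1\<close> for
  \<open>c = 0\<close>, that is \<open>M + 1\<close>.\<close>

lemma exponent_pairs_bound:
  assumes "(U, V) \<in> exponent_pairs M k"
  shows "int k \<le> M + 1"
proof -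
  note D = exponent_pairsD[OF assms]
  have "card (U \<union> V) \<le> card (window M)" using D(4,5) by (intro card_mono) auto
  moreover have "card V \<le> m" using card_mono[of "window M - {0}" V] D(5,6) card_window(1) by auto
  moreover have "card (U \<union> V) = card U + card V" using D(1-3) by (rule card_Un_disjoint)
  moreover have "k = card U + 2 * card V" using assms by (simp add: exponent_pairs_def)
  ultimately show ?thesis using c unfolding card_window(2) by (auto split: if_splits)
qed

text \<open>Both identities at once. For \<open>c = 1\<close> the rectangle has
  \<open>2 * m - n\<close> rows of length \<open>n\<close>, for \<open>c = 0\<close> it has
  \<open>n\<close> rows of length \<open>2 * m + 1 - n\<close>.\<close>

theorem schur_rectangle:
  fixes t :: "nat \<Rightarrow> 'k::field_char_0 polys"
  assumes k: "int k = (if c = 1 then 2 * int m - int n else int n)"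
    and ne: "I_set c n base \<noteq> {}" and b: "int b = M + 1 - int k"
  shows "(\<Sum>mu \<in> I_set c n base. delta (if c = 1 then int m else - int m) mu *
      Q_fun (quotient0 mu) t * schur (quotient1 mu) (\<lambda>j. t (2 * j))) = schur (rect_partition k b) t"
proof -
  have I: "I_set c n base = filled ` exponent_pairs M k" by (rule I_set_eq_filled[OF k])
  then obtain U V where "(U, V) \<in> exponent_pairs M k" using ne by auto
  then have kM: "int k \<le> M + 1" by (rule exponent_pairs_bound)
  have "(\<Sum>mu \<in> I_set c n base. delta (if c = 1 then int m else - int m) mu *
      Q_fun (quotient0 mu) t * schur (quotient1 mu) (\<lambda>j. t (2 * j))) =
    (\<Sum>(U, V)\<in>exponent_pairs M k. pair_sign U V * Q_fun (strict_partition_of (nat ` (U - {0}))) t *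
       det (mat k k (\<lambda>(i, j). h_poly (\<lambda>j. t (2 * j))
         ((M - 2 * int k + 2 + 2 * int j - sorted_list_of_set (exponents U V) ! i) div 2))))"
    unfolding I sum.reindex[OF inj_on_filled] o_def
  proof (rule sum.cong[OF refl], clarify)
    fix U V assume P: "(U, V) \<in> exponent_pairs M k"
    show "delta (if c = 1 then int m else - int m) (filled (U, V)) * Q_fun (quotient0 (filled (U, V))) t *
        schur (quotient1 (filled (U, V))) (\<lambda>j. t (2 * j)) =
      pair_sign U V * Q_fun (strict_partition_of (nat ` (U - {0}))) t *
       det (mat k k (\<lambda>(i, j). h_poly (\<lambda>j. t (2 * j))
         ((M - 2 * int k + 2 + 2 * int j - sorted_list_of_set (exponents U V) ! i) div 2)))"
      by (simp only: delta_filled[OF P] quotient0_filled[OF P] schur_quotient1_filled[OF P])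
  qed
  also have "\<dots> = det (mat k k (\<lambda>(i, j). h_poly t (M + 1 - int k + int j - int i)))"
    by (rule rectangle_expansion[OF kM, symmetric])
  also have "\<dots> = det (mat k k (\<lambda>(i, j). h_poly t (int (rect_partition k b i) + int j - int i)))"
    by (intro arg_cong[of _ _ det] eq_matI) (auto simp: rect_partition_def b)
  also have "\<dots> = schur (rect_partition k b) t"
    by (rule schur_eq_det[symmetric]) (auto simp: rect_partition_def antimono_def)
  finally show ?thesis .
qed

end

theorem theorem3p1:
  fixes m n :: nat and t :: "nat \<Rightarrow> 'k::field_char_0 polys"
  defines "t \<equiv> var"
  shows
    "(\<Sum>mu \<in> I_set 1 n (core (int m)).
        delta (int m) mu * Q_fun (quotient0 mu) t * schur (quotient1 mu) (\<lambda>j. t (2 * j)))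
      = (if I_set 1 n (core (int m)) = {} then 0
         else schur (rect_partition (2 * m - n) n) t) \<and>
     (\<Sum>mu \<in> I_set 0 n (core (- int m)).
        delta (- int m) mu * Q_fun (quotient0 mu) t * schur (quotient1 mu) (\<lambda>j. t (2 * j)))
      = (if I_set 0 n (core (- int m)) = {} then 0
         else schur (rect_partition n (2 * m + 1 - n)) t)"
proof
  interpret odd: core_filling m 1 by unfold_locales simp
  interpret even: core_filling m 0 by unfold_locales simp
  show "(\<Sum>mu \<in> I_set 1 n (core (int m)).
        delta (int m) mu * Q_fun (quotient0 mu) t * schur (quotient1 mu) (\<lambda>j. t (2 * j)))
      = (if I_set 1 n (core (int m)) = {} then 0
         else schur (rect_partition (2 * m - n) n) t)"
  proof (cases "I_set 1 n (core (int m)) = {}")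
    case False
    then obtain mu where "odd.fillable mu" "(\<Sum>i\<le>m. mu i) = (\<Sum>i\<le>m. core (int m) i) + n"
      using odd.I_set_base[of n] by auto
    from odd.fillable_surj[OF this(1)] obtain U V where UV: "U \<subseteq> window (2 * int m - int 1)"
      "V \<subseteq> window (2 * int m - int 1) - {0}" "U \<inter> V = {}" "mu = odd.filled (U, V)" by blast
    have "int (\<Sum>i\<le>m. mu i) - int (\<Sum>i\<le>m. core (int m) i) = int n"
      using \<open>(\<Sum>i\<le>m. mu i) = _\<close> by simp
    \<comment> \<open>A non-empty index set makes the natural-number subtraction in the rectangle
      exact.\<close>
    then have "n \<le> 2 * m" using odd.filled_size[OF UV(1-3)] unfolding UV(4) by simp
    then have 1: "int (2 * m - n) = (if (1 :: nat) = 1 then 2 * int m - int n else int n)"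
      and 2: "int n = 2 * int m - int 1 + 1 - int (2 * m - n)"
      by simp_all
    have "I_set 1 n (core (if (1 :: nat) = 1 then int m else - int m)) \<noteq> {}" using False by simp
    from odd.schur_rectangle[OF 1 this 2, of t] False show ?thesis
      by (simp only: simp_thms if_True if_False)
  qed simp
  show "(\<Sum>mu \<in> I_set 0 n (core (- int m)).
        delta (- int m) mu * Q_fun (quotient0 mu) t * schur (quotient1 mu) (\<lambda>j. t (2 * j)))
      = (if I_set 0 n (core (- int m)) = {} then 0
         else schur (rect_partition n (2 * m + 1 - n)) t)"
  proof (cases "I_set 0 n (core (- int m)) = {}")
    case False
    then obtain U V where "(U, V) \<in> exponent_pairs (2 * int m - int 0) n"
      using even.I_set_eq_filled[of n n] by auto
    \<comment> \<open>Again this makes the subtraction exact.\<close>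
    then have "int n \<le> 2 * int m + 1" using even.exponent_pairs_bound by fastforce
    then have 1: "int (2 * m + 1 - n) = 2 * int m - int 0 + 1 - int n" by simp
    have 2: "int n = (if (0 :: nat) = 1 then 2 * int m - int n else int n)" by simp
    have "I_set 0 n (core (if (0 :: nat) = 1 then int m else - int m)) \<noteq> {}" using False by simp
    from even.schur_rectangle[OF 2 this 1, of t] False show ?thesis
      by (simp only: zero_neq_one simp_thms if_True if_False)
  qed simp
qed

end
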